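(* Let $G$ be an amenable second countable locally compact group, and let $H$ be a closed subgroup of finite covolume. Then $H$ is cocompact in $G$ if and only if $H$ is weakly cocompact in $G$.
   Context: A closed subgroup $H$ of a locally compact group $G$ is of finite covolume if $G/H$ carries a $G$-invariant probability measure $m$; it is cocompact if $G/H$ is compact. A measure-preserving action of a group $G$ on a probability space $(X,m)$ has the spectral gap if the unitary representation of $G$ on the space $L^2_0(X,m)$ of (classes of) $L^2$-functions of zero integral does not contain almost invariant vectors (i.e. there is no sequence of unit vectors $(v_n)$ with $\sup_{g\in K}\|gv_n-v_n\|\to 0$ for every compact subset $K\subset G$). A closed subgroup $H$ of finite covolume in a $\sigma$-compact locally compact group $G$ is weakly cocompact if the $G$-action on $G/H$ (with its $G$-invariant probability measure) has the spectral gap. *)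

theory Defs
  imports "HOL-Probability.Probability"
begin

text \<open>
  Topological groups are modelled by the type class \<^class>\<open>topological_group_add\<close>. The group
  operation is written additively but is not assumed to be commutative. Left translation by
  \<open>g\<close> is \<open>(+) g\<close>.
\<close>

definition closed_subgroup :: "'g::topological_group_add set \<Rightarrow> bool" where
  "closed_subgroup H \<longleftrightarrow>
     closed H \<and> 0 \<in> H \<and> (\<forall>x\<in>H. \<forall>y\<in>H. x + y \<in> H) \<and> (\<forall>x\<in>H. - x \<in> H)"


section \<open>Amenability\<close>

text \<open>
  Regularity of the measure is not listed: on a second countable locally compact Hausdorff
  space every Borel measure that is finite on compact sets is regular.
\<close>

definition left_haar_measure ::
    "'g::{topological_group_add, t2_space, second_countable_topology} measure \<Rightarrow> bool" where
  "left_haar_measure \<mu> \<longleftrightarrow>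
     sets \<mu> = sets borel \<and>
     emeasure \<mu> UNIV \<noteq> 0 \<and>
     (\<forall>K. compact K \<longrightarrow> emeasure \<mu> K < \<infinity>) \<and>
     (\<forall>g. distr \<mu> \<mu> ((+) g) = \<mu>)"

text \<open>Representatives of the elements of the real space \<open>L\<^sup>\<infinity>(\<mu>)\<close>.\<close>

definition Linfty :: "'x measure \<Rightarrow> ('x \<Rightarrow> real) set" where
  "Linfty \<mu> = {f \<in> borel_measurable \<mu>. \<exists>C. AE x in \<mu>. \<bar>f x\<bar> \<le> C}"

text \<open>
  A mean on \<open>L\<^sup>\<infinity>(\<mu>)\<close> is a normalized positive linear functional. Since positivity is only
  required to see functions up to null sets, \<open>M\<close> takes equal values on functions which agree
  almost everywhere, so it is indeed a functional on classes. Its values outside \<open>L\<^sup>\<infinity>(\<mu>)\<close> are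
  irrelevant.
\<close>

definition mean_on_Linfty :: "'x measure \<Rightarrow> (('x \<Rightarrow> real) \<Rightarrow> real) \<Rightarrow> bool" where
  "mean_on_Linfty \<mu> M \<longleftrightarrow>
     (\<forall>f\<in>Linfty \<mu>. \<forall>h\<in>Linfty \<mu>. M (\<lambda>x. f x + h x) = M f + M h) \<and>
     (\<forall>f\<in>Linfty \<mu>. \<forall>c. M (\<lambda>x. c * f x) = c * M f) \<and>
     (\<forall>f\<in>Linfty \<mu>. (AE x in \<mu>. 0 \<le> f x) \<longrightarrow> 0 \<le> M f) \<and>
     M (\<lambda>_. 1) = 1"

text \<open>
  A locally compact group is amenable if \<open>L\<^sup>\<infinity>\<close> (with respect to Haar measure) admits a left
  invariant mean. Haar measure being unique up to a positive factor, the space \<open>L\<^sup>\<infinity>\<close> does not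
  depend on the choice of \<open>\<mu>\<close>.
\<close>

definition amenable ::
    "'g::{topological_group_add, t2_space, second_countable_topology} itself \<Rightarrow> bool" where
  "amenable _ \<longleftrightarrow>
     (\<exists>(\<mu> :: 'g measure) M. left_haar_measure \<mu> \<and> mean_on_Linfty \<mu> M \<and>
        (\<forall>f\<in>Linfty \<mu>. \<forall>g. M (\<lambda>x. f (g + x)) = M f))"


section \<open>Coset spaces\<close>

definition left_coset :: "'g::group_add set \<Rightarrow> 'g \<Rightarrow> 'g set" where
  "left_coset H g = (+) g ` H"

definition coset_space :: "'g::group_add set \<Rightarrow> 'g set set" where
  "coset_space H = range (left_coset H)"

text \<open>The quotient topology on \<open>G/H\<close>.\<close>

definition coset_topology :: "'g::topological_group_add set \<Rightarrow> 'g set topology" where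
  "coset_topology H = topology (\<lambda>U. U \<subseteq> coset_space H \<and> open (left_coset H -` U))"

lemma openin_coset_topology:
  "openin (coset_topology H) U \<longleftrightarrow> U \<subseteq> coset_space H \<and> open (left_coset H -` U)"
proof -
  have "istopology (\<lambda>U. U \<subseteq> coset_space H \<and> open (left_coset H -` U))"
    unfolding istopology_def by (auto simp: vimage_Union)
  then show ?thesis
    by (simp add: coset_topology_def topology_inverse')
qed

lemma topspace_coset_topology: "topspace (coset_topology H) = coset_space H"
proof
  show "topspace (coset_topology H) \<subseteq> coset_space H"
    using openin_coset_topology[THEN iffD1, OF openin_topspace] by blast
  have "left_coset H -` coset_space H = UNIV"
    by (auto simp: coset_space_def)
  then show "coset_space H \<subseteq> topspace (coset_topology H)"
    by (intro openin_subset) (simp add: openin_coset_topology)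
qed

lemma quotient_map_left_coset: "quotient_map euclidean (coset_topology H) (left_coset H)"
  by (auto simp: quotient_map_def topspace_coset_topology openin_coset_topology
      coset_space_def vimage_def)

text \<open>The action of \<open>G\<close> on \<open>G/H\<close> by left translation.\<close>

definition coset_action :: "'g::group_add \<Rightarrow> 'g set \<Rightarrow> 'g set" where
  "coset_action g C = (+) g ` C"

lemma coset_action_left_coset: "coset_action g (left_coset H a) = left_coset H (g + a)"
  by (simp add: coset_action_def left_coset_def image_image add.assoc)

definition invariant_coset_probability ::
    "'g::topological_group_add set \<Rightarrow> 'g set measure \<Rightarrow> bool" where
  "invariant_coset_probability H m \<longleftrightarrow>
     space m = coset_space H \<and>
     sets m = sigma_sets (coset_space H) {U. openin (coset_topology H) U} \<and>
     prob_space m \<and>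
     (\<forall>g. distr m m (coset_action g) = m)"

definition finite_covolume :: "'g::topological_group_add set \<Rightarrow> bool" where
  "finite_covolume H \<longleftrightarrow> (\<exists>m. invariant_coset_probability H m)"

definition cocompact :: "'g::topological_group_add set \<Rightarrow> bool" where
  "cocompact H \<longleftrightarrow> compact_space (coset_topology H)"


section \<open>Spectral gap\<close>

text \<open>
  The elements of \<open>L\<^sup>2\<^sub>0(X,m)\<close> are represented by complex-valued functions. For a probability
  measure \<open>m\<close>, square integrable functions are integrable, so the last condition is meaningful.
\<close>

definition L2_0 :: "'x measure \<Rightarrow> ('x \<Rightarrow> complex) set" where
  "L2_0 m = {f \<in> borel_measurable m.
     integrable m (\<lambda>x. (cmod (f x))\<^sup>2) \<and> (\<integral>x. f x \<partial>m) = 0}"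

definition L2_norm :: "'x measure \<Rightarrow> ('x \<Rightarrow> complex) \<Rightarrow> real" where
  "L2_norm m f = sqrt (\<integral>x. (cmod (f x))\<^sup>2 \<partial>m)"

text \<open>The representation associated with an action: \<open>(g f)(x) = f(g\<^sup>-\<^sup>1 x)\<close>.\<close>

definition koopman :: "('g::group_add \<Rightarrow> 'x \<Rightarrow> 'x) \<Rightarrow> 'g \<Rightarrow> ('x \<Rightarrow> complex) \<Rightarrow> 'x \<Rightarrow> complex" where
  "koopman act g f = (\<lambda>x. f (act (- g) x))"

text \<open>
  The supremum is taken in \<^typ>\<open>ennreal\<close>, where it is well behaved also for \<open>K = {}\<close>.
\<close>

definition has_almost_invariant_vectors ::
    "('g::topological_group_add \<Rightarrow> 'x \<Rightarrow> 'x) \<Rightarrow> 'x measure \<Rightarrow> bool" where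
  "has_almost_invariant_vectors act m \<longleftrightarrow>
     (\<exists>v :: nat \<Rightarrow> 'x \<Rightarrow> complex.
        (\<forall>n. v n \<in> L2_0 m \<and> L2_norm m (v n) = 1) \<and>
        (\<forall>K. compact K \<longrightarrow>
           (\<lambda>n. SUP g\<in>K. ennreal (L2_norm m (\<lambda>x. koopman act g (v n) x - v n x)))
             \<longlonglongrightarrow> 0))"

definition spectral_gap ::
    "('g::topological_group_add \<Rightarrow> 'x \<Rightarrow> 'x) \<Rightarrow> 'x measure \<Rightarrow> bool" where
  "spectral_gap act m \<longleftrightarrow> \<not> has_almost_invariant_vectors act m"

text \<open>
  The invariant probability measure on \<open>G/H\<close> is unique when it exists. Quantifying over all of
  them, together with existence, avoids building this uniqueness into the definition.
\<close>

definition weakly_cocompact :: "'g::topological_group_add set \<Rightarrow> bool" where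
  "weakly_cocompact H \<longleftrightarrow>
     finite_covolume H \<and>
     (\<forall>m. invariant_coset_probability H m \<longrightarrow> spectral_gap coset_action m)"

end

theory Submission
  imports Defs
begin

text \<open>
  Write \<open>X = G/H\<close>, with invariant probability measure \<open>m\<close> and projection \<open>p\<close>, and let \<open>\<mu>\<close> be left Haar
  measure. Both implications compare \<open>m\<close> with the
  images of measures on \<open>G\<close> under the orbit maps \<open>g \<mapsto> g x\<close>.

  If \<open>H\<close> is cocompact, then \<open>p\<close> maps some compact set \<open>C\<close> onto \<open>X\<close>, so any two points of \<open>X\<close> differ
  by an element of the compact set \<open>C - C\<close>. The orbit averages of a nonnegative function over
  \<open>-S\<close>, where \<open>S\<close> is a compact neighbourhood of 0, are therefore bounded, whatever the base point, by
  the averages over \<open>-S'\<close> from any other base point, for one larger compact set \<open>S'\<close>: inversion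
  turns \<open>\<mu>\<close> into a right invariant measure. Applied to \<open>\<bar>v(x) - v(x')\<bar>\<^sup>2\<close> and integrated over \<open>x\<close> and
  \<open>x'\<close>, this is an inequality of Poincare type (\<open>poincare_inequality\<close>): the double integral, which is
  2 for a unit vector \<open>v\<close> of mean zero, is controlled by the displacements of \<open>v\<close> under \<open>S'\<close>.
  Hence no sequence of such vectors is almost invariant.

  If \<open>H\<close> is not cocompact, amenability is used through Reiter's condition (\<open>reiter_condition\<close>): there
  are probability densities on \<open>G\<close> which are moved little, in \<open>L\<^sup>1\<close>, by a given compact set. Push such a
  density to \<open>X\<close> along an orbit map whose base point is so far out that little mass falls on
  an open set which carries almost all of \<open>m\<close>. The image has a density \<open>\<phi>\<close> with respect to
  \<open>m\<close>, which is moved just as little. The unit vector \<open>sqrt \<phi>\<close> is then almost invariant, since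
  \<open>(sqrt a - sqrt b)\<^sup>2 \<le> \<bar>a - b\<bar>\<close>, and almost orthogonal to the constants, because it is concentrated on a set
  of small measure. Subtracting the mean and normalizing gives almost invariant vectors in
  \<open>L\<^sup>2\<^sub>0\<close> (\<open>not_cocompact_imp_almost_invariant_vectors\<close>).

  Reiter's condition is derived from an invariant mean \<open>M\<close> in two steps. The first
  (\<open>mean_smear_translate\<close>) is that \<open>M\<close>, composed with averaging over a compact set \<open>A\<close>, remains invariant when
  the averaging is performed after the translation. The second replaces the separation of convex
  sets in \<open>L\<^sup>1\<close> by a minimization in a Hilbert space (\<open>theorem_of_the_alternative\<close>). Suppose that all the
  averaged densities are moved by more than \<open>c\<close> in total by a finite set \<open>I\<close>. Then a least-squares
  problem over the unit ball of \<open>L\<^sup>\<infinity>\<close> has a minimizer, which is an exact solution of the dual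
  problem: bounded functions \<open>F g\<close> for \<open>g\<close> in \<open>I\<close>, such that the average over \<open>A\<close> of the sum of
  \<open>F g (g + x) - F g x\<close> is at least \<open>c\<close> almost everywhere. The mean \<open>M\<close> of this average is 0 by the first
  step, a contradiction. Averaged densities depend continuously on
  translation, so passing from finite to compact sets costs nothing.
\<close>


section \<open>Compact sets in topological groups\<close>

lemma measurable_group_uminus [measurable]:
  "(uminus :: 'g::{topological_group_add, second_countable_topology} \<Rightarrow> 'g) \<in> borel \<rightarrow>\<^sub>M borel"
  by (intro borel_measurable_continuous_onI continuous_intros)

lemma measurable_group_uminus' [measurable (raw)]:
  fixes f :: "'a \<Rightarrow> 'g::{topological_group_add, second_countable_topology}"
  shows "f \<in> borel_measurable M \<Longrightarrow> (\<lambda>x. - f x) \<in> borel_measurable M"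
  by (rule measurable_compose[OF _ measurable_group_uminus])

lemma compact_plus:
  fixes A B :: "'g::topological_monoid_add set"
  assumes "compact A" "compact B"
  shows "compact {a + b |a b. a \<in> A \<and> b \<in> B}"
proof -
  have "compact ((\<lambda>(a, b). a + b) ` (A \<times> B))"
    using assms by (intro compact_continuous_image compact_Times)
      (auto simp: case_prod_unfold intro!: continuous_intros)
  also have "(\<lambda>(a, b). a + b) ` (A \<times> B) = {a + b |a b. a \<in> A \<and> b \<in> B}"
    by auto
  finally show ?thesis .
qed

lemma compact_uminus:
  fixes A :: "'g::topological_group_add set"
  assumes "compact A" shows "compact (uminus ` A)"
  using assms by (intro compact_continuous_image continuous_intros)

lemma open_plus_set:
  fixes U A :: "'g::topological_group_add set"
  assumes "open U"
  shows "open {u + a |u a. u \<in> U \<and> a \<in> A}"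
proof -
  have "{u + a |u a. u \<in> U \<and> a \<in> A} = (\<Union>a\<in>A. (\<lambda>x. x + - a) -` U)" (is "?L = ?R")
  proof
    show "?L \<subseteq> ?R" by (auto simp: add.assoc)
    show "?R \<subseteq> ?L"
    proof
      fix x assume "x \<in> ?R"
      then obtain a where "a \<in> A" "x + - a \<in> U" by auto
      moreover have "x = (x + - a) + a" by (simp add: add.assoc)
      ultimately show "x \<in> ?L" by blast
    qed
  qed
  moreover have "open ((\<lambda>x. x + - a) -` U)" for a
    using assms by (intro open_vimage continuous_intros)
  ultimately show ?thesis by auto
qed

lemma compact_neighbourhood:
  fixes x :: "'a::topological_space"
  assumes "locally_compact_space (euclidean :: 'a topology)"
  obtains U K where "open U" "compact K" "x \<in> U" "U \<subseteq> K"
proof -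
  have "\<exists>U K. open U \<and> compact K \<and> x \<in> U \<and> U \<subseteq> K"
    using assms by (simp add: locally_compact_space_def)
  then show ?thesis using that by blast
qed

lemma compact_exhaustion:
  fixes type :: "'g::{t2_space, second_countable_topology} itself"
  assumes "locally_compact_space (euclidean :: 'g topology)"
  shows "\<exists>K :: nat \<Rightarrow> 'g set. (\<forall>n. compact (K n)) \<and> incseq K \<and>
    (\<forall>C. compact C \<longrightarrow> (\<exists>n. C \<subseteq> K n))"
proof -
  define F :: "'g set set" where "F = interior ` {K. compact K}"
  have cov: "\<Union>F = UNIV"
  proof -
    have "\<exists>K. compact K \<and> x \<in> interior K" for x :: 'g
    proof -
      obtain U K where "open U" "compact K" "x \<in> U" "U \<subseteq> K"
        by (rule compact_neighbourhood[OF assms, of x])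
      then show ?thesis by (intro exI[of _ K]) (auto intro: interiorI)
    qed
    then show ?thesis by (auto simp: F_def)
  qed
  have op: "\<And>S. S \<in> F \<Longrightarrow> open S" by (auto simp: F_def)
  obtain F' where F': "F' \<subseteq> F" "countable F'" "\<Union>F' = \<Union>F"
    by (rule Lindelof[OF op])
  have "\<exists>I. countable I \<and> I \<subseteq> {K. compact K} \<and> F' = interior ` I"
    using F'(1,2) unfolding F_def by (intro countable_subset_image[THEN iffD1]) auto
  then obtain I where I: "countable I" "I \<subseteq> {K. compact K}" "F' = interior ` I"
    by blast
  have "\<Union>F' = UNIV" using F'(3) cov by simp
  then have "I \<noteq> {}" using I(3) by (metis Union_empty empty_not_UNIV image_empty)
  then obtain c :: "nat \<Rightarrow> 'g set" where c: "range c = I"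
    using range_from_nat_into[OF _ I(1)] by blast
  define K where "K n = (\<Union>i\<le>n. c i)" for n :: nat
  have cc: "compact (c i)" for i using c I(2) by auto
  have 1: "compact (K n)" for n unfolding K_def using cc by (intro compact_UN) auto
  have 2: "incseq K" unfolding K_def by (intro incseq_SucI UN_mono) auto
  have 3: "\<exists>n. C \<subseteq> K n" if C: "compact C" for C
  proof -
    have "C \<subseteq> (\<Union>i. interior (c i))" using F'(3) I(3) c cov by auto
    then obtain J where J: "finite J" "C \<subseteq> (\<Union>i\<in>J. interior (c i))"
      using compactE_image[OF C, of UNIV "\<lambda>i. interior (c i)"] open_interior by metis
    obtain n where n: "\<forall>i\<in>J. i \<le> n" using J(1) finite_nat_set_iff_bounded_le by blast
    have "C \<subseteq> K n" unfolding K_def using J(2) n interior_subset by fastforce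
    then show ?thesis ..
  qed
  show ?thesis using 1 2 3 by blast
qed

text \<open>
  Take \<open>V\<close> with \<open>V + V \<subseteq> U\<close>; its closure lies in \<open>V + V\<close>, since every point of the closure differs by an
  element of \<open>V\<close> from a point of \<open>V\<close>.
\<close>

lemma small_compact_neighbourhood:
  fixes U :: "'g::{topological_group_add, t2_space} set"
  assumes lc: "locally_compact_space (euclidean :: 'g topology)" and U: "open U" "0 \<in> U"
  obtains V B where "open V" "0 \<in> V" "compact B" "V \<subseteq> B" "B \<subseteq> U"
proof -
  obtain W K where WK: "open W" "compact K" "(0::'g) \<in> W" "W \<subseteq> K"
    by (rule compact_neighbourhood[OF lc, of 0])
  have "open ((\<lambda>(a, b). a + b) -` U :: ('g \<times> 'g) set)"
    using U by (intro open_vimage) (auto simp: case_prod_unfold intro!: continuous_intros)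
  moreover have "(0, 0) \<in> (\<lambda>(a, b). a + b) -` U" using U by simp
  ultimately obtain P Q where PQ: "open P" "open Q" "0 \<in> P" "0 \<in> Q" "P \<times> Q \<subseteq> (\<lambda>(a, b). a + b) -` U"
    by (elim open_prod_elim) auto
  define V where "V = P \<inter> Q"
  have sub: "closure V \<subseteq> U"
  proof
    fix x assume x: "x \<in> closure V"
    have "open ((\<lambda>y. - y + x) -` V)"
      using PQ unfolding V_def by (intro open_vimage continuous_intros) auto
    moreover have "x \<in> (\<lambda>y. - y + x) -` V" using PQ by (simp add: V_def)
    ultimately have "V \<inter> (\<lambda>y. - y + x) -` V \<noteq> {}"
      using x unfolding closure_iff_nhds_not_empty by (drule_tac x = "(\<lambda>y. - y + x) -` V" in spec) auto
    then obtain y where "y \<in> V" "- y + x \<in> V"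
      by blast
    then have "y + (- y + x) \<in> U" using PQ(5) by (auto simp: V_def)
    then show "x \<in> U" by simp
  qed
  show ?thesis
  proof (rule that[of "V \<inter> W" "closure V \<inter> K"])
    show "compact (closure V \<inter> K)" using WK by (simp add: closed_Int_compact)
    show "open (V \<inter> W)" using PQ WK by (auto simp: V_def)
    show "V \<inter> W \<subseteq> closure V \<inter> K" using WK closure_subset by blast
  qed (use PQ WK sub in \<open>auto simp: V_def\<close>)
qed

section \<open>A theorem of the alternative for bounded functions\<close>

text \<open>
  A minimizing sequence need not converge when the minimum is attained on a large set. It does if,
  among the almost minimizers of \<open>J\<close>, one also picks points whose norm \<open>q\<close> is almost least. Midpoints of almost
  minimizers are almost minimizers, so they are not much shorter than the points chosen, and then the
  parallelogram law (the assumption on \<open>q\<close>) makes the distance \<open>d\<close> of late members small.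
\<close>

lemma minimizing_sequence_Cauchy:
  fixes J q :: "'a \<Rightarrow> real" and d :: "'a \<Rightarrow> 'a \<Rightarrow> real"
  assumes ne: "B \<noteq> {}"
    and mid: "\<And>a b. a \<in> B \<Longrightarrow> b \<in> B \<Longrightarrow> mid a b \<in> B"
    and J0: "\<And>a. a \<in> B \<Longrightarrow> 0 \<le> J a"
    and Jmid: "\<And>a b. a \<in> B \<Longrightarrow> b \<in> B \<Longrightarrow> J (mid a b) \<le> (J a + J b) / 2"
    and q0: "\<And>a. a \<in> B \<Longrightarrow> 0 \<le> q a" and qQ: "\<And>a. a \<in> B \<Longrightarrow> q a \<le> Q"
    and qmid: "\<And>a b. a \<in> B \<Longrightarrow> b \<in> B \<Longrightarrow> q (mid a b) \<le> (q a + q b) / 2 - d a b / 4"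
  shows "\<exists>F :: nat \<Rightarrow> 'a. (\<forall>n. F n \<in> B) \<and> (\<lambda>n. J (F n)) \<longlonglongrightarrow> Inf (J ` B) \<and>
    (\<forall>e>0. \<exists>K. \<forall>k\<ge>K. \<forall>l\<ge>k. d (F k) (F l) < e)"
proof -
  define j where "j = Inf (J ` B)"
  have bdd: "bdd_below (J ` B)" using J0 by (auto intro!: bdd_belowI[of _ 0])
  have jle: "j \<le> J a" if "a \<in> B" for a
    unfolding j_def using that bdd by (auto intro: cInf_lower)
  define S where "S k = {a \<in> B. J a < j + 1 / real (Suc k)}" for k
  have S_ne: "S k \<noteq> {}" for k
  proof -
    have "\<exists>x\<in>J ` B. x < j + 1 / real (Suc k)"
      using ne bdd by (intro cInf_lessD) (auto simp: j_def)
    then show ?thesis by (auto simp: S_def)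
  qed
  have S_mono: "S l \<subseteq> S k" if "k \<le> l" for k l
  proof -
    have "1 / real (Suc l) \<le> 1 / real (Suc k)" using that by (intro divide_left_mono) auto
    then show ?thesis by (auto simp: S_def)
  qed
  have bddq: "bdd_below (q ` S k)" for k using q0 by (auto intro!: bdd_belowI[of _ 0] simp: S_def)
  define m where "m k = Inf (q ` S k)" for k
  have mle: "m k \<le> q a" if "a \<in> S k" for a k
    unfolding m_def using that bddq by (auto intro: cInf_lower)
  have "\<exists>a\<in>S k. q a < m k + 1 / real (Suc k)" for k
  proof -
    have "\<exists>x\<in>q ` S k. x < m k + 1 / real (Suc k)"
      using S_ne bddq by (intro cInf_lessD) (auto simp: m_def)
    then show ?thesis by auto
  qed
  then obtain F where F: "\<And>k. F k \<in> S k" "\<And>k. q (F k) < m k + 1 / real (Suc k)"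
    by metis
  have FB: "F k \<in> B" for k using F(1)[of k] by (simp add: S_def)
  have inc: "incseq m"
    unfolding incseq_def m_def using S_mono S_ne bddq
    by (auto intro!: cInf_superset_mono image_mono)
  have mQ: "m k \<le> Q" for k
    using mle[OF F(1)] qQ[OF FB] by (rule order_trans)
  obtain L where L: "m \<longlonglongrightarrow> L" using incseq_convergent[OF inc, of Q] mQ by blast
  have mL: "m k \<le> L" for k using inc L by (rule incseq_le)
  have dist: "d (F k) (F l) \<le> 2 * (L - m k) + 4 / real (Suc k)" if "k \<le> l" for k l
  proof -
    have Fl: "F l \<in> S k" using F(1) S_mono[OF that] by blast
    have "J (mid (F k) (F l)) \<le> (J (F k) + J (F l)) / 2" using FB by (intro Jmid)
    also have "\<dots> < j + 1 / real (Suc k)" using F(1)[of k] Fl by (simp add: S_def)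
    finally have "mid (F k) (F l) \<in> S k" using mid FB by (simp add: S_def)
    then have "m k \<le> q (mid (F k) (F l))" by (rule mle)
    also have "\<dots> \<le> (q (F k) + q (F l)) / 2 - d (F k) (F l) / 4" using FB by (intro qmid)
    finally have "d (F k) (F l) \<le> 2 * q (F k) + 2 * q (F l) - 4 * m k" by (simp add: field_simps)
    moreover have "q (F l) < m l + 1 / real (Suc k)"
    proof -
      have "1 / real (Suc l) \<le> 1 / real (Suc k)" using that by (intro divide_left_mono) auto
      then show ?thesis using F(2)[of l] by simp
    qed
    moreover define e where "e = 1 / real (Suc k)"
    moreover have "4 / real (Suc k) = 4 * e" by (simp add: e_def)
    ultimately show ?thesis using F(2)[of k, folded e_def] mL[of l] by simp
  qed
  have "(\<lambda>k. 2 * (L - m k) + 4 * (1 / real (Suc k))) \<longlonglongrightarrow> 2 * (L - L) + 4 * 0"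
    by (intro tendsto_intros L LIMSEQ_Suc[OF lim_1_over_n])
  then have lim0: "(\<lambda>k. 2 * (L - m k) + 4 / real (Suc k)) \<longlonglongrightarrow> 0" by simp
  have "\<exists>K. \<forall>k\<ge>K. \<forall>l\<ge>k. d (F k) (F l) < e" if e: "e > 0" for e
  proof -
    obtain K where "\<forall>k\<ge>K. 2 * (L - m k) + 4 / real (Suc k) < e"
      using order_tendstoD(2)[OF lim0 e] by (auto simp: eventually_sequentially)
    then show ?thesis using dist by (meson le_less_trans)
  qed
  moreover have "(\<lambda>n. J (F n)) \<longlonglongrightarrow> j"
  proof (rule tendsto_sandwich)
    show "\<forall>\<^sub>F n in sequentially. j \<le> J (F n)" using jle FB by simp
    show "\<forall>\<^sub>F n in sequentially. J (F n) \<le> j + 1 / real (Suc n)"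
      using F(1) by (auto simp: S_def less_imp_le)
    have "(\<lambda>n. j + 1 / real (Suc n)) \<longlonglongrightarrow> j + 0"
      by (intro tendsto_intros LIMSEQ_Suc[OF lim_1_over_n])
    then show "(\<lambda>n. j + 1 / real (Suc n)) \<longlonglongrightarrow> j" by simp
  qed simp
  ultimately show ?thesis using FB unfolding j_def by blast
qed

text \<open>
  The bound is required at every point, so that dominated convergence and pointwise estimates apply to all
  members without exceptional sets.
\<close>

definition unit_ball_Linfty :: "'x measure \<Rightarrow> ('x \<Rightarrow> real) set" where
  "unit_ball_Linfty N = {F \<in> borel_measurable N. \<forall>y. \<bar>F y\<bar> \<le> 1}"

lemma unit_ball_LinftyD:
  assumes "F \<in> unit_ball_Linfty N"
  shows "F \<in> borel_measurable N" "\<bar>F y\<bar> \<le> 1"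
  using assms by (auto simp: unit_ball_Linfty_def)

lemma (in finite_measure) integrable_bounded:
  fixes f :: "'a \<Rightarrow> real"
  assumes "f \<in> borel_measurable M" "\<And>x. \<bar>f x\<bar> \<le> C"
  shows "integrable M f"
  using assms by (intro integrable_const_bound[of _ C]) auto

lemma convex_combination_unit_ball:
  assumes "F \<in> unit_ball_Linfty N" "G \<in> unit_ball_Linfty N" "0 \<le> t" "t \<le> 1"
  shows "(\<lambda>y. (1 - t) * F y + t * G y) \<in> unit_ball_Linfty N"
proof -
  have [measurable]: "F \<in> borel_measurable N" "G \<in> borel_measurable N"
    using assms by (auto simp: unit_ball_Linfty_def)
  have "\<bar>(1 - t) * F y + t * G y\<bar> \<le> 1" for y
  proof -
    have "\<bar>(1 - t) * F y + t * G y\<bar> \<le> (1 - t) * \<bar>F y\<bar> + t * \<bar>G y\<bar>"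
      using assms(3,4) by (intro order_trans[OF abs_triangle_ineq]) (simp add: abs_mult)
    also have "\<dots> \<le> (1 - t) * 1 + t * 1"
      using assms by (intro add_mono mult_left_mono) (auto simp: unit_ball_Linfty_def)
    finally show ?thesis by simp
  qed
  then show ?thesis by (auto simp: unit_ball_Linfty_def)
qed

text \<open>
  Along a subsequence with square distances below \<open>4\<^sup>-\<^sup>n\<close>, consecutive differences have \<open>L\<^sup>1\<close> norms which
  are summable, so that the differences are absolutely summable almost everywhere.
\<close>

lemma (in finite_measure) L2_Cauchy_AE_subseq:
  assumes F: "\<And>n :: nat. F n \<in> unit_ball_Linfty M"
    and Cau: "\<And>e. e > 0 \<Longrightarrow> \<exists>K. \<forall>k\<ge>K. \<forall>l\<ge>k. (\<integral>y. (F k y - F l y)\<^sup>2 \<partial>M) < (e :: real)"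
  shows "\<exists>r G. strict_mono r \<and> G \<in> unit_ball_Linfty M \<and> (AE y in M. (\<lambda>n. F (r n) y) \<longlonglongrightarrow> G y)"
proof -
  have [measurable]: "F n \<in> borel_measurable M" for n using unit_ball_LinftyD(1)[OF F] .
  have b: "\<bar>F n y\<bar> \<le> 1" for n y using unit_ball_LinftyD(2)[OF F] .
  have b2: "\<bar>F n y - F m y\<bar> \<le> 2" for n m y using b[of n y] b[of m y] by linarith
  have "\<forall>n::nat. \<exists>K. \<forall>k\<ge>K. \<forall>l\<ge>k. (\<integral>y. (F k y - F l y)\<^sup>2 \<partial>M) < (1/4)^n"
    by (intro allI Cau) simp
  then obtain K where K: "\<And>n k l. K n \<le> k \<Longrightarrow> k \<le> l \<Longrightarrow> (\<integral>y. (F k y - F l y)\<^sup>2 \<partial>M) < (1/4)^n"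
    by metis
  define r where "r n = (\<Sum>i\<le>n. K i) + n" for n
  have r: "strict_mono r" unfolding r_def by (intro strict_monoI_Suc) simp
  have Kr: "K n \<le> r n" for n
    unfolding r_def using member_le_sum[of n "{..n}" K] by simp
  define a where "a n y = F (r (Suc n)) y - F (r n) y" for n y
  have [measurable]: "a n \<in> borel_measurable M" for n unfolding a_def by measurable
  have ab: "\<bar>a n y\<bar> \<le> 2" for n y unfolding a_def by (rule b2)
  have int_a: "integrable M (\<lambda>y. \<bar>a n y\<bar>)" "integrable M (\<lambda>y. (a n y)\<^sup>2)" for n
  proof -
    have "(a n y)\<^sup>2 \<le> 2\<^sup>2" for y using ab[of n y] by (intro abs_le_square_iff[THEN iffD1]) simp
    then show "integrable M (\<lambda>y. \<bar>a n y\<bar>)" "integrable M (\<lambda>y. (a n y)\<^sup>2)"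
      using ab by (auto intro!: integrable_bounded[of "\<lambda>y. \<bar>a n y\<bar>" 2]
          integrable_bounded[of "\<lambda>y. (a n y)\<^sup>2" 4])
  qed
  have bound: "(\<integral>y. \<bar>a n y\<bar> \<partial>M) \<le> (1 + measure M (space M)) * (1/2)^n" for n
  proof -
    have "(\<integral>y. \<bar>a n y\<bar> \<partial>M) \<le> (\<integral>y. 2^n * (a n y)\<^sup>2 + (1/2)^n \<partial>M)"
    proof (intro integral_mono int_a Bochner_Integration.integrable_add integrable_mult_right)
      fix y
      \<comment> \<open>The Cauchy-Schwarz inequality, in the form \<open>\<bar>a\<bar> \<le> 2\<^sup>n a\<^sup>2 + 2\<^sup>-\<^sup>n\<close>.\<close>
      have "0 \<le> (2^n * \<bar>a n y\<bar> - 1)\<^sup>2" by simp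
      then have "2 * \<bar>a n y\<bar> * 2^n \<le> (2^n)\<^sup>2 * (a n y)\<^sup>2 + 1"
        by (simp add: power2_diff power_mult_distrib mult_ac)
      moreover have "0 \<le> \<bar>a n y\<bar> * 2^n" by simp
      ultimately have "\<bar>a n y\<bar> * 2^n \<le> (2^n)\<^sup>2 * (a n y)\<^sup>2 + 1"
        by linarith
      then show "\<bar>a n y\<bar> \<le> 2^n * (a n y)\<^sup>2 + (1/2)^n"
        by (simp add: field_simps power2_eq_square)
    qed simp
    also have "\<dots> = 2^n * (\<integral>y. (a n y)\<^sup>2 \<partial>M) + (1/2)^n * measure M (space M)"
      using int_a by simp
    also have "\<dots> \<le> 2^n * (1/4)^n + (1/2)^n * measure M (space M)"
    proof -
      have "(\<integral>y. (a n y)\<^sup>2 \<partial>M) = (\<integral>y. (F (r n) y - F (r (Suc n)) y)\<^sup>2 \<partial>M)"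
        unfolding a_def by (simp add: power2_commute)
      also have "\<dots> < (1/4)^n" using Kr r by (intro K) (auto simp: strict_mono_less_eq)
      finally show ?thesis by simp
    qed
    also have "(2::real)^n * (1/4)^n = (1/2)^n" by (simp add: power_mult_distrib[symmetric])
    finally show ?thesis by (simp add: algebra_simps)
  qed
  have "(\<integral>\<^sup>+y. (\<Sum>n. ennreal \<bar>a n y\<bar>) \<partial>M) = (\<Sum>n. \<integral>\<^sup>+y. ennreal \<bar>a n y\<bar> \<partial>M)"
    by (rule nn_integral_suminf) measurable
  also have "\<dots> \<le> (\<Sum>n. ennreal ((1 + measure M (space M)) * (1/2)^n))"
    using bound int_a by (intro suminf_le) (auto simp: nn_integral_eq_integral intro!: ennreal_leI)
  also have "\<dots> < \<infinity>"
    by (subst suminf_ennreal2) (auto intro!: summable_mult summable_geometric)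
  finally have "AE y in M. (\<Sum>n. ennreal \<bar>a n y\<bar>) \<noteq> \<infinity>"
    by (intro nn_integral_PInf_AE) auto
  then have conv: "AE y in M. convergent (\<lambda>n. F (r n) y)"
  proof eventually_elim
    case (elim y)
    have "summable (\<lambda>n. \<bar>a n y\<bar>)"
      using elim by (intro summable_suminf_not_top) auto
    then have "summable (\<lambda>n. a n y)" by (rule summable_rabs_cancel)
    then have "(\<lambda>m. \<Sum>n<m. a n y) \<longlonglongrightarrow> (\<Sum>n. a n y)" by (rule summable_LIMSEQ)
    moreover have "(\<Sum>n<m. a n y) = F (r m) y - F (r 0) y" for m
      unfolding a_def by (rule sum_lessThan_telescope)
    ultimately have "(\<lambda>m. F (r m) y - F (r 0) y + F (r 0) y) \<longlonglongrightarrow> (\<Sum>n. a n y) + F (r 0) y"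
      by (intro tendsto_add tendsto_const) simp
    then show ?case by (auto simp: convergent_def)
  qed
  define G where "G y = max (- 1) (min 1 (lim (\<lambda>n. F (r n) y)))" for y
  have "G \<in> borel_measurable M" unfolding G_def by measurable
  then have "G \<in> unit_ball_Linfty M" by (auto simp: unit_ball_Linfty_def G_def)
  moreover have "AE y in M. (\<lambda>n. F (r n) y) \<longlonglongrightarrow> G y"
    using conv
  proof eventually_elim
    case (elim y)
    then have l: "(\<lambda>n. F (r n) y) \<longlonglongrightarrow> lim (\<lambda>n. F (r n) y)" by (simp add: convergent_LIMSEQ_iff)
    have "lim (\<lambda>n. F (r n) y) \<le> 1"
      using b by (intro LIMSEQ_le_const2[OF l]) (auto simp: abs_le_iff)
    moreover have "- 1 \<le> lim (\<lambda>n. F (r n) y)"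
      using b by (intro LIMSEQ_le_const[OF l]) (auto simp: abs_le_iff minus_le_iff)
    ultimately show ?case using l by (simp add: G_def)
  qed
  ultimately show ?thesis using r by blast
qed

text \<open>
  The upper Taylor bound for \<open>s \<mapsto> (max 0 s)\<^sup>2\<close>, whose derivative is \<open>2 max 0 s\<close>. It gives the first-order
  condition at the minimizer below.
\<close>

lemma positive_part_square_le:
  fixes a h :: real
  shows "(max 0 (a + h))\<^sup>2 \<le> (max 0 a)\<^sup>2 + 2 * max 0 a * h + h\<^sup>2"
proof (cases "a \<ge> 0")
  case True
  have "(max 0 (a + h))\<^sup>2 \<le> (a + h)\<^sup>2" by (simp add: max_def)
  then show ?thesis using True by (simp add: power2_sum max_def algebra_simps)
next
  case False
  then have "\<bar>max 0 (a + h)\<bar> \<le> \<bar>h\<bar>" by auto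
  then have "(max 0 (a + h))\<^sup>2 \<le> h\<^sup>2" by (simp only: abs_le_square_iff)
  then show ?thesis using False by (simp add: max_def)
qed

lemma positive_part_square_midpoint:
  fixes a b :: real
  shows "(max 0 ((a + b) / 2))\<^sup>2 \<le> ((max 0 a)\<^sup>2 + (max 0 b)\<^sup>2) / 2"
proof -
  have "(max 0 ((a + b) / 2))\<^sup>2 \<le> ((max 0 a + max 0 b) / 2)\<^sup>2"
    by (intro power_mono) (auto simp: max_def)
  also have "\<dots> \<le> ((max 0 a)\<^sup>2 + (max 0 b)\<^sup>2) / 2"
    using zero_le_power2[of "max 0 a - max 0 b"] by (simp add: power2_eq_square algebra_simps)
  finally show ?thesis .
qed

text \<open>
  Here \<open>c \<le> D F\<close> is a system of inequalities for a function \<open>F\<close> bounded by 1, and \<open>w\<close> is a certificate that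
  it has no solution, as in Farkas' lemma. The certificate is the defect \<open>(c - D F)\<^sup>+\<close> of an \<open>F\<close> which minimizes the
  \<open>L\<^sup>2\<close> norm of the defect. A minimizer exists: the measures being finite, bounded functions are square
  integrable, and minimizing sequences can be chosen to converge almost everywhere. The inequality for \<open>w\<close>
  holds for the minimizer itself because \<open>D F \<le> c\<close> where \<open>w\<close> is positive, and for the other points of the ball because
  the derivative of the norm in their direction is nonnegative.
\<close>

theorem theorem_of_the_alternative:
  fixes D :: "('y \<Rightarrow> real) \<Rightarrow> 'x \<Rightarrow> real" and c C :: real
  assumes N: "finite_measure N" and R: "finite_measure R"
    and meas: "\<And>F. F \<in> unit_ball_Linfty N \<Longrightarrow> D F \<in> borel_measurable R"
    and bound: "\<And>F x. F \<in> unit_ball_Linfty N \<Longrightarrow> \<bar>D F x\<bar> \<le> C"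
    and affine: "\<And>F G t x. F \<in> unit_ball_Linfty N \<Longrightarrow> G \<in> unit_ball_Linfty N \<Longrightarrow> 0 \<le> t \<Longrightarrow> t \<le> 1 \<Longrightarrow>
      D (\<lambda>y. (1 - t) * F y + t * G y) x = (1 - t) * D F x + t * D G x"
    and cont: "\<And>F G. (\<And>n::nat. F n \<in> unit_ball_Linfty N) \<Longrightarrow> G \<in> unit_ball_Linfty N \<Longrightarrow>
      (AE y in N. (\<lambda>n. F n y) \<longlonglongrightarrow> G y) \<Longrightarrow> AE x in R. (\<lambda>n. D (F n) x) \<longlonglongrightarrow> D G x"
    and no_strict_solution: "\<And>F. F \<in> unit_ball_Linfty N \<Longrightarrow> \<not> (AE x in R. c \<le> D F x)"
  shows "\<exists>w \<in> borel_measurable R. (\<forall>x. 0 \<le> w x \<and> w x \<le> \<bar>c\<bar> + C) \<and> \<not> (AE x in R. w x = 0) \<and>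
    (\<forall>F \<in> unit_ball_Linfty N. (\<integral>x. w x * D F x \<partial>R) \<le> c * (\<integral>x. w x \<partial>R))"
proof -
  interpret N: finite_measure N by fact
  interpret R: finite_measure R by fact
  let ?B = "unit_ball_Linfty N"
  have zero: "(\<lambda>_. 0) \<in> ?B" by (simp add: unit_ball_Linfty_def)
  have C0: "0 \<le> C" using bound[OF zero] abs_ge_zero order_trans by blast
  define slack where "slack F x = max 0 (c - D F x)" for F x
  have slack_meas [measurable]: "slack F \<in> borel_measurable R" if "F \<in> ?B" for F
  proof -
    have [measurable]: "D F \<in> borel_measurable R" using that by (rule meas)
    show ?thesis unfolding slack_def by measurable
  qed
  have slack_bd: "0 \<le> slack F x" "slack F x \<le> \<bar>c\<bar> + C" if "F \<in> ?B" for F x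
    using bound[OF that, of x] C0 by (auto simp: slack_def)
  have slack_int2: "integrable R (\<lambda>x. (slack F x)\<^sup>2)" if "F \<in> ?B" for F
    using slack_bd[OF that] slack_meas[OF that] C0
    by (intro R.integrable_bounded[of _ "(\<bar>c\<bar> + C)\<^sup>2"]) (auto intro!: power_mono)
  define J where "J F = (\<integral>x. (slack F x)\<^sup>2 \<partial>R)" for F
  have sq_int: "integrable N (\<lambda>y. (F y)\<^sup>2)" if "F \<in> ?B" for F
    using unit_ball_LinftyD[OF that]
    by (intro N.integrable_bounded[of _ 1]) (auto simp: abs_square_le_1)
  \<comment> \<open>The midpoint is written as a convex combination, to match the form in which \<open>D\<close> is affine.\<close>
  define mid where "mid F G = (\<lambda>y. (1 - 1/2) * F y + 1/2 * (G y :: real))" for F G :: "'y \<Rightarrow> real"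
  have mid: "mid F G \<in> ?B" if "F \<in> ?B" "G \<in> ?B" for F G
    unfolding mid_def using that by (intro convex_combination_unit_ball) auto
  have ex: "\<exists>F :: nat \<Rightarrow> 'y \<Rightarrow> real. (\<forall>n. F n \<in> ?B) \<and> (\<lambda>n. J (F n)) \<longlonglongrightarrow> Inf (J ` ?B) \<and>
      (\<forall>e>0. \<exists>K. \<forall>k\<ge>K. \<forall>l\<ge>k. (\<integral>y. (F k y - F l y)\<^sup>2 \<partial>N) < e)"
  proof (rule minimizing_sequence_Cauchy[where mid = mid and q = "\<lambda>F. \<integral>y. (F y)\<^sup>2 \<partial>N"
        and Q = "measure N (space N)"])
    show "?B \<noteq> {}" using zero by blast
  next
    fix F assume F: "F \<in> ?B"
    show "0 \<le> J F" unfolding J_def by (intro Bochner_Integration.integral_nonneg) simp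
    show "0 \<le> (\<integral>y. (F y)\<^sup>2 \<partial>N)" by (intro Bochner_Integration.integral_nonneg) simp
    have "(\<integral>y. (F y)\<^sup>2 \<partial>N) \<le> (\<integral>y. 1 \<partial>N)"
      using unit_ball_LinftyD[OF F] sq_int[OF F] by (intro integral_mono) (auto simp: abs_square_le_1)
    then show "(\<integral>y. (F y)\<^sup>2 \<partial>N) \<le> measure N (space N)" by simp
  next
    fix F G assume FG: "F \<in> ?B" "G \<in> ?B"
    show "mid F G \<in> ?B" using FG by (rule mid)
    have "J (mid F G) \<le> (\<integral>x. ((slack F x)\<^sup>2 + (slack G x)\<^sup>2) / 2 \<partial>R)"
      unfolding J_def
    proof (intro integral_mono slack_int2 mid FG)
      show "integrable R (\<lambda>x. ((slack F x)\<^sup>2 + (slack G x)\<^sup>2) / 2)"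
        using FG by (intro integrable_divide Bochner_Integration.integrable_add slack_int2)
      fix x
      have "D (mid F G) x = (1 - 1/2) * D F x + 1/2 * D G x"
        unfolding mid_def using FG by (intro affine) auto
      then have "c - D (mid F G) x = ((c - D F x) + (c - D G x)) / 2" by (simp add: field_simps)
      then show "(slack (mid F G) x)\<^sup>2 \<le> ((slack F x)\<^sup>2 + (slack G x)\<^sup>2) / 2"
        unfolding slack_def by (simp only: positive_part_square_midpoint)
    qed
    then show "J (mid F G) \<le> (J F + J G) / 2"
      using FG by (simp add: J_def slack_int2)
    have [measurable]: "F \<in> borel_measurable N" "G \<in> borel_measurable N"
      using FG by (auto simp: unit_ball_Linfty_def)
    have diff_int: "integrable N (\<lambda>y. (F y - G y)\<^sup>2)"
    proof (intro N.integrable_bounded[of _ 4])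
      fix y
      have "\<bar>F y - G y\<bar> \<le> 2"
        using unit_ball_LinftyD(2)[OF FG(1), of y] unit_ball_LinftyD(2)[OF FG(2), of y] by linarith
      then have "(F y - G y)\<^sup>2 \<le> 2\<^sup>2" by (intro abs_le_square_iff[THEN iffD1]) simp
      then show "\<bar>(F y - G y)\<^sup>2\<bar> \<le> 4" by simp
    qed measurable
    have "(\<integral>y. (mid F G y)\<^sup>2 \<partial>N) = (\<integral>y. ((F y)\<^sup>2 + (G y)\<^sup>2) / 2 - (F y - G y)\<^sup>2 / 4 \<partial>N)"
      by (intro Bochner_Integration.integral_cong refl) (simp add: mid_def power2_eq_square field_simps)
    also have "\<dots> = ((\<integral>y. (F y)\<^sup>2 \<partial>N) + (\<integral>y. (G y)\<^sup>2 \<partial>N)) / 2 - (\<integral>y. (F y - G y)\<^sup>2 \<partial>N) / 4"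
      using sq_int[OF FG(1)] sq_int[OF FG(2)] diff_int by simp
    finally show "(\<integral>y. (mid F G y)\<^sup>2 \<partial>N)
        \<le> ((\<integral>y. (F y)\<^sup>2 \<partial>N) + (\<integral>y. (G y)\<^sup>2 \<partial>N)) / 2 - (\<integral>y. (F y - G y)\<^sup>2 \<partial>N) / 4" by simp
  qed
  then obtain F where F: "\<And>n. F n \<in> ?B" "(\<lambda>n. J (F n)) \<longlonglongrightarrow> Inf (J ` ?B)"
    and Cau: "\<And>e. e > 0 \<Longrightarrow> \<exists>K. \<forall>k\<ge>K. \<forall>l\<ge>k. (\<integral>y. (F k y - F l y)\<^sup>2 \<partial>N) < e"
    by metis
  obtain r G where r: "strict_mono r" and G: "G \<in> ?B" and lim: "AE y in N. (\<lambda>n. F (r n) y) \<longlonglongrightarrow> G y"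
    using N.L2_Cauchy_AE_subseq[OF F(1) Cau] by blast
  have "(\<lambda>n. J (F (r n))) \<longlonglongrightarrow> J G"
    unfolding J_def
  proof (rule integral_dominated_convergence[where w = "\<lambda>_. (\<bar>c\<bar> + C)\<^sup>2"])
    show "AE x in R. (\<lambda>n. (slack (F (r n)) x)\<^sup>2) \<longlonglongrightarrow> (slack G x)\<^sup>2"
      using cont[of "\<lambda>n. F (r n)", OF F(1) G lim]
      by eventually_elim (auto simp: slack_def intro!: tendsto_intros)
    show "AE x in R. norm ((slack (F (r n)) x)\<^sup>2) \<le> (\<bar>c\<bar> + C)\<^sup>2" for n
      using slack_bd[OF F(1)] by (auto intro!: power_mono)
  qed (use slack_meas F(1) G in \<open>auto\<close>)
  moreover have "(\<lambda>n. J (F (r n))) \<longlonglongrightarrow> Inf (J ` ?B)"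
    using LIMSEQ_subseq_LIMSEQ[OF F(2) r] by (simp add: o_def)
  ultimately have "J G = Inf (J ` ?B)" by (rule LIMSEQ_unique)
  moreover have "bdd_below (J ` ?B)" by (auto intro!: bdd_belowI[of _ 0] simp: J_def)
  ultimately have min: "J G \<le> J F" if "F \<in> ?B" for F
    using that by (auto intro: cInf_lower)
  define w where "w = slack G"
  have wm [measurable]: "w \<in> borel_measurable R" unfolding w_def using G by (rule slack_meas)
  have w_bd: "0 \<le> w x" "w x \<le> \<bar>c\<bar> + C" for x using slack_bd[OF G] by (auto simp: w_def)
  have w_int: "integrable R w" using w_bd by (intro R.integrable_bounded[of _ "\<bar>c\<bar> + C"]) auto
  have variation: "(\<integral>x. w x * (D F x - D G x) \<partial>R) \<le> 0" if F: "F \<in> ?B" for F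
  proof (rule ccontr)
    have [measurable]: "D F \<in> borel_measurable R" "D G \<in> borel_measurable R"
      using F G by (auto intro: meas)
    let ?\<Delta> = "\<lambda>x. D F x - D G x"
    define s where "s = (\<integral>x. w x * ?\<Delta> x \<partial>R)"
    assume "\<not> ?thesis"
    then have s: "s > 0" by (simp add: s_def)
    have Db: "\<bar>?\<Delta> x\<bar> \<le> 2 * C" for x using bound[OF F, of x] bound[OF G, of x] by linarith
    have i1: "integrable R (\<lambda>x. w x * ?\<Delta> x)"
    proof (intro R.integrable_bounded[of _ "(\<bar>c\<bar> + C) * (2 * C)"])
      show "\<bar>w x * ?\<Delta> x\<bar> \<le> (\<bar>c\<bar> + C) * (2 * C)" for x
        unfolding abs_mult using w_bd[of x] Db[of x] C0 by (intro mult_mono) auto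
    qed measurable
    have i2: "integrable R (\<lambda>x. (?\<Delta> x)\<^sup>2)"
    proof (intro R.integrable_bounded[of _ "(2 * C)\<^sup>2"])
      show "\<bar>(?\<Delta> x)\<^sup>2\<bar> \<le> (2 * C)\<^sup>2" for x
        using power_mono[OF Db[of x] abs_ge_zero, of 2] by simp
    qed measurable
    have i3: "integrable R (\<lambda>x. (w x)\<^sup>2)" unfolding w_def using G by (rule slack_int2)
    define b where "b = (\<integral>x. (?\<Delta> x)\<^sup>2 \<partial>R)"
    have b0: "0 \<le> b" unfolding b_def by (intro Bochner_Integration.integral_nonneg) simp
    \<comment> \<open>A step small enough for the linear term \<open>- 2 t s\<close> to dominate the quadratic term \<open>t\<^sup>2 b\<close>.\<close>
    define t where "t = min 1 (s / (b + 1))"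
    have t: "0 < t" "t \<le> 1" using s b0 by (auto simp: t_def)
    let ?F = "\<lambda>y. (1 - t) * G y + t * F y"
    have Ft: "?F \<in> ?B" using F G t by (intro convex_combination_unit_ball) auto
    have "J G \<le> J ?F" using Ft by (rule min)
    also have "J ?F \<le> (\<integral>x. (w x)\<^sup>2 + 2 * (- t) * (w x * ?\<Delta> x) + t\<^sup>2 * (?\<Delta> x)\<^sup>2 \<partial>R)"
      unfolding J_def
    proof (intro integral_mono slack_int2 Ft)
      show "integrable R (\<lambda>x. (w x)\<^sup>2 + 2 * (- t) * (w x * ?\<Delta> x) + t\<^sup>2 * (?\<Delta> x)\<^sup>2)"
        by (intro Bochner_Integration.integrable_add integrable_mult_right i1 i2 i3)
      fix x
      have "D ?F x = (1 - t) * D G x + t * D F x" using F G t by (intro affine) auto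
      then have "c - D ?F x = (c - D G x) + (- t * ?\<Delta> x)" by (simp add: algebra_simps)
      then have "(slack ?F x)\<^sup>2 \<le> (w x)\<^sup>2 + 2 * w x * (- t * ?\<Delta> x) + (- t * ?\<Delta> x)\<^sup>2"
        unfolding w_def slack_def by (simp only: positive_part_square_le)
      then show "(slack ?F x)\<^sup>2 \<le> (w x)\<^sup>2 + 2 * (- t) * (w x * ?\<Delta> x) + t\<^sup>2 * (?\<Delta> x)\<^sup>2"
        by (simp add: power_mult_distrib mult.assoc mult.left_commute)
    qed
    also have "\<dots> = J G + 2 * (- t) * s + t\<^sup>2 * b"
      unfolding s_def b_def J_def w_def[symmetric]
      using i1 i2 i3 by (simp del: mult_minus_right mult_minus_left right_diff_distrib)
    finally have "t * (2 * s) \<le> t * (t * b)" by (simp add: power2_eq_square algebra_simps)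
    then have "2 * s \<le> t * b" using t(1) by simp
    also have "t * b \<le> s / (b + 1) * b" using b0 by (intro mult_right_mono) (auto simp: t_def)
    also have "\<dots> \<le> s" using s b0 by (simp add: field_simps)
    finally show False using s by simp
  qed
  show ?thesis
  proof (intro bexI conjI allI ballI)
    show "w \<in> borel_measurable R" by fact
    show "0 \<le> w x" "w x \<le> \<bar>c\<bar> + C" for x by (fact w_bd)+
    show "\<not> (AE x in R. w x = 0)"
    proof
      assume "AE x in R. w x = 0"
      then have "AE x in R. c \<le> D G x"
        by eventually_elim (auto simp: w_def slack_def max_def split: if_splits)
      then show False using no_strict_solution[OF G] by simp
    qed
  next
    fix F assume F: "F \<in> ?B"
    have [measurable]: "D F \<in> borel_measurable R" "D G \<in> borel_measurable R"
      using F G by (auto intro: meas)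
    have i: "integrable R (\<lambda>x. w x * D F x)" if F: "F \<in> ?B" for F
    proof (intro R.integrable_bounded[of _ "(\<bar>c\<bar> + C) * C"])
      show "(\<lambda>x. w x * D F x) \<in> borel_measurable R"
        using meas[OF F] by measurable
      show "\<bar>w x * D F x\<bar> \<le> (\<bar>c\<bar> + C) * C" for x
        unfolding abs_mult using w_bd[of x] bound[OF F] C0 by (intro mult_mono) auto
    qed
    have "(\<integral>x. w x * D F x \<partial>R) \<le> (\<integral>x. w x * D G x \<partial>R)"
      using variation[OF F] i[OF F] i[OF G] by (simp add: right_diff_distrib)
    also have "\<dots> \<le> (\<integral>x. c * w x \<partial>R)"
    proof (intro integral_mono i G)
      show "integrable R (\<lambda>x. c * w x)" using w_int by simp
      show "w x * D G x \<le> c * w x" for x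
        by (auto simp: w_def slack_def max_def mult.commute intro: mult_right_mono)
    qed
    finally show "(\<integral>x. w x * D F x \<partial>R) \<le> c * (\<integral>x. w x \<partial>R)" by simp
  qed
qed

section \<open>Null sets and translations for Haar measure\<close>

locale haar =
  fixes \<mu> :: "'g::{topological_group_add, t2_space, second_countable_topology} measure"
  assumes left_haar: "left_haar_measure \<mu>"
    and locally_compact: "locally_compact_space (euclidean :: 'g topology)"
begin

lemma sets_haar [measurable_cong]: "sets \<mu> = sets borel"
  using left_haar by (simp add: left_haar_measure_def)

lemma space_haar [simp]: "space \<mu> = UNIV"
  using sets_eq_imp_space_eq[OF sets_haar] by simp

lemma borel_measurable_haar [simp]: "borel_measurable \<mu> = borel_measurable borel"
  by (rule measurable_cong_sets) (simp_all add: sets_haar)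

lemma finite_on_compact: "compact K \<Longrightarrow> emeasure \<mu> K < \<infinity>"
  using left_haar by (simp add: left_haar_measure_def)

lemma distr_translate: "distr \<mu> \<mu> ((+) g) = \<mu>"
  using left_haar by (simp add: left_haar_measure_def)

lemma nn_integral_translate:
  assumes [measurable]: "f \<in> borel_measurable borel"
  shows "(\<integral>\<^sup>+x. f (g + x) \<partial>\<mu>) = (\<integral>\<^sup>+x. f x \<partial>\<mu>)"
  by (subst (2) distr_translate[of g, symmetric]) (simp add: nn_integral_distr)

lemma integral_translate:
  fixes f :: "'g \<Rightarrow> real"
  assumes [measurable]: "f \<in> borel_measurable borel"
  shows "(\<integral>x. f (g + x) \<partial>\<mu>) = (\<integral>x. f x \<partial>\<mu>)"
  by (subst (2) distr_translate[of g, symmetric]) (simp add: integral_distr)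

lemma integrable_translate:
  fixes f :: "'g \<Rightarrow> real"
  assumes "integrable \<mu> f"
  shows "integrable \<mu> (\<lambda>x. f (g + x))"
proof -
  have [measurable]: "f \<in> borel_measurable borel"
    using borel_measurable_integrable[OF assms] by simp
  have "integrable (distr \<mu> \<mu> ((+) g)) f" using assms by (simp add: distr_translate)
  then show ?thesis by (subst (asm) integrable_distr_eq) simp_all
qed

lemma emeasure_translate:
  assumes [measurable]: "A \<in> sets borel"
  shows "emeasure \<mu> ((+) g -` A) = emeasure \<mu> A"
  by (subst (2) distr_translate[of g, symmetric]) (simp add: emeasure_distr)

sublocale sigma_finite_measure \<mu>
proof
  obtain K :: "nat \<Rightarrow> 'g set" where K: "\<And>n. compact (K n)" "incseq K"
    "\<And>C. compact C \<Longrightarrow> \<exists>n. C \<subseteq> K n"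
    using compact_exhaustion[OF locally_compact] by blast
  have "x \<in> (\<Union>n. K n)" for x using K(3)[of "{x}"] by auto
  then show "\<exists>A. countable A \<and> A \<subseteq> sets \<mu> \<and> \<Union> A = space \<mu> \<and> (\<forall>a\<in>A. emeasure \<mu> a \<noteq> \<infinity>)"
    using K(1) finite_on_compact
    by (intro exI[of _ "range K"]) (auto simp: sets_haar compact_imp_closed dest!: less_imp_neq)
qed

sublocale pair_sigma_finite \<mu> \<mu> ..

lemma emeasure_UNIV_pos: "emeasure \<mu> UNIV \<noteq> 0"
  using left_haar by (simp add: left_haar_measure_def)

text \<open>
  Integrate the indicator of \<open>- y + x \<in> N\<close> in both orders. For fixed \<open>y\<close> it is a left translate of \<open>N\<close>, hence
  null; for fixed \<open>x\<close> it is a left translate of \<open>- N\<close>.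
\<close>

lemma null_uminus:
  assumes [measurable]: "N \<in> sets borel" and "emeasure \<mu> N = 0"
  shows "emeasure \<mu> (uminus -` N) = 0"
proof -
  have [measurable]: "uminus -` N \<in> sets borel"
    using measurable_sets[OF measurable_group_uminus assms(1)] by simp
  have "0 = (\<integral>\<^sup>+y. (\<integral>\<^sup>+x. indicator N (- y + x) \<partial>\<mu>) \<partial>\<mu>)"
    using assms(2) by (simp add: nn_integral_translate[of "indicator N"])
  also have "\<dots> = (\<integral>\<^sup>+x. (\<integral>\<^sup>+y. indicator N (- y + x) \<partial>\<mu>) \<partial>\<mu>)"
    by (rule Fubini') measurable
  also have "\<dots> = (\<integral>\<^sup>+x. (\<integral>\<^sup>+y. indicator (uminus -` N) (- x + y) \<partial>\<mu>) \<partial>\<mu>)"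
    by (intro nn_integral_cong) (simp add: indicator_def minus_add)
  also have "\<dots> = emeasure \<mu> (uminus -` N) * emeasure \<mu> UNIV"
    by (simp add: nn_integral_translate[of "indicator (uminus -` N)"])
  finally show ?thesis using emeasure_UNIV_pos by simp
qed

text \<open>
  Right translation is left translation conjugated by inversion, and both preserve null sets.
\<close>

lemma null_translate_right:
  assumes [measurable]: "N \<in> sets borel" and "emeasure \<mu> N = 0"
  shows "emeasure \<mu> ((\<lambda>h. h + k) -` N) = 0"
proof -
  have [measurable]: "uminus -` N \<in> sets borel"
    using measurable_sets[OF measurable_group_uminus assms(1)] by simp
  have [measurable]: "(+) (- k) -` uminus -` N \<in> sets borel"
    by (rule measurable_sets_borel) measurable
  have "(\<lambda>h. h + k) -` N = uminus -` ((+) (- k) -` (uminus -` N))"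
    by (auto simp: minus_add)
  moreover have "emeasure \<mu> (uminus -` ((+) (- k) -` (uminus -` N))) = 0"
    by (intro null_uminus) (simp_all add: emeasure_translate null_uminus assms)
  ultimately show ?thesis by simp
qed

lemma AE_translate_right:
  assumes "AE x in \<mu>. P x"
  shows "AE h in \<mu>. P (h + k)"
proof -
  obtain N where N: "{x. \<not> P x} \<subseteq> N" "emeasure \<mu> N = 0" "N \<in> sets \<mu>"
    using AE_E[OF assms] by auto
  have [measurable]: "N \<in> sets borel" using N by (simp add: sets_haar)
  have "(\<lambda>h. h + k) -` N \<in> sets borel" by (rule measurable_sets_borel) measurable
  then show ?thesis
    using N null_translate_right[of N k]
    by (intro AE_I[of _ _ "(\<lambda>h. h + k) -` N"]) (auto simp: sets_haar)
qed

lemma open_pos: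
  assumes "open U" "x \<in> U"
  shows "emeasure \<mu> U > 0"
proof (rule ccontr)
  assume "\<not> emeasure \<mu> U > 0"
  then have 0: "emeasure \<mu> U = 0" by simp
  have op: "open ((+) g -` U)" for g
    using assms by (intro open_vimage continuous_intros)
  define F where "F = range (\<lambda>g. (+) g -` U)"
  have "z \<in> (+) (x + - z) -` U" for z using assms(2) by (simp add: add.assoc)
  then have UF: "\<Union>F = UNIV" unfolding F_def by blast
  have opF: "\<And>X. X \<in> F \<Longrightarrow> open X" using op by (auto simp: F_def)
  obtain F' where F': "F' \<subseteq> F" "countable F'" "\<Union>F' = \<Union>F"
    by (rule Lindelof[OF opF])
  have "(\<Union>X\<in>F'. X) \<in> null_sets \<mu>"
  proof (intro null_sets_UN' F' null_setsI)
    fix X assume "X \<in> F'"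
    then obtain g where X: "X = (+) g -` U" using F'(1) by (auto simp: F_def)
    show "emeasure \<mu> X = 0" using 0 assms(1) by (simp add: X emeasure_translate)
    show "X \<in> sets \<mu>" using op by (simp add: X sets_haar)
  qed
  then show False using F'(3) UF emeasure_UNIV_pos by auto
qed

text \<open>The measure of the symmetric difference of \<open>g + A\<close> and \<open>A\<close>.\<close>

definition shift_diff :: "'g set \<Rightarrow> 'g \<Rightarrow> real" where
  "shift_diff A g = (\<integral>l. \<bar>indicator A (- g + l) - indicator A l\<bar> \<partial>\<mu>)"

lemma compact_sets: "compact A \<Longrightarrow> A \<in> sets borel" for A :: "'g set"
  by (intro borel_closed compact_imp_closed)

lemma integrable_indicator_compact: "compact A \<Longrightarrow> integrable \<mu> (indicator A :: 'g \<Rightarrow> real)"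
  using finite_on_compact[of A] by (intro integrable_real_indicator) (auto simp: sets_haar compact_sets)

lemma integrable_indicator_compact_translate:
  "compact A \<Longrightarrow> integrable \<mu> (\<lambda>l. indicator A (g + l) :: real)"
  by (intro integrable_translate integrable_indicator_compact)

lemma shift_diff_translate:
  assumes "compact A"
  shows "(\<integral>l. \<bar>indicator A (- g + l) - indicator A (- h + l)\<bar> \<partial>\<mu>) = shift_diff A (- h + g)"
proof -
  have [measurable]: "A \<in> sets borel" using assms by (rule compact_sets)
  have "shift_diff A (- h + g) = (\<integral>l. \<bar>indicator A (- (- h + g) + (- h + l)) - indicator A (- h + l)\<bar> \<partial>\<mu>)"
    unfolding shift_diff_def by (rule integral_translate[symmetric]) measurable
  then show ?thesis by (simp add: minus_add add.assoc)
qed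

text \<open>
  The sets \<open>V\<^sub>n + A\<close>, for a decreasing base \<open>V\<^sub>n\<close> of neighbourhoods of 0, decrease to the closed set \<open>A\<close>, so their
  measures tend to that of \<open>A\<close>. For \<open>g \<in> V\<^sub>n\<close> both \<open>A\<close> and \<open>g + A\<close> are subsets of \<open>V\<^sub>n + A\<close> with the measure of \<open>A\<close>.
\<close>

lemma shift_diff_small:
  assumes A: "compact A" and e: "\<eta> > 0"
  shows "\<exists>U. open U \<and> 0 \<in> U \<and> (\<forall>g\<in>U. shift_diff A g < \<eta>)"
proof -
  have mA [measurable]: "A \<in> sets borel" using A by (rule compact_sets)
  obtain W K where WK: "open W" "compact K" "(0::'g) \<in> W" "W \<subseteq> K"
    by (rule compact_neighbourhood[OF locally_compact, of 0])
  obtain V :: "nat \<Rightarrow> 'g set" where V: "\<And>i. open (V i)" "\<And>i. 0 \<in> V i"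
    "\<And>S. open S \<Longrightarrow> 0 \<in> S \<Longrightarrow> eventually (\<lambda>i. V i \<subseteq> S) sequentially"
    using countable_basis_at_decseq[of "0::'g"] by metis
  define P where "P n = {u + a |u a. u \<in> W \<inter> (\<Inter>i\<le>n. V i) \<and> a \<in> A}" for n :: nat
  have opP: "open (P n)" for n
    unfolding P_def using V WK by (intro open_plus_set open_Int open_INT) auto
  have [measurable]: "P n \<in> sets borel" for n using opP by simp
  have decP: "decseq P" unfolding decseq_def P_def by fastforce
  have PK: "P n \<subseteq> {u + a |u a. u \<in> K \<and> a \<in> A}" for n
    unfolding P_def using WK by auto
  \<comment> \<open>Finiteness makes the measure continuous from above; it holds because the neighbourhoods are cut
    down to \<open>W\<close>, which lies in the compact set \<open>K\<close>.\<close>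
  have finP: "emeasure \<mu> (P n) < \<infinity>" for n
  proof -
    have "emeasure \<mu> (P n) \<le> emeasure \<mu> {u + a |u a. u \<in> K \<and> a \<in> A}"
      using compact_plus[OF WK(2) A]
      by (intro emeasure_mono[OF PK]) (auto simp: sets_haar intro: compact_sets)
    also have "\<dots> < \<infinity>" by (intro finite_on_compact compact_plus WK A)
    finally show ?thesis .
  qed
  have inter: "(\<Inter>n. P n) = A"
  proof
    have "a \<in> P n" if "a \<in> A" for a n
    proof -
      have "a = 0 + a" "0 \<in> W \<inter> (\<Inter>i\<le>n. V i)" using V(2) WK(3) by auto
      then show ?thesis unfolding P_def using that by blast
    qed
    then show "A \<subseteq> (\<Inter>n. P n)" by auto
    show "(\<Inter>n. P n) \<subseteq> A"
    proof
      fix x assume x: "x \<in> (\<Inter>n. P n)"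
      show "x \<in> A"
      proof (rule ccontr)
        assume "x \<notin> A"
        have "closed A" using A by (rule compact_imp_closed)
        then have "open ((\<lambda>v. - v + x) -` (- A))"
          by (intro open_vimage continuous_intros) auto
        moreover have "0 \<in> (\<lambda>v. - v + x) -` (- A)" using \<open>x \<notin> A\<close> by simp
        ultimately obtain n where n: "V n \<subseteq> (\<lambda>v. - v + x) -` (- A)"
          using V(3) eventually_happens'[OF sequentially_bot] by metis
        obtain u a where ua: "x = u + a" "u \<in> V n" "a \<in> A"
          using x unfolding P_def by fastforce
        then have "- u + x \<notin> A" using n by auto
        then show False using ua by (simp add: add.assoc[symmetric])
      qed
    qed
  qed
  have fin_A: "emeasure \<mu> A < \<infinity>" using A by (rule finite_on_compact)
  have "(\<lambda>n. measure \<mu> (P n)) \<longlonglongrightarrow> measure \<mu> (\<Inter>n. P n)"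
    using finP by (intro Lim_measure_decseq) (auto simp: decP sets_haar opP less_top)
  then have "(\<lambda>n. 2 * measure \<mu> (P n) - 2 * measure \<mu> A) \<longlonglongrightarrow> 2 * measure \<mu> A - 2 * measure \<mu> A"
    unfolding inter by (intro tendsto_intros)
  then have "eventually (\<lambda>n. 2 * measure \<mu> (P n) - 2 * measure \<mu> A < \<eta>) sequentially"
    using e by (intro order_tendstoD(2)[where a = \<eta>]) auto
  then obtain n where n: "2 * measure \<mu> (P n) - 2 * measure \<mu> A < \<eta>"
    using eventually_happens'[OF sequentially_bot] by metis
  have iP: "integrable \<mu> (indicator (P n) :: 'g \<Rightarrow> real)"
    using finP[of n] by (intro integrable_real_indicator) (auto simp: sets_haar)
  note iA = integrable_indicator_compact[OF A] integrable_indicator_compact_translate[OF A]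
  have "shift_diff A g < \<eta>" if g: "g \<in> W \<inter> (\<Inter>i\<le>n. V i)" for g
  proof -
    have AP: "A \<subseteq> P n" using inter by auto
    have gP: "l \<in> P n" if "- g + l \<in> A" for l
    proof -
      have "l = g + (- g + l)" by simp
      then show ?thesis unfolding P_def using g that by blast
    qed
    have "shift_diff A g \<le> (\<integral>l. 2 * indicator (P n) l - indicator A (- g + l) - indicator A l \<partial>\<mu>)"
      unfolding shift_diff_def
    proof (intro integral_mono)
      show "integrable \<mu> (\<lambda>l. \<bar>indicator A (- g + l) - indicator A l\<bar> :: real)"
        using iA by (intro integrable_abs Bochner_Integration.integrable_diff)
      show "integrable \<mu> (\<lambda>l. 2 * indicator (P n) l - indicator A (- g + l) - indicator A l :: real)"
        using iA iP by (intro Bochner_Integration.integrable_diff integrable_mult_right)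
      show "\<bar>indicator A (- g + l) - indicator A l\<bar>
          \<le> 2 * indicator (P n) l - indicator A (- g + l) - (indicator A l :: real)" for l
        using AP gP[of l] by (auto simp: indicator_def)
    qed
    also have "\<dots> = 2 * measure \<mu> (P n) - measure \<mu> A - measure \<mu> A"
      using iA iP integral_translate[of "indicator A" "- g"]
      by (simp add: Bochner_Integration.integral_diff)
    finally show ?thesis using n by simp
  qed
  then show ?thesis
    using V WK by (intro exI[of _ "W \<inter> (\<Inter>i\<le>n. V i)"]) (auto intro!: open_INT)
qed

end

section \<open>Averaging a function over left translates\<close>

definition bounded_borel :: "('g::topological_space \<Rightarrow> real) set" where
  "bounded_borel = {f \<in> borel_measurable borel. \<exists>C. \<forall>x. \<bar>f x\<bar> \<le> C}"

lemma bounded_borelI: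
  "f \<in> borel_measurable borel \<Longrightarrow> (\<And>x. \<bar>f x\<bar> \<le> C) \<Longrightarrow> f \<in> bounded_borel"
  by (auto simp: bounded_borel_def)

lemma bounded_borel_measurable: "f \<in> bounded_borel \<Longrightarrow> f \<in> borel_measurable borel"
  by (simp add: bounded_borel_def)

lemma bounded_borel_bound:
  assumes "f \<in> bounded_borel"
  shows "\<exists>C\<ge>0. \<forall>x. \<bar>f x\<bar> \<le> C"
proof -
  obtain C where "\<And>x. \<bar>f x\<bar> \<le> C" using assms by (auto simp: bounded_borel_def)
  then show ?thesis by (meson abs_ge_zero order_trans)
qed

lemma bounded_borel_add:
  assumes "f \<in> bounded_borel" "h \<in> bounded_borel"
  shows "(\<lambda>x. f x + h x) \<in> bounded_borel"
proof -
  obtain C C' where "\<And>x. \<bar>f x\<bar> \<le> C" "\<And>x. \<bar>h x\<bar> \<le> C'"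
    using assms by (auto simp: bounded_borel_def)
  then have "\<bar>f x + h x\<bar> \<le> C + C'" for x by (meson abs_triangle_ineq add_mono order_trans)
  then show ?thesis using assms by (auto simp: bounded_borel_def)
qed

lemma bounded_borel_scale:
  assumes "f \<in> bounded_borel"
  shows "(\<lambda>x. c * f x) \<in> bounded_borel"
proof -
  obtain C where "\<And>x. \<bar>f x\<bar> \<le> C" using assms by (auto simp: bounded_borel_def)
  then have "\<bar>c * f x\<bar> \<le> \<bar>c\<bar> * C" for x by (simp add: abs_mult mult_left_mono)
  then show ?thesis using assms by (auto simp: bounded_borel_def)
qed

lemma bounded_borel_diff:
  assumes "f \<in> bounded_borel" "h \<in> bounded_borel"
  shows "(\<lambda>x. f x - h x) \<in> bounded_borel"
  using bounded_borel_add[OF assms(1) bounded_borel_scale[OF assms(2), of "- 1"]] by simp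

lemma bounded_borel_const: "(\<lambda>_. c) \<in> bounded_borel"
  by (auto simp: bounded_borel_def)

lemma bounded_borel_sum:
  assumes "\<And>i. i \<in> I \<Longrightarrow> f i \<in> bounded_borel"
  shows "(\<lambda>x. \<Sum>i\<in>I. f i x) \<in> bounded_borel"
  using assms
  by (induction I rule: infinite_finite_induct) (auto intro: bounded_borel_const bounded_borel_add)

lemma bounded_borel_translate:
  fixes g :: "'g::{topological_group_add, second_countable_topology}"
  assumes "f \<in> bounded_borel"
  shows "(\<lambda>x. f (g + x)) \<in> bounded_borel"
proof -
  have [measurable]: "f \<in> borel_measurable borel" using assms by (rule bounded_borel_measurable)
  have "(\<lambda>x. f (g + x)) \<in> borel_measurable borel" by measurable
  then show ?thesis using assms by (auto simp: bounded_borel_def)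
qed

lemma integrable_times_bounded:
  fixes k h :: "'x \<Rightarrow> real"
  assumes "integrable M k" "h \<in> borel_measurable M" "\<And>x. \<bar>h x\<bar> \<le> C"
  shows "integrable M (\<lambda>x. k x * h x)"
proof (rule Bochner_Integration.integrable_bound)
  show "integrable M (\<lambda>l. C * k l)" using assms(1) by simp
  show "(\<lambda>l. k l * h l) \<in> borel_measurable M"
    using assms(2) borel_measurable_integrable[OF assms(1)] by simp
  have "0 \<le> C" using assms(3) abs_ge_zero order_trans by blast
  then show "AE x in M. norm (k x * h x) \<le> norm (C * k x)"
    using assms(3) by (auto simp: abs_mult mult.commute[of C] intro!: AE_I2 mult_left_mono)
qed

context haar
begin

lemma AE_translate_left:
  assumes "AE x in \<mu>. P x"
  shows "AE x in \<mu>. P (g + x)"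
proof -
  have "AE x in distr \<mu> \<mu> ((+) g). P x" unfolding distr_translate by (rule assms)
  then show ?thesis by (rule AE_distrD[rotated]) simp
qed

lemma integrable_mult_bounded:
  fixes k h :: "'g \<Rightarrow> real"
  assumes "integrable \<mu> k" "h \<in> borel_measurable borel" "\<And>x. \<bar>h x\<bar> \<le> C"
  shows "integrable \<mu> (\<lambda>l. k l * h l)"
  using integrable_times_bounded[of \<mu> k h C] assms by simp

lemma integral_mult_bounded:
  fixes k h :: "'g \<Rightarrow> real"
  assumes "integrable \<mu> k" "h \<in> borel_measurable borel" "\<And>x. \<bar>h x\<bar> \<le> C"
  shows "\<bar>\<integral>l. k l * h l \<partial>\<mu>\<bar> \<le> C * (\<integral>l. \<bar>k l\<bar> \<partial>\<mu>)"
proof -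
  have "\<bar>\<integral>l. k l * h l \<partial>\<mu>\<bar> \<le> (\<integral>l. \<bar>k l * h l\<bar> \<partial>\<mu>)" by (rule integral_abs_bound)
  also have "\<dots> \<le> (\<integral>l. C * \<bar>k l\<bar> \<partial>\<mu>)"
    using assms
    by (intro integral_mono integrable_abs integrable_mult_bounded[OF assms] integrable_mult_right)
      (auto simp: abs_mult mult.commute[of C] intro: mult_left_mono)
  finally show ?thesis by simp
qed

text \<open>
  Averages of left translates of \<open>f\<close> with weight \<open>k\<close>. The second is the convolution \<open>k * f\<close>; the first is its
  adjoint for the pairing given by Haar measure.
\<close>

definition smear :: "('g \<Rightarrow> real) \<Rightarrow> ('g \<Rightarrow> real) \<Rightarrow> 'g \<Rightarrow> real" where
  "smear k f x = (\<integral>l. k l * f (l + x) \<partial>\<mu>)"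

definition spread :: "('g \<Rightarrow> real) \<Rightarrow> ('g \<Rightarrow> real) \<Rightarrow> 'g \<Rightarrow> real" where
  "spread k f x = (\<integral>l. k l * f (- l + x) \<partial>\<mu>)"

lemma integrable_smear:
  assumes "integrable \<mu> k" "f \<in> bounded_borel"
  shows "integrable \<mu> (\<lambda>l. k l * f (l + x))"
proof -
  have [measurable]: "f \<in> borel_measurable borel" using assms by (intro bounded_borel_measurable)
  obtain C where "\<And>x. \<bar>f x\<bar> \<le> C" "0 \<le> C" using bounded_borel_bound[OF assms(2)] by blast
  then show ?thesis using assms(1) by (intro integrable_mult_bounded[of _ _ C]) auto
qed

lemma integrable_spread_kernel:
  assumes "integrable \<mu> k" "f \<in> bounded_borel"
  shows "integrable \<mu> (\<lambda>l. k l * f (- l + x))"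
proof -
  have [measurable]: "f \<in> borel_measurable borel" using assms by (intro bounded_borel_measurable)
  obtain C where "\<And>x. \<bar>f x\<bar> \<le> C" "0 \<le> C" using bounded_borel_bound[OF assms(2)] by blast
  then show ?thesis using assms(1) by (intro integrable_mult_bounded[of _ _ C]) auto
qed

lemma smear_bound:
  assumes "integrable \<mu> k" "f \<in> borel_measurable borel" "\<And>x. \<bar>f x\<bar> \<le> C"
  shows "\<bar>smear k f x\<bar> \<le> C * (\<integral>l. \<bar>k l\<bar> \<partial>\<mu>)"
proof -
  note [measurable] = assms(2)
  show ?thesis unfolding smear_def using assms by (intro integral_mult_bounded) auto
qed

lemma spread_bound:
  assumes "integrable \<mu> k" "f \<in> borel_measurable borel" "\<And>x. \<bar>f x\<bar> \<le> C"
  shows "\<bar>spread k f x\<bar> \<le> C * (\<integral>l. \<bar>k l\<bar> \<partial>\<mu>)"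
proof -
  note [measurable] = assms(2)
  show ?thesis unfolding spread_def using assms by (intro integral_mult_bounded) auto
qed

lemma measurable_smear [measurable]:
  assumes [measurable]: "k \<in> borel_measurable borel" "f \<in> borel_measurable borel"
  shows "smear k f \<in> borel_measurable borel"
proof -
  have "(\<lambda>x. \<integral>l. k l * f (l + x) \<partial>\<mu>) \<in> borel_measurable borel"
    by measurable
  then show ?thesis by (simp add: smear_def[abs_def])
qed

lemma measurable_spread [measurable]:
  assumes [measurable]: "k \<in> borel_measurable borel" "f \<in> borel_measurable borel"
  shows "spread k f \<in> borel_measurable borel"
proof -
  have "(\<lambda>x. \<integral>l. k l * f (- l + x) \<partial>\<mu>) \<in> borel_measurable borel"
    by measurable
  then show ?thesis by (simp add: spread_def[abs_def])
qed

lemma integrable_measurable [measurable_dest]: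
  fixes k :: "'g \<Rightarrow> real"
  shows "integrable \<mu> k \<Longrightarrow> k \<in> borel_measurable borel"
  using borel_measurable_integrable[of \<mu> k] by simp

lemma bounded_borel_smear:
  assumes k: "integrable \<mu> k" and f: "f \<in> bounded_borel"
  shows "smear k f \<in> bounded_borel"
proof -
  obtain C where C: "\<And>x. \<bar>f x\<bar> \<le> C" "0 \<le> C" using bounded_borel_bound[OF f] by blast
  show ?thesis
    by (rule bounded_borelI[OF measurable_smear[OF integrable_measurable[OF k] bounded_borel_measurable[OF f]]
          smear_bound[OF k bounded_borel_measurable[OF f] C(1)]])
qed

lemma bounded_borel_spread:
  assumes k: "integrable \<mu> k" and f: "f \<in> bounded_borel"
  shows "spread k f \<in> bounded_borel"
proof -
  obtain C where C: "\<And>x. \<bar>f x\<bar> \<le> C" "0 \<le> C" using bounded_borel_bound[OF f] by blast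
  show ?thesis
    by (rule bounded_borelI[OF measurable_spread[OF integrable_measurable[OF k] bounded_borel_measurable[OF f]]
          spread_bound[OF k bounded_borel_measurable[OF f] C(1)]])
qed

lemma integrable_product:
  fixes k f :: "'g \<Rightarrow> real"
  assumes k: "integrable \<mu> k" and f: "integrable \<mu> f"
  shows "integrable (\<mu> \<Otimes>\<^sub>M \<mu>) (\<lambda>(l, x). k l * f x)"
proof (rule Fubini_integrable)
  have [measurable]: "k \<in> borel_measurable borel" "f \<in> borel_measurable borel"
    using k f by (auto intro: integrable_measurable)
  show "(\<lambda>(l, x). k l * f x) \<in> borel_measurable (\<mu> \<Otimes>\<^sub>M \<mu>)" by measurable
  show "integrable \<mu> (\<lambda>l. \<integral>x. norm (case (l, x) of (l, x) \<Rightarrow> k l * f x) \<partial>\<mu>)"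
    using k by (simp add: abs_mult)
  show "AE l in \<mu>. integrable \<mu> (\<lambda>x. case (l, x) of (l, x) \<Rightarrow> k l * f x)"
    using f by simp
qed

lemma integrable_product_translate:
  fixes k f :: "'g \<Rightarrow> real"
  assumes k: "integrable \<mu> k" and f: "integrable \<mu> f"
  shows "integrable (\<mu> \<Otimes>\<^sub>M \<mu>) (\<lambda>(l, x). k l * f (- l + x))"
proof (rule Fubini_integrable)
  have [measurable]: "k \<in> borel_measurable borel" "f \<in> borel_measurable borel"
    using k f by (auto intro: integrable_measurable)
  show "(\<lambda>(l, x). k l * f (- l + x)) \<in> borel_measurable (\<mu> \<Otimes>\<^sub>M \<mu>)" by measurable
  have "(\<integral>x. \<bar>f (- l + x)\<bar> \<partial>\<mu>) = (\<integral>x. \<bar>f x\<bar> \<partial>\<mu>)" for l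
    using integral_translate[of "\<lambda>x. \<bar>f x\<bar>" "- l"] by simp
  then show "integrable \<mu> (\<lambda>l. \<integral>x. norm (case (l, x) of (l, x) \<Rightarrow> k l * f (- l + x)) \<partial>\<mu>)"
    using k by (simp add: abs_mult)
  show "AE l in \<mu>. integrable \<mu> (\<lambda>x. case (l, x) of (l, x) \<Rightarrow> k l * f (- l + x))"
    using integrable_translate[OF f] by simp
qed

lemma integral_spread:
  assumes k: "integrable \<mu> k" and f: "integrable \<mu> f"
  shows "integrable \<mu> (spread k f)" "(\<integral>x. spread k f x \<partial>\<mu>) = (\<integral>l. k l \<partial>\<mu>) * (\<integral>x. f x \<partial>\<mu>)"
proof -
  note i = integrable_product_translate[OF k f]
  show "integrable \<mu> (spread k f)"
    unfolding spread_def[abs_def] by (rule integrable_snd[OF i])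
  have "(\<integral>x. spread k f x \<partial>\<mu>) = (\<integral>l. (\<integral>x. k l * f (- l + x) \<partial>\<mu>) \<partial>\<mu>)"
    unfolding spread_def by (rule Fubini_integral[OF i])
  also have "\<dots> = (\<integral>l. k l * (\<integral>x. f x \<partial>\<mu>) \<partial>\<mu>)"
    using f by (simp add: integral_translate integrable_measurable)
  finally show "(\<integral>x. spread k f x \<partial>\<mu>) = (\<integral>l. k l \<partial>\<mu>) * (\<integral>x. f x \<partial>\<mu>)" by simp
qed

lemma spread_L1_bound:
  assumes k: "integrable \<mu> k" and f: "integrable \<mu> f" and f0: "\<And>x. 0 \<le> f x"
  shows "(\<integral>x. \<bar>spread k f x\<bar> \<partial>\<mu>) \<le> (\<integral>l. \<bar>k l\<bar> \<partial>\<mu>) * (\<integral>x. f x \<partial>\<mu>)"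
proof -
  have k': "integrable \<mu> (\<lambda>l. \<bar>k l\<bar>)" using k by simp
  have "(\<integral>x. \<bar>spread k f x\<bar> \<partial>\<mu>) \<le> (\<integral>x. spread (\<lambda>l. \<bar>k l\<bar>) f x \<partial>\<mu>)"
  proof (intro integral_mono integrable_abs integral_spread k k' f)
    fix x
    have "\<bar>spread k f x\<bar> \<le> (\<integral>l. \<bar>k l * f (- l + x)\<bar> \<partial>\<mu>)"
      unfolding spread_def by (rule integral_abs_bound)
    then show "\<bar>spread k f x\<bar> \<le> spread (\<lambda>l. \<bar>k l\<bar>) f x"
      using f0 by (simp add: spread_def abs_mult)
  qed
  then show ?thesis by (simp add: integral_spread[OF k' f])
qed

lemma smear_spread_adjoint:
  assumes k: "integrable \<mu> k" and w: "integrable \<mu> w" and f: "f \<in> bounded_borel"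
  shows "(\<integral>x. w x * smear k f x \<partial>\<mu>) = (\<integral>x. f x * spread k w x \<partial>\<mu>)"
proof -
  have [measurable]: "k \<in> borel_measurable borel" "w \<in> borel_measurable borel" "f \<in> borel_measurable borel"
    using k w f by (auto intro: integrable_measurable bounded_borel_measurable)
  obtain C where C: "\<And>x. \<bar>f x\<bar> \<le> C" "0 \<le> C" using bounded_borel_bound[OF f] by blast
  have i1: "integrable (\<mu> \<Otimes>\<^sub>M \<mu>) (\<lambda>(l, x). k l * w x * f (l + x))"
  proof (rule Bochner_Integration.integrable_bound)
    show "integrable (\<mu> \<Otimes>\<^sub>M \<mu>) (\<lambda>z. C * (case z of (l, x) \<Rightarrow> k l * w x))"
      by (intro integrable_mult_right integrable_product k w)
    show "AE z in \<mu> \<Otimes>\<^sub>M \<mu>. norm (case z of (l, x) \<Rightarrow> k l * w x * f (l + x))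
        \<le> norm (C * (case z of (l, x) \<Rightarrow> k l * w x))"
      using C by (auto simp: abs_mult mult.commute[of C] intro!: AE_I2 mult_left_mono)
  qed measurable
  have i2: "integrable (\<mu> \<Otimes>\<^sub>M \<mu>) (\<lambda>(l, x). k l * w (- l + x) * f x)"
  proof (rule Bochner_Integration.integrable_bound)
    show "integrable (\<mu> \<Otimes>\<^sub>M \<mu>) (\<lambda>z. C * (case z of (l, x) \<Rightarrow> k l * w (- l + x)))"
      by (intro integrable_mult_right integrable_product_translate k w)
    show "AE z in \<mu> \<Otimes>\<^sub>M \<mu>. norm (case z of (l, x) \<Rightarrow> k l * w (- l + x) * f x)
        \<le> norm (C * (case z of (l, x) \<Rightarrow> k l * w (- l + x)))"
      using C by (auto simp: abs_mult mult.commute[of C] intro!: AE_I2 mult_left_mono)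
  qed measurable
  have "w x * smear k f x = (\<integral>l. k l * w x * f (l + x) \<partial>\<mu>)" for x
    unfolding smear_def by (subst integral_mult_right_zero[symmetric]) (simp add: mult_ac)
  then have "(\<integral>x. w x * smear k f x \<partial>\<mu>) = (\<integral>x. (\<integral>l. k l * w x * f (l + x) \<partial>\<mu>) \<partial>\<mu>)"
    by simp
  also have "\<dots> = (\<integral>l. (\<integral>x. k l * w x * f (l + x) \<partial>\<mu>) \<partial>\<mu>)"
    by (rule Fubini_integral[OF i1])
  also have "\<dots> = (\<integral>l. (\<integral>x. k l * w (- l + x) * f x \<partial>\<mu>) \<partial>\<mu>)"
  proof (rule Bochner_Integration.integral_cong[OF refl])
    fix l
    show "(\<integral>x. k l * w x * f (l + x) \<partial>\<mu>) = (\<integral>x. k l * w (- l + x) * f x \<partial>\<mu>)"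
      using integral_translate[of "\<lambda>x. k l * w (- l + x) * f x" l] by simp
  qed
  also have "\<dots> = (\<integral>x. (\<integral>l. k l * w (- l + x) * f x \<partial>\<mu>) \<partial>\<mu>)"
    by (rule Fubini_integral[OF i2, symmetric])
  also have "\<dots> = (\<integral>x. f x * spread k w x \<partial>\<mu>)"
    unfolding spread_def by (simp add: mult.commute)
  finally show ?thesis .
qed

lemma smear_translate:
  assumes [measurable]: "k \<in> borel_measurable borel" "f \<in> borel_measurable borel"
  shows "smear k (\<lambda>x. f (g + x)) = smear (\<lambda>l. k (- g + l)) f"
proof
  fix x
  show "smear k (\<lambda>x. f (g + x)) x = smear (\<lambda>l. k (- g + l)) f x"
    unfolding smear_def
    using integral_translate[of "\<lambda>l. k (- g + l) * f (l + x)" g] by (simp add: add.assoc)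
qed

lemma spread_translate:
  assumes [measurable]: "k \<in> borel_measurable borel" "f \<in> borel_measurable borel"
  shows "spread k f (- g + x) = spread (\<lambda>l. k (- g + l)) f x"
  unfolding spread_def
  using integral_translate[of "\<lambda>l. k l * f (- l + (- g + x))" "- g"]
  by (simp add: minus_add add.assoc)

text \<open>
  Translating the argument of a convolution translates its kernel, and indicators of compact sets
  depend continuously on translation in \<open>L\<^sup>1\<close>.
\<close>

lemma spread_uniformly_continuous:
  assumes B: "compact B" and f: "f \<in> bounded_borel" and e: "\<eta> > 0"
  shows "\<exists>N. open N \<and> l\<^sub>0 \<in> N \<and>
    (\<forall>l\<in>N. \<forall>x. \<bar>spread (indicator B) f (l + x) - spread (indicator B) f (l\<^sub>0 + x)\<bar> \<le> \<eta>)"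
proof -
  have [measurable]: "f \<in> borel_measurable borel" "B \<in> sets borel"
    using f B by (auto intro: bounded_borel_measurable compact_sets)
  obtain C where C: "\<And>x. \<bar>f x\<bar> \<le> C" "0 \<le> C" using bounded_borel_bound[OF f] by blast
  obtain U where U: "open U" "0 \<in> U" "\<And>g. g \<in> U \<Longrightarrow> shift_diff B g < \<eta> / (C + 1)"
    using shift_diff_small[OF B, of "\<eta> / (C + 1)"] e C by auto
  have "open ((\<lambda>l. l\<^sub>0 + - l) -` U)" using U by (intro open_vimage continuous_intros)
  moreover have "l\<^sub>0 \<in> (\<lambda>l. l\<^sub>0 + - l) -` U" using U by simp
  moreover have "\<bar>spread (indicator B) f (l + x) - spread (indicator B) f (l\<^sub>0 + x)\<bar> \<le> \<eta>"
    if "l \<in> (\<lambda>l. l\<^sub>0 + - l) -` U" for l x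
  proof -
    have sp: "spread (indicator B) f (l + x) = spread (\<lambda>k. indicator B (l + k)) f x" for l
      using spread_translate[of "indicator B" f "- l" x] by simp
    note iB = integrable_indicator_compact_translate[OF B]
    have "spread (indicator B) f (l + x) - spread (indicator B) f (l\<^sub>0 + x)
        = spread (\<lambda>k. indicator B (l + k) - indicator B (l\<^sub>0 + k)) f x"
      unfolding sp unfolding spread_def
      using integrable_spread_kernel[OF iB f, of l x] integrable_spread_kernel[OF iB f, of "l\<^sub>0" x]
      by (simp add: left_diff_distrib)
    also have "\<bar>\<dots>\<bar> \<le> C * (\<integral>k. \<bar>indicator B (l + k) - indicator B (l\<^sub>0 + k)\<bar> \<partial>\<mu>)"
      using iB C by (intro spread_bound) auto
    also have "(\<integral>k. \<bar>indicator B (l + k) - indicator B (l\<^sub>0 + k)\<bar> \<partial>\<mu>) = shift_diff B (l\<^sub>0 + - l)"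
      using shift_diff_translate[OF B, of "- l" "- l\<^sub>0"] by simp
    also have "C * shift_diff B (l\<^sub>0 + - l) \<le> C * (\<eta> / (C + 1))"
      using U(3)[of "l\<^sub>0 + - l"] that C by (intro mult_left_mono) auto
    also have "\<dots> \<le> \<eta>" using C e by (simp add: field_simps)
    finally show ?thesis .
  qed
  ultimately show ?thesis by blast
qed

text \<open>
  The composition averages \<open>f\<close> with the weights \<open>l \<mapsto> k (b + l)\<close> for \<open>b \<in> B\<close>, all of which are close to \<open>k\<close> when \<open>B\<close> is a
  small neighbourhood of 0.
\<close>

lemma smear_spread_approx:
  assumes k: "integrable \<mu> k" and B: "compact B" and f: "f \<in> bounded_borel"
    and C: "\<And>x. \<bar>f x\<bar> \<le> C"
    and close: "\<And>b. b \<in> B \<Longrightarrow> (\<integral>l. \<bar>k (b + l) - k l\<bar> \<partial>\<mu>) \<le> \<eta>"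
  shows "\<bar>smear k (spread (indicator B) f) x - measure \<mu> B * smear k f x\<bar> \<le> measure \<mu> B * (C * \<eta>)"
proof -
  have [measurable]: "f \<in> borel_measurable borel" "B \<in> sets borel" "k \<in> borel_measurable borel"
    using f B k by (auto intro: bounded_borel_measurable compact_sets integrable_measurable)
  have C0: "0 \<le> C" using C abs_ge_zero order_trans by blast
  note iB = integrable_indicator_compact[OF B]
  have i: "integrable (\<mu> \<Otimes>\<^sub>M \<mu>) (\<lambda>(b, l). indicator B b * k l * f (- b + (l + x)))"
  proof (rule Bochner_Integration.integrable_bound)
    show "integrable (\<mu> \<Otimes>\<^sub>M \<mu>) (\<lambda>z. C * (case z of (b, l) \<Rightarrow> indicator B b * k l))"
      by (intro integrable_mult_right integrable_product k iB)
    show "AE z in \<mu> \<Otimes>\<^sub>M \<mu>. norm (case z of (b, l) \<Rightarrow> indicator B b * k l * f (- b + (l + x)))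
        \<le> norm (C * (case z of (b, l) \<Rightarrow> indicator B b * k l))"
      using C C0 by (auto simp: abs_mult mult.commute[of C] intro!: AE_I2 mult_left_mono)
  qed measurable
  have sm: "smear k (\<lambda>z. f (- b + z)) x = smear (\<lambda>l. k (b + l)) f x" for b
    by (subst smear_translate) simp_all
  have "k l * spread (indicator B) f (l + x)
      = (\<integral>b. indicator B b * k l * f (- b + (l + x)) \<partial>\<mu>)" for l
    unfolding spread_def by (subst integral_mult_right_zero[symmetric]) (simp add: mult_ac)
  then have "smear k (spread (indicator B) f) x
      = (\<integral>l. (\<integral>b. indicator B b * k l * f (- b + (l + x)) \<partial>\<mu>) \<partial>\<mu>)"
    unfolding smear_def by simp
  also have "\<dots> = (\<integral>b. (\<integral>l. indicator B b * k l * f (- b + (l + x)) \<partial>\<mu>) \<partial>\<mu>)"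
    by (rule Fubini_integral[OF i])
  also have "\<dots> = (\<integral>b. indicator B b * smear (\<lambda>l. k (b + l)) f x \<partial>\<mu>)"
    unfolding sm[symmetric] unfolding smear_def by (simp add: mult.assoc)
  finally have eq: "smear k (spread (indicator B) f) x
      = (\<integral>b. indicator B b * smear (\<lambda>l. k (b + l)) f x \<partial>\<mu>)" .
  have kb: "integrable \<mu> (\<lambda>l. k (b + l))" for b using k by (rule integrable_translate)
  have "smear (\<lambda>l. k (b + l)) f x - smear k f x = smear (\<lambda>l. k (b + l) - k l) f x" for b
    unfolding smear_def
    using integrable_smear[OF kb f, of b x] integrable_smear[OF k f, of x]
    by (simp add: left_diff_distrib)
  moreover have "\<bar>smear (\<lambda>l. k (b + l) - k l) f x\<bar> \<le> C * \<eta>" if "b \<in> B" for b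
  proof -
    have "\<bar>smear (\<lambda>l. k (b + l) - k l) f x\<bar> \<le> C * (\<integral>l. \<bar>k (b + l) - k l\<bar> \<partial>\<mu>)"
      using kb k C by (intro smear_bound) auto
    also have "\<dots> \<le> C * \<eta>" using close[OF that] C0 by (rule mult_left_mono)
    finally show ?thesis .
  qed
  ultimately have diff: "\<bar>indicator B b * smear (\<lambda>l. k (b + l)) f x - indicator B b * smear k f x\<bar>
      \<le> indicator B b * (C * \<eta>)" for b
    by (auto simp: indicator_def)
  have i': "integrable \<mu> (\<lambda>b. indicator B b * smear (\<lambda>l. k (b + l)) f x)"
  proof -
    have "integrable \<mu> (\<lambda>b. \<integral>l. indicator B b * k l * f (- b + (l + x)) \<partial>\<mu>)"
      by (rule integrable_fst[OF i])
    then show ?thesis unfolding sm[symmetric] unfolding smear_def by (simp add: mult.assoc)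
  qed
  have "\<bar>smear k (spread (indicator B) f) x - measure \<mu> B * smear k f x\<bar>
      = \<bar>\<integral>b. indicator B b * smear (\<lambda>l. k (b + l)) f x - indicator B b * smear k f x \<partial>\<mu>\<bar>"
    using i' iB by (simp add: eq)
  also have "\<dots> \<le> (\<integral>b. \<bar>indicator B b * smear (\<lambda>l. k (b + l)) f x - indicator B b * smear k f x\<bar> \<partial>\<mu>)"
    by (rule integral_abs_bound)
  also have "\<dots> \<le> (\<integral>b. indicator B b * (C * \<eta>) \<partial>\<mu>)"
    using i' iB diff
    by (intro integral_mono integrable_abs Bochner_Integration.integrable_diff integrable_mult_left) auto
  also have "\<dots> = measure \<mu> B * (C * \<eta>)" using iB by simp
  finally show ?thesis .
qed

end

section \<open>From an invariant mean to Reiter's condition\<close>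

locale haar_mean = haar \<mu>
  for \<mu> :: "'g::{topological_group_add, t2_space, second_countable_topology} measure" +
  fixes M :: "('g \<Rightarrow> real) \<Rightarrow> real"
  assumes mean: "mean_on_Linfty \<mu> M"
    and invariant: "\<And>f g. f \<in> Linfty \<mu> \<Longrightarrow> M (\<lambda>x. f (g + x)) = M f"
begin

lemma bounded_borel_Linfty: "f \<in> bounded_borel \<Longrightarrow> f \<in> Linfty \<mu>"
  unfolding bounded_borel_def Linfty_def by auto

lemma mean_add: "f \<in> bounded_borel \<Longrightarrow> h \<in> bounded_borel \<Longrightarrow> M (\<lambda>x. f x + h x) = M f + M h"
  using mean by (simp add: mean_on_Linfty_def bounded_borel_Linfty)

lemma mean_scale: "f \<in> bounded_borel \<Longrightarrow> M (\<lambda>x. c * f x) = c * M f"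
  using mean by (simp add: mean_on_Linfty_def bounded_borel_Linfty)

lemma mean_const: "M (\<lambda>_. c) = c"
  using mean_scale[OF bounded_borel_const[of 1], of c] mean by (simp add: mean_on_Linfty_def)

lemma mean_diff: "f \<in> bounded_borel \<Longrightarrow> h \<in> bounded_borel \<Longrightarrow> M (\<lambda>x. f x - h x) = M f - M h"
  using mean_add[of f "\<lambda>x. - 1 * h x"] mean_scale[of h "- 1"] bounded_borel_scale[of h "- 1"] by simp

lemma mean_sum:
  assumes "\<And>i. i \<in> I \<Longrightarrow> f i \<in> bounded_borel"
  shows "M (\<lambda>x. \<Sum>i\<in>I. f i x) = (\<Sum>i\<in>I. M (f i))"
  using assms
  by (induction I rule: infinite_finite_induct) (simp_all add: mean_const mean_add bounded_borel_sum)

lemma mean_mono_AE: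
  assumes "f \<in> bounded_borel" "h \<in> bounded_borel" "AE x in \<mu>. f x \<le> h x"
  shows "M f \<le> M h"
proof -
  have "(\<lambda>x. h x - f x) \<in> Linfty \<mu>"
    using assms by (intro bounded_borel_Linfty bounded_borel_diff)
  moreover have "AE x in \<mu>. 0 \<le> h x - f x" using assms(3) by eventually_elim simp
  ultimately have "0 \<le> M (\<lambda>x. h x - f x)" using mean by (simp add: mean_on_Linfty_def)
  then show ?thesis using assms by (simp add: mean_diff)
qed

lemma mean_abs_le:
  assumes "f \<in> bounded_borel" "\<And>x. \<bar>f x\<bar> \<le> C"
  shows "\<bar>M f\<bar> \<le> C"
proof -
  have "M f \<le> M (\<lambda>_. C)"
    using assms by (intro mean_mono_AE bounded_borel_const AE_I2) (auto simp: abs_le_iff)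
  moreover have "M (\<lambda>_. - C) \<le> M f"
    using assms(2) by (intro mean_mono_AE bounded_borel_const AE_I2 assms(1)) (auto simp: abs_le_iff minus_le_iff)
  ultimately show ?thesis by (simp add: mean_const abs_le_iff)
qed

lemma mean_translate: "f \<in> bounded_borel \<Longrightarrow> M (\<lambda>x. f (g + x)) = M f"
  by (intro invariant bounded_borel_Linfty)

text \<open>
  The mean commutes with an integral of translates when the translates depend norm continuously on the
  group element: \<open>A\<close> is cut into finitely many pieces on which the translate is almost constant.
\<close>

lemma mean_smear_uniformly_continuous:
  assumes A: "compact A" and f: "f \<in> bounded_borel"
    and uc: "\<And>l\<^sub>0 \<eta>. \<eta> > 0 \<Longrightarrow> \<exists>N. open N \<and> l\<^sub>0 \<in> N \<and> (\<forall>l\<in>N. \<forall>x. \<bar>f (l + x) - f (l\<^sub>0 + x)\<bar> \<le> \<eta>)"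
  shows "M (smear (indicator A) f) = measure \<mu> A * M f"
proof -
  have small: "\<bar>M (smear (indicator A) f) - measure \<mu> A * M f\<bar> \<le> \<eta> * measure \<mu> A" if \<eta>: "\<eta> > 0" for \<eta>
  proof -
    obtain N where N: "\<And>i. open (N i)" "\<And>i. i \<in> N i"
      "\<And>i l x. l \<in> N i \<Longrightarrow> \<bar>f (l + x) - f (i + x)\<bar> \<le> \<eta>"
      using uc[OF \<eta>] by metis
    have fin: "A' \<in> sets borel \<Longrightarrow> A' \<subseteq> A \<Longrightarrow> emeasure \<mu> A' < \<infinity>" for A'
      using emeasure_mono[of A' A \<mu>] finite_on_compact[OF A] A
      by (auto simp: sets_haar compact_sets intro: le_less_trans)
    then have int: "A' \<in> sets borel \<Longrightarrow> A' \<subseteq> A \<Longrightarrow> integrable \<mu> (indicator A' :: 'g \<Rightarrow> real)" for A'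
      by (intro integrable_real_indicator) (auto simp: sets_haar)
    \<comment> \<open>The induction cuts \<open>A'\<close> along the sets \<open>N i\<close> one at a time; all cut sets stay inside \<open>A\<close>.\<close>
    have cover: "finite I \<Longrightarrow> A' \<in> sets borel \<Longrightarrow> A' \<subseteq> A \<Longrightarrow> A' \<subseteq> (\<Union>i\<in>I. N i) \<Longrightarrow>
        \<bar>M (smear (indicator A') f) - measure \<mu> A' * M f\<bar> \<le> \<eta> * measure \<mu> A'" for I A'
    proof (induction I arbitrary: A' rule: finite_induct)
      case empty
      then show ?case by (simp add: smear_def[abs_def] mean_const)
    next
      case (insert i I)
      define A1 where "A1 = A' \<inter> N i"
      define A2 where "A2 = A' - N i"
      have sets: "A1 \<in> sets borel" "A2 \<in> sets borel"
        using insert.prems(1) N(1)[of i] by (auto simp: A1_def A2_def)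
      have sub: "A1 \<subseteq> A" "A2 \<subseteq> A" using insert.prems by (auto simp: A1_def A2_def)
      have i1: "integrable \<mu> (indicator A1 :: 'g \<Rightarrow> real)" and i2: "integrable \<mu> (indicator A2 :: 'g \<Rightarrow> real)"
        using int sets sub by auto
      have ind: "indicator A' l = indicator A1 l + (indicator A2 l :: real)" for l
        by (auto simp: A1_def A2_def indicator_def)
      have sm: "smear (indicator A') f = (\<lambda>x. smear (indicator A1) f x + smear (indicator A2) f x)"
      proof
        fix x
        show "smear (indicator A') f x = smear (indicator A1) f x + smear (indicator A2) f x"
          unfolding smear_def ind using integrable_smear[OF i1 f, of x] integrable_smear[OF i2 f, of x]
          by (simp add: distrib_right)
      qed
      have bb: "smear (indicator A1) f \<in> bounded_borel" "smear (indicator A2) f \<in> bounded_borel"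
        using i1 i2 f by (auto intro: bounded_borel_smear)
      have fin12: "emeasure \<mu> A1 \<noteq> \<infinity>" "emeasure \<mu> A2 \<noteq> \<infinity>"
        using fin[OF sets(1) sub(1)] fin[OF sets(2) sub(2)] by auto
      have "A' = A1 \<union> A2" "A1 \<inter> A2 = {}" by (auto simp: A1_def A2_def)
      then have m: "measure \<mu> A' = measure \<mu> A1 + measure \<mu> A2"
        using sets fin12 by (simp add: measure_Union sets_haar)
      have IH: "\<bar>M (smear (indicator A2) f) - measure \<mu> A2 * M f\<bar> \<le> \<eta> * measure \<mu> A2"
        using insert.prems by (intro insert.IH sets sub) (auto simp: A2_def)
      have bbi: "(\<lambda>x. f (i + x)) \<in> bounded_borel" using f by (rule bounded_borel_translate)
      have "\<bar>smear (indicator A1) f x - measure \<mu> A1 * f (i + x)\<bar> \<le> \<eta> * measure \<mu> A1" for x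
      proof -
        have ii: "integrable \<mu> (\<lambda>l. indicator A1 l * f (i + x))" using i1 by simp
        have "smear (indicator A1) f x - measure \<mu> A1 * f (i + x)
            = (\<integral>l. indicator A1 l * f (l + x) - indicator A1 l * f (i + x) \<partial>\<mu>)"
          unfolding smear_def using integrable_smear[OF i1 f, of x] ii by simp
        also have "\<bar>\<dots>\<bar> \<le> (\<integral>l. \<bar>indicator A1 l * f (l + x) - indicator A1 l * f (i + x)\<bar> \<partial>\<mu>)"
          by (rule integral_abs_bound)
        also have "\<dots> \<le> (\<integral>l. \<eta> * indicator A1 l \<partial>\<mu>)"
        proof (intro integral_mono integrable_abs Bochner_Integration.integrable_diff
            integrable_smear[OF i1 f, of x] i1 ii integrable_mult_right)
          show "\<bar>indicator A1 l * f (l + x) - indicator A1 l * f (i + x)\<bar> \<le> \<eta> * indicator A1 l" for l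
            using N(3)[of l i x] by (auto simp: indicator_def A1_def)
        qed
        finally show ?thesis by simp
      qed
      then have "\<bar>M (\<lambda>x. smear (indicator A1) f x - measure \<mu> A1 * f (i + x))\<bar> \<le> \<eta> * measure \<mu> A1"
        by (intro mean_abs_le bounded_borel_diff bounded_borel_scale bb bbi)
      then have "\<bar>M (smear (indicator A1) f) - measure \<mu> A1 * M f\<bar> \<le> \<eta> * measure \<mu> A1"
        using bb bbi f by (simp add: mean_diff mean_scale bounded_borel_scale mean_translate)
      then show ?case using IH bb by (simp add: sm mean_add m algebra_simps)
    qed
    obtain I where "finite I" "A \<subseteq> (\<Union>i\<in>I. N i)"
    proof (rule compactE_image[OF A, of UNIV N])
      show "A \<subseteq> \<Union> (range N)" using N(2) by blast
    qed (use N(1) in auto)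
    then show ?thesis using A by (intro cover) (auto intro: compact_sets)
  qed
  have "\<bar>M (smear (indicator A) f) - measure \<mu> A * M f\<bar> \<le> 0"
  proof (rule field_le_epsilon)
    fix e :: real assume "e > 0"
    then have "\<bar>M (smear (indicator A) f) - measure \<mu> A * M f\<bar>
        \<le> e / (measure \<mu> A + 1) * measure \<mu> A" by (intro small) (auto intro!: divide_pos_pos add_nonneg_pos)
    also have "\<dots> \<le> e"
    proof -
      have "0 < measure \<mu> A + 1" by (intro add_nonneg_pos) auto
      then show ?thesis using \<open>e > 0\<close> by (simp add: divide_le_eq algebra_simps)
    qed
    finally show "\<bar>M (smear (indicator A) f) - measure \<mu> A * M f\<bar> \<le> 0 + e" by simp
  qed
  then show ?thesis by simp
qed

lemma indicator_translate: "indicator ((+) g ` A) l = (indicator A (- g + l) :: real)" for l :: 'g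
proof -
  have "l \<in> (+) g ` A \<longleftrightarrow> - g + l \<in> A" by (auto intro!: image_eqI[of _ _ "- g + l"])
  then show ?thesis by (simp add: indicator_def)
qed

text \<open>
  Averaging over \<open>A\<close> after a translation by \<open>g\<close> is averaging over \<open>g + A\<close>, and the invariance of the mean does not
  apply, because \<open>g\<close> stands to the left of the variable of integration. If \<open>f\<close> is replaced by its convolution \<open>S\<close> with the
  indicator of a small set \<open>B\<close>, both averages have mean \<open>\<mu>(A) M(S)\<close>. The averages of \<open>S\<close> differ
  from those of \<open>\<mu>(B) f\<close> uniformly by a small multiple of \<open>\<mu>(B)\<close>.
\<close>

theorem mean_smear_translate:
  assumes A: "compact A" and f: "f \<in> bounded_borel"
  shows "M (smear (indicator A) (\<lambda>x. f (g + x))) = M (smear (indicator A) f)"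
proof -
  define A' where "A' = (+) g ` A"
  have A': "compact A'" unfolding A'_def using A by (intro compact_continuous_image continuous_intros)
  note iA = integrable_indicator_compact[OF A] and iA' = integrable_indicator_compact[OF A']
  have mf: "f \<in> borel_measurable borel" using f by (rule bounded_borel_measurable)
  have ind: "(indicator A' :: 'g \<Rightarrow> real) = (\<lambda>l. indicator A (- g + l))"
    by (auto simp: A'_def indicator_translate)
  have meas: "measure \<mu> A' = measure \<mu> A"
    using integral_translate[of "indicator A" "- g"] compact_sets[OF A]
    by (simp add: ind[symmetric])
  have trans: "smear (indicator A) (\<lambda>x. f (g + x)) = smear (indicator A') f"
    unfolding ind using mf compact_sets[OF A] by (intro smear_translate) auto
  obtain C where C: "\<And>x. \<bar>f x\<bar> \<le> C" "0 \<le> C" using bounded_borel_bound[OF f] by blast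
  have close: "\<bar>M (smear (indicator A') f) - M (smear (indicator A) f)\<bar> \<le> 2 * (C * \<eta>)" if \<eta>: "\<eta> > 0" for \<eta>
  proof -
    obtain U where U: "open U" "0 \<in> U" "\<And>b. b \<in> U \<Longrightarrow> shift_diff A b < \<eta>"
      using shift_diff_small[OF A \<eta>] by blast
    obtain U' where U': "open U'" "0 \<in> U'" "\<And>b. b \<in> U' \<Longrightarrow> shift_diff A' b < \<eta>"
      using shift_diff_small[OF A' \<eta>] by blast
    have "open (uminus -` (U \<inter> U'))" using U U' by (intro open_vimage continuous_intros) auto
    moreover have "0 \<in> uminus -` (U \<inter> U')" using U U' by simp
    ultimately obtain V B where VB: "open V" "0 \<in> V" "compact B" "V \<subseteq> B" "B \<subseteq> uminus -` (U \<inter> U')"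
      by (rule small_compact_neighbourhood[OF locally_compact])
    have "0 < emeasure \<mu> V" using VB by (intro open_pos)
    also have "\<dots> \<le> emeasure \<mu> B"
      using VB by (intro emeasure_mono) (auto simp: sets_haar compact_sets)
    finally have b: "0 < measure \<mu> B"
      using finite_on_compact[OF VB(3)] by (simp add: measure_def enn2real_positive_iff)
    define S where "S = spread (indicator B) f"
    have S: "S \<in> bounded_borel"
      unfolding S_def by (intro bounded_borel_spread integrable_indicator_compact VB f)
    have uc: "\<exists>N. open N \<and> l\<^sub>0 \<in> N \<and> (\<forall>l\<in>N. \<forall>x. \<bar>S (l + x) - S (l\<^sub>0 + x)\<bar> \<le> e)" if "e > 0" for l\<^sub>0 e
      unfolding S_def using VB(3) f that by (rule spread_uniformly_continuous)
    have one: "\<bar>measure \<mu> A * M S - measure \<mu> B * M (smear (indicator D) f)\<bar> \<le> measure \<mu> B * (C * \<eta>)"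
      if D: "compact D" "measure \<mu> D = measure \<mu> A" and sd: "\<And>b. b \<in> U \<inter> U' \<Longrightarrow> shift_diff D b < \<eta>" for D
    proof -
      note iD = integrable_indicator_compact[OF D(1)]
      have "\<bar>smear (indicator D) S x - measure \<mu> B * smear (indicator D) f x\<bar> \<le> measure \<mu> B * (C * \<eta>)" for x
        unfolding S_def
      proof (rule smear_spread_approx[OF iD VB(3) f C(1)])
        fix b assume "b \<in> B"
        then have "- b \<in> U \<inter> U'" using VB(5) by auto
        then show "(\<integral>l. \<bar>indicator D (b + l) - indicator D l\<bar> \<partial>\<mu>) \<le> \<eta>"
          using sd[of "- b"] by (simp add: shift_diff_def)
      qed
      then have "\<bar>M (\<lambda>x. smear (indicator D) S x - measure \<mu> B * smear (indicator D) f x)\<bar>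
          \<le> measure \<mu> B * (C * \<eta>)"
        by (intro mean_abs_le bounded_borel_diff bounded_borel_scale bounded_borel_smear iD S f)
      then have "\<bar>M (smear (indicator D) S) - measure \<mu> B * M (smear (indicator D) f)\<bar>
          \<le> measure \<mu> B * (C * \<eta>)"
        using iD S f by (simp add: mean_diff mean_scale bounded_borel_scale bounded_borel_smear)
      then show ?thesis
        using mean_smear_uniformly_continuous[OF D(1) S uc] D(2) by simp
    qed
    have "\<bar>measure \<mu> A * M S - measure \<mu> B * M (smear (indicator A) f)\<bar> \<le> measure \<mu> B * (C * \<eta>)"
      using U(3) by (intro one A) auto
    moreover have "\<bar>measure \<mu> A * M S - measure \<mu> B * M (smear (indicator A') f)\<bar> \<le> measure \<mu> B * (C * \<eta>)"
      using U'(3) by (intro one A' meas) auto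
    ultimately have "\<bar>measure \<mu> B * M (smear (indicator A') f) - measure \<mu> B * M (smear (indicator A) f)\<bar>
        \<le> 2 * (measure \<mu> B * (C * \<eta>))" by linarith
    then have "measure \<mu> B * \<bar>M (smear (indicator A') f) - M (smear (indicator A) f)\<bar>
        \<le> measure \<mu> B * (2 * (C * \<eta>))"
      using b by (simp add: right_diff_distrib[symmetric] abs_mult mult.left_commute)
    then show ?thesis using b by simp
  qed
  have "\<bar>M (smear (indicator A') f) - M (smear (indicator A) f)\<bar> \<le> 0"
  proof (rule field_le_epsilon)
    fix e :: real assume e: "e > 0"
    have "\<bar>M (smear (indicator A') f) - M (smear (indicator A) f)\<bar> \<le> 2 * (C * (e / (2 * (C + 1))))"
      using e C by (intro close) auto
    also have "\<dots> \<le> e" using e C by (simp add: field_simps)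
    finally show "\<bar>M (smear (indicator A') f) - M (smear (indicator A) f)\<bar> \<le> 0 + e" by simp
  qed
  then show ?thesis by (simp add: trans)
qed

text \<open>
  The theorem of the alternative is applied to the averaged divergences
  \<open>D F x = \<Sum>g\<in>I. \<integral> 1\<^sub>A(l) (F g (g + l + x) - F g (l + x)) dl\<close>. Since \<open>M (D F) = 0\<close>, the inequality \<open>c \<le> D F\<close> has no solution. The
  certificate, as a density with respect to \<open>\<mu>\<close>, is the one sought: by adjointness its pairing with \<open>D F\<close> is the pairing of \<open>F g\<close> with the
  displacements of the convolution, and the signs of these displacements are an admissible choice of \<open>F\<close>.
\<close>

lemma approximately_invariant_spread:
  assumes A: "compact A" and I: "finite I" and c: "c > 0"
  shows "\<exists>w. integrable \<mu> w \<and> w \<in> bounded_borel \<and> (\<forall>x. 0 \<le> w x) \<and> 0 < (\<integral>x. w x \<partial>\<mu>) \<and>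
    (\<Sum>g\<in>I. \<integral>x. \<bar>spread (indicator A) w (- g + x) - spread (indicator A) w x\<bar> \<partial>\<mu>) \<le> c * (\<integral>x. w x \<partial>\<mu>)"
proof -
  note iA = integrable_indicator_compact[OF A]
  have [measurable]: "A \<in> sets borel" using A by (rule compact_sets)
  have "sigma_finite_measure \<mu>" by unfold_locales
  from sigma_finite_measure.Ex_finite_integrable_function[OF this]
  obtain h0 where h0': "h0 \<in> borel_measurable \<mu>" "integral\<^sup>N \<mu> h0 \<noteq> \<infinity>"
    "\<forall>x\<in>space \<mu>. 0 < h0 x \<and> h0 x < \<infinity>"
    by blast
  have h0: "h0 \<in> borel_measurable \<mu>" "integral\<^sup>N \<mu> h0 \<noteq> \<infinity>" "0 < h0 x" "h0 x < \<infinity>" for x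
    using h0' by simp_all
  \<comment> \<open>A finite measure \<open>\<rho>\<close> with the null sets of \<open>\<mu>\<close>. Its density \<open>h\<close> is bounded by 1 so that
    the final density \<open>W\<close> is bounded, and its convolutions are given by integrals that converge at every point.\<close>
  define h where "h x = min 1 (enn2real (h0 x))" for x
  have [measurable]: "h0 \<in> borel_measurable borel" using h0(1) by simp
  have mh [measurable]: "h \<in> borel_measurable borel" unfolding h_def by measurable
  have h: "0 < h x" "h x \<le> 1" for x
    using h0(3)[of x] h0(4)[of x] by (auto simp: h_def enn2real_positive_iff)
  have "(\<integral>\<^sup>+x. ennreal (h x) \<partial>\<mu>) \<le> (\<integral>\<^sup>+x. h0 x \<partial>\<mu>)"
  proof (rule nn_integral_mono)
    fix x
    have "ennreal (h x) \<le> ennreal (enn2real (h0 x))" by (intro ennreal_leI) (simp add: h_def)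
    also have "\<dots> = h0 x" using h0(4)[of x] by (intro ennreal_enn2real) simp
    finally show "ennreal (h x) \<le> h0 x" .
  qed
  then have fin: "(\<integral>\<^sup>+x. ennreal (h x) \<partial>\<mu>) < \<infinity>" using h0(2) by (auto simp: less_top top_unique)
  then have ih: "integrable \<mu> h" using h(1) by (intro integrableI_nonneg) (auto intro: less_imp_le)
  define \<rho> where "\<rho> = density \<mu> (\<lambda>x. ennreal (h x))"
  have [measurable_cong]: "sets \<rho> = sets borel" by (simp add: \<rho>_def sets_haar)
  have [simp]: "borel_measurable \<rho> = borel_measurable borel"
    by (rule measurable_cong_sets) (simp_all add: \<rho>_def sets_haar)
  have fin\<rho>: "finite_measure \<rho>"
    using fin by (intro finite_measureI) (simp add: \<rho>_def emeasure_density less_imp_neq)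
  have AE\<rho>: "(AE x in \<rho>. P x) \<longleftrightarrow> (AE x in \<mu>. P x)" for P
    unfolding \<rho>_def using h(1) by (subst AE_density) auto
  define N where "N = count_space I \<Otimes>\<^sub>M \<rho>"
  have finI: "finite_measure (count_space I)" using I by (rule finite_measure_count_space)
  have finN: "finite_measure N"
    unfolding N_def using fin\<rho> finI by (intro finite_measure_pair_measure)
  interpret P: pair_sigma_finite "count_space I" \<rho>
    using finI fin\<rho> by (auto simp: pair_sigma_finite_def finite_measure_def)
  let ?B = "unit_ball_Linfty N"
  have slice: "(\<lambda>z. F (g, z)) \<in> bounded_borel" if "F \<in> ?B" "g \<in> I" for F g
  proof (rule bounded_borelI)
    have "F \<in> borel_measurable (count_space I \<Otimes>\<^sub>M \<rho>)"
      using unit_ball_LinftyD(1)[OF that(1)] by (simp add: N_def)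
    then have "(\<lambda>z. F (g, z)) \<in> borel_measurable \<rho>"
      using that(2) by (intro measurable_Pair2[where x = g]) auto
    then show "(\<lambda>z. F (g, z)) \<in> borel_measurable borel" by simp
    show "\<bar>F (g, z)\<bar> \<le> 1" for z using unit_ball_LinftyD(2)[OF that(1)] .
  qed
  define D where "D F x = (\<Sum>g\<in>I. smear (indicator A) (\<lambda>z. F (g, g + z)) x - smear (indicator A) (\<lambda>z. F (g, z)) x)"
    for F :: "'g \<times> 'g \<Rightarrow> real" and x
  have tslice: "(\<lambda>z. F (g, g + z)) \<in> bounded_borel" if "F \<in> ?B" "g \<in> I" for F g
    using slice[OF that] by (rule bounded_borel_translate)
  have sm1: "smear (indicator A) (\<lambda>z. F (g, z)) \<in> bounded_borel"
    and sm2: "smear (indicator A) (\<lambda>z. F (g, g + z)) \<in> bounded_borel" if "F \<in> ?B" "g \<in> I" for F g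
    using slice[OF that] tslice[OF that] iA by (auto intro: bounded_borel_smear)
  have D_bb: "D F \<in> bounded_borel" if "F \<in> ?B" for F
    unfolding D_def[abs_def] using that by (intro bounded_borel_sum bounded_borel_diff sm1 sm2)
  define C where "C = (\<Sum>g\<in>I. 2 * measure \<mu> A)"
  have D_bound: "\<bar>D F x\<bar> \<le> C" if F: "F \<in> ?B" for F x
    unfolding D_def C_def
  proof (intro order_trans[OF sum_abs] sum_mono)
    fix g assume g: "g \<in> I"
    have "\<bar>smear (indicator A) (\<lambda>z. F (g, g + z)) x\<bar> \<le> 1 * (\<integral>l. \<bar>indicator A l\<bar> \<partial>\<mu>)"
      using unit_ball_LinftyD(2)[OF F] tslice[OF F g] iA by (intro smear_bound bounded_borel_measurable) auto
    moreover have "\<bar>smear (indicator A) (\<lambda>z. F (g, z)) x\<bar> \<le> 1 * (\<integral>l. \<bar>indicator A l\<bar> \<partial>\<mu>)"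
      using unit_ball_LinftyD(2)[OF F] slice[OF F g] iA by (intro smear_bound bounded_borel_measurable) auto
    ultimately show "\<bar>smear (indicator A) (\<lambda>z. F (g, g + z)) x - smear (indicator A) (\<lambda>z. F (g, z)) x\<bar>
        \<le> 2 * measure \<mu> A" by simp
  qed
  have "\<exists>w \<in> borel_measurable \<rho>. (\<forall>x. 0 \<le> w x \<and> w x \<le> \<bar>c\<bar> + C) \<and> \<not> (AE x in \<rho>. w x = 0) \<and>
    (\<forall>F \<in> ?B. (\<integral>x. w x * D F x \<partial>\<rho>) \<le> c * (\<integral>x. w x \<partial>\<rho>))"
  proof (rule theorem_of_the_alternative[OF finN fin\<rho>])
    show "D F \<in> borel_measurable \<rho>" if "F \<in> ?B" for F
      using bounded_borel_measurable[OF D_bb[OF that]] by simp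
    show "\<bar>D F x\<bar> \<le> C" if "F \<in> ?B" for F x using that by (rule D_bound)
  next
    fix F G and t :: real and x assume F: "F \<in> ?B" and G: "G \<in> ?B"
    have lin: "smear (indicator A) (\<lambda>z. (1 - t) * p z + t * q z) x
        = (1 - t) * smear (indicator A) p x + t * smear (indicator A) q x"
      if p: "p \<in> bounded_borel" and q: "q \<in> bounded_borel" for p q
    proof -
      have "smear (indicator A) (\<lambda>z. (1 - t) * p z + t * q z) x
          = (\<integral>l. (1 - t) * (indicator A l * p (l + x)) + t * (indicator A l * q (l + x)) \<partial>\<mu>)"
        unfolding smear_def by (intro Bochner_Integration.integral_cong refl) (simp add: algebra_simps)
      then show ?thesis
        unfolding smear_def using integrable_smear[OF iA p, of x] integrable_smear[OF iA q, of x] by simp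
    qed
    show "D (\<lambda>y. (1 - t) * F y + t * G y) x = (1 - t) * D F x + t * D G x"
      unfolding D_def sum_distrib_left sum.distrib[symmetric]
    proof (intro sum.cong refl)
      fix g assume g: "g \<in> I"
      show "smear (indicator A) (\<lambda>z. (1 - t) * F (g, g + z) + t * G (g, g + z)) x
          - smear (indicator A) (\<lambda>z. (1 - t) * F (g, z) + t * G (g, z)) x
        = (1 - t) * (smear (indicator A) (\<lambda>z. F (g, g + z)) x - smear (indicator A) (\<lambda>z. F (g, z)) x)
          + t * (smear (indicator A) (\<lambda>z. G (g, g + z)) x - smear (indicator A) (\<lambda>z. G (g, z)) x)"
        unfolding lin[OF tslice[OF F g] tslice[OF G g]] lin[OF slice[OF F g] slice[OF G g]]
        by (simp add: algebra_simps)
    qed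
  next
    fix F :: "nat \<Rightarrow> 'g \<times> 'g \<Rightarrow> real" and G
    assume F: "\<And>n. F n \<in> ?B" and G: "G \<in> ?B" and lim: "AE y in N. (\<lambda>n. F n y) \<longlonglongrightarrow> G y"
    have AEg: "AE z in \<mu>. (\<lambda>n. F n (g, z)) \<longlonglongrightarrow> G (g, z)" if "g \<in> I" for g
      using P.AE_pair[OF lim[unfolded N_def]] that by (simp add: AE_count_space AE\<rho>)
    have conv: "(\<lambda>n. smear (indicator A) (p n) x) \<longlonglongrightarrow> smear (indicator A) q x"
      if p: "\<And>n. p n \<in> bounded_borel" "\<And>n z. \<bar>p n z\<bar> \<le> 1" and q: "q \<in> bounded_borel"
        and l: "AE z in \<mu>. (\<lambda>n. p n z) \<longlonglongrightarrow> q z" for p q x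
      unfolding smear_def
    proof (rule integral_dominated_convergence[where w = "indicator A"])
      have [measurable]: "p n \<in> borel_measurable borel" "q \<in> borel_measurable borel" for n
        using p q by (auto intro: bounded_borel_measurable)
      show "(\<lambda>l. indicator A l * q (l + x)) \<in> borel_measurable \<mu>"
        "(\<lambda>l. indicator A l * p n (l + x)) \<in> borel_measurable \<mu>" for n by measurable
      show "integrable \<mu> (indicator A :: 'g \<Rightarrow> real)" by (rule iA)
      show "AE l in \<mu>. (\<lambda>n. indicator A l * p n (l + x)) \<longlonglongrightarrow> indicator A l * q (l + x)"
        using AE_translate_right[OF l, of x] by eventually_elim (intro tendsto_intros)
      show "AE l in \<mu>. norm (indicator A l * p n (l + x)) \<le> indicator A l" for n
        using p(2) by (auto simp: indicator_def)
    qed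
    have "(\<lambda>n. D (F n) x) \<longlonglongrightarrow> D G x" for x
      unfolding D_def
    proof (intro tendsto_sum tendsto_diff)
      fix g assume g: "g \<in> I"
      show "(\<lambda>n. smear (indicator A) (\<lambda>z. F n (g, z)) x) \<longlonglongrightarrow> smear (indicator A) (\<lambda>z. G (g, z)) x"
        using unit_ball_LinftyD(2)[OF F] by (intro conv slice F G g AEg) auto
      show "(\<lambda>n. smear (indicator A) (\<lambda>z. F n (g, g + z)) x) \<longlonglongrightarrow> smear (indicator A) (\<lambda>z. G (g, g + z)) x"
        using unit_ball_LinftyD(2)[OF F] by (intro conv tslice F G g AE_translate_left[OF AEg]) auto
    qed
    then show "AE x in \<rho>. (\<lambda>n. D (F n) x) \<longlonglongrightarrow> D G x" by simp
  next
    fix F assume F: "F \<in> ?B"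
    show "\<not> (AE x in \<rho>. c \<le> D F x)"
    proof
      assume "AE x in \<rho>. c \<le> D F x"
      then have "M (\<lambda>_. c) \<le> M (D F)"
        using F by (intro mean_mono_AE bounded_borel_const D_bb) (auto simp: AE\<rho>)
      also have "M (D F) = (\<Sum>g\<in>I. M (\<lambda>x. smear (indicator A) (\<lambda>z. F (g, g + z)) x - smear (indicator A) (\<lambda>z. F (g, z)) x))"
        unfolding D_def[abs_def] using F by (intro mean_sum bounded_borel_diff sm1 sm2)
      also have "\<dots> = (\<Sum>g\<in>I. 0)"
        using F by (intro sum.cong refl) (simp add: mean_diff sm1 sm2 mean_smear_translate[OF A slice])
      finally show False using c by (simp add: mean_const)
    qed
  qed
  then obtain w where w: "w \<in> borel_measurable borel" "\<And>x. 0 \<le> w x" "\<And>x. w x \<le> \<bar>c\<bar> + C"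
    and w_ne: "\<not> (AE x in \<mu>. w x = 0)"
    and w_le: "\<And>F. F \<in> ?B \<Longrightarrow> (\<integral>x. w x * D F x \<partial>\<rho>) \<le> c * (\<integral>x. w x \<partial>\<rho>)"
    by (auto simp: AE\<rho>)
  note [measurable] = w(1)
  define W where "W x = w x * h x" for x
  have [measurable]: "W \<in> borel_measurable borel" unfolding W_def by measurable
  have W0: "0 \<le> W x" for x using w(2) h(1)[of x] by (simp add: W_def)
  have iW: "integrable \<mu> W"
    using integrable_mult_bounded[OF ih w(1), of "\<bar>c\<bar> + C"] w(2,3) by (simp add: W_def[abs_def] mult.commute)
  have "W x \<le> (\<bar>c\<bar> + C) * 1" for x
    unfolding W_def using w(2,3)[of x] h[of x] by (intro mult_mono) auto
  then have W_bb: "W \<in> bounded_borel" using W0 by (intro bounded_borelI[of _ "\<bar>c\<bar> + C"]) auto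
  have to_mu: "(\<integral>x. w x * f x \<partial>\<rho>) = (\<integral>x. W x * f x \<partial>\<mu>)" if [measurable]: "f \<in> borel_measurable borel" for f
    unfolding \<rho>_def W_def using h(1) by (subst integral_density) (auto intro!: less_imp_le simp: mult_ac)
  have W_pos: "0 < (\<integral>x. W x \<partial>\<mu>)"
  proof -
    have "(\<integral>x. W x \<partial>\<mu>) \<noteq> 0"
    proof
      assume "(\<integral>x. W x \<partial>\<mu>) = 0"
      then have "AE x in \<mu>. W x = 0"
        using integral_nonneg_eq_0_iff_AE[OF iW] W0 by simp
      then have "AE x in \<mu>. w x = 0"
        by eventually_elim (use h(1) in \<open>auto simp: W_def less_imp_neq[symmetric]\<close>)
      then show False using w_ne by simp
    qed
    moreover have "0 \<le> (\<integral>x. W x \<partial>\<mu>)" using W0 by (intro Bochner_Integration.integral_nonneg) auto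
    ultimately show ?thesis by simp
  qed
  define V where "V = spread (indicator A) W"
  have mV [measurable]: "V \<in> borel_measurable borel" unfolding V_def by measurable
  have iV: "integrable \<mu> V" unfolding V_def by (rule integral_spread(1)[OF iA iW])
  \<comment> \<open>Testing the certificate against these signs produces the sum of the \<open>L\<^sup>1\<close> displacements.\<close>
  define F where "F = (\<lambda>(g, x). sgn (V (- g + x) - V x))"
  have F: "F \<in> ?B"
  proof -
    have "F \<in> borel_measurable N"
      unfolding N_def using I
    proof (intro measurable_pair_measure_countable1)
      show "(\<lambda>y. F (x, y)) \<in> borel_measurable \<rho>" for x
        unfolding F_def by simp
    qed (auto simp: countable_finite)
    moreover have "\<bar>F y\<bar> \<le> 1" for y by (auto simp: F_def sgn_if split: prod.split)
    ultimately show ?thesis by (simp add: unit_ball_Linfty_def)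
  qed
  have "(\<Sum>g\<in>I. \<integral>x. \<bar>V (- g + x) - V x\<bar> \<partial>\<mu>) = (\<Sum>g\<in>I. (\<integral>x. W x * smear (indicator A) (\<lambda>z. F (g, g + z)) x \<partial>\<mu>)
      - (\<integral>x. W x * smear (indicator A) (\<lambda>z. F (g, z)) x \<partial>\<mu>))"
  proof (intro sum.cong refl)
    fix g assume g: "g \<in> I"
    have mF [measurable]: "(\<lambda>z. F (g, z)) \<in> borel_measurable borel"
      using slice[OF F g] by (rule bounded_borel_measurable)
    have Fb: "\<bar>F (g, z)\<bar> \<le> 1" for z using unit_ball_LinftyD(2)[OF F] .
    have iVg: "integrable \<mu> (\<lambda>x. V (- g + x))" using iV by (rule integrable_translate)
    have "(\<integral>x. W x * smear (indicator A) (\<lambda>z. F (g, g + z)) x \<partial>\<mu>) = (\<integral>x. F (g, g + x) * V x \<partial>\<mu>)"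
      unfolding V_def by (rule smear_spread_adjoint[OF iA iW tslice[OF F g]])
    also have "\<dots> = (\<integral>x. F (g, x) * V (- g + x) \<partial>\<mu>)"
      using integral_translate[of "\<lambda>x. F (g, x) * V (- g + x)" g] by simp
    finally have 1: "(\<integral>x. W x * smear (indicator A) (\<lambda>z. F (g, g + z)) x \<partial>\<mu>)
        = (\<integral>x. V (- g + x) * F (g, x) \<partial>\<mu>)" by (simp add: mult.commute)
    have 2: "(\<integral>x. W x * smear (indicator A) (\<lambda>z. F (g, z)) x \<partial>\<mu>) = (\<integral>x. V x * F (g, x) \<partial>\<mu>)"
      unfolding V_def using smear_spread_adjoint[OF iA iW slice[OF F g]] by (simp add: mult.commute)
    have "(\<integral>x. \<bar>V (- g + x) - V x\<bar> \<partial>\<mu>) = (\<integral>x. V (- g + x) * F (g, x) - V x * F (g, x) \<partial>\<mu>)"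
      by (intro Bochner_Integration.integral_cong refl)
        (auto simp: F_def sgn_if)
    also have "\<dots> = (\<integral>x. V (- g + x) * F (g, x) \<partial>\<mu>) - (\<integral>x. V x * F (g, x) \<partial>\<mu>)"
      using integrable_mult_bounded[OF iVg mF Fb] integrable_mult_bounded[OF iV mF Fb]
      by (intro Bochner_Integration.integral_diff)
    finally show "(\<integral>x. \<bar>V (- g + x) - V x\<bar> \<partial>\<mu>) = (\<integral>x. W x * smear (indicator A) (\<lambda>z. F (g, g + z)) x \<partial>\<mu>)
      - (\<integral>x. W x * smear (indicator A) (\<lambda>z. F (g, z)) x \<partial>\<mu>)" by (simp only: 1 2)
  qed
  also have "\<dots> = (\<integral>x. W x * D F x \<partial>\<mu>)"
  proof -
    have iWs: "integrable \<mu> (\<lambda>x. W x * f x)" if "f \<in> bounded_borel" for f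
      using bounded_borel_bound[OF that] bounded_borel_measurable[OF that]
      by (auto intro: integrable_mult_bounded[OF iW])
    have "(\<integral>x. W x * D F x \<partial>\<mu>) = (\<integral>x. (\<Sum>g\<in>I. W x * smear (indicator A) (\<lambda>z. F (g, g + z)) x
        - W x * smear (indicator A) (\<lambda>z. F (g, z)) x) \<partial>\<mu>)"
      unfolding D_def by (simp add: sum_distrib_left right_diff_distrib)
    also have "\<dots> = (\<Sum>g\<in>I. \<integral>x. W x * smear (indicator A) (\<lambda>z. F (g, g + z)) x
        - W x * smear (indicator A) (\<lambda>z. F (g, z)) x \<partial>\<mu>)"
      by (intro Bochner_Integration.integral_sum Bochner_Integration.integrable_diff iWs sm1[OF F] sm2[OF F])
    also have "\<dots> = (\<Sum>g\<in>I. (\<integral>x. W x * smear (indicator A) (\<lambda>z. F (g, g + z)) x \<partial>\<mu>)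
        - (\<integral>x. W x * smear (indicator A) (\<lambda>z. F (g, z)) x \<partial>\<mu>))"
      by (intro sum.cong refl Bochner_Integration.integral_diff iWs sm1[OF F] sm2[OF F])
    finally show ?thesis by simp
  qed
  also have "\<dots> = (\<integral>x. w x * D F x \<partial>\<rho>)"
    using bounded_borel_measurable[OF D_bb[OF F]] by (intro to_mu[symmetric])
  also have "\<dots> \<le> c * (\<integral>x. w x \<partial>\<rho>)" using F by (rule w_le)
  also have "(\<integral>x. w x \<partial>\<rho>) = (\<integral>x. W x \<partial>\<mu>)" using to_mu[of "\<lambda>_. 1"] by simp
  finally show ?thesis
    using iW W_bb W0 W_pos unfolding V_def by blast
qed

text \<open>
  For \<open>g\<close> in \<open>K\<close> and \<open>i\<close> in a finite net of \<open>K\<close>, the translates of a convolution with the indicator of \<open>A\<close>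
  by \<open>g\<close> and \<open>i\<close> are at distance at most the measure of the symmetric difference of \<open>g + A\<close> and \<open>i + A\<close>, times the
  mass of the density. The net depends only on \<open>A\<close>, \<open>K\<close> and \<open>\<epsilon>\<close>, so the density can be chosen after it.
\<close>

theorem reiter_condition:
  assumes K: "compact K" and e: "\<epsilon> > 0"
  shows "\<exists>V :: 'g \<Rightarrow> real. integrable \<mu> V \<and> (\<forall>x. 0 \<le> V x) \<and> (\<integral>x. V x \<partial>\<mu>) = 1 \<and>
    (\<forall>g\<in>K. (\<integral>x. \<bar>V (- g + x) - V x\<bar> \<partial>\<mu>) \<le> \<epsilon>)"
proof -
  obtain U A where UA: "open U" "compact A" "(0::'g) \<in> U" "U \<subseteq> A"
    by (rule compact_neighbourhood[OF locally_compact])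
  note A = UA(2)
  note iA = integrable_indicator_compact[OF A]
  have [measurable]: "A \<in> sets borel" using A by (rule compact_sets)
  have "0 < emeasure \<mu> U" using UA by (intro open_pos)
  also have "\<dots> \<le> emeasure \<mu> A"
    using UA by (intro emeasure_mono) (auto simp: sets_haar compact_sets)
  finally have a: "0 < measure \<mu> A"
    using finite_on_compact[OF A] by (simp add: measure_def enn2real_positive_iff)
  \<comment> \<open>Half of the error is spent on the net and half on the displacements; the factor \<open>\<mu>(A)\<close> compensates for
    the mass of the convolution.\<close>
  define c where "c = \<epsilon> * measure \<mu> A / 2"
  have c: "c > 0" using e a by (simp add: c_def)
  obtain U where U: "open U" "0 \<in> U" "\<And>g. g \<in> U \<Longrightarrow> shift_diff A g < c"
    using shift_diff_small[OF A c] by blast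
  have opU: "open ((+) (- i) -` U)" for i
    using U by (intro open_vimage continuous_intros)
  obtain I where I: "I \<subseteq> K" "finite I" "K \<subseteq> (\<Union>i\<in>I. (+) (- i) -` U)"
  proof (rule compactE_image[OF K, of K "\<lambda>i. (+) (- i) -` U"])
    show "K \<subseteq> (\<Union>i\<in>K. (+) (- i) -` U)" using U(2) by auto
  qed (use opU in auto)
  obtain w where w: "integrable \<mu> w" "w \<in> bounded_borel" "\<And>x. 0 \<le> w x" "0 < (\<integral>x. w x \<partial>\<mu>)"
    and sum_le: "(\<Sum>g\<in>I. \<integral>x. \<bar>spread (indicator A) w (- g + x) - spread (indicator A) w x\<bar> \<partial>\<mu>)
      \<le> c * (\<integral>x. w x \<partial>\<mu>)"
    using approximately_invariant_spread[OF A I(2) c] by blast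
  have mw [measurable]: "w \<in> borel_measurable borel" using w(2) by (rule bounded_borel_measurable)
  define S where "S = spread (indicator A) w"
  have iS: "integrable \<mu> S" "(\<integral>x. S x \<partial>\<mu>) = measure \<mu> A * (\<integral>x. w x \<partial>\<mu>)"
    unfolding S_def using integral_spread[OF iA w(1)] by simp_all
  have iSg: "integrable \<mu> (\<lambda>x. S (g + x))" for g using iS(1) by (rule integrable_translate)
  have S0: "0 \<le> S x" for x
    unfolding S_def spread_def using w(3) by (intro Bochner_Integration.integral_nonneg) auto
  have near: "(\<integral>x. \<bar>S (- g + x) - S x\<bar> \<partial>\<mu>) \<le> \<epsilon> * (\<integral>x. S x \<partial>\<mu>)" if g: "g \<in> K" for g
  proof -
    obtain i where i: "i \<in> I" "- i + g \<in> U" using I(3) g by auto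
    have sp: "S (- g + x) = spread (\<lambda>l. indicator A (- g + l)) w x" for g x
      unfolding S_def by (rule spread_translate) measurable
    note iAg = integrable_indicator_compact_translate[OF A]
    define k :: "'g \<Rightarrow> real" where "k l = indicator A (- g + l) - indicator A (- i + l)" for l
    have k: "integrable \<mu> k" unfolding k_def using iAg by (intro Bochner_Integration.integrable_diff)
    have "S (- g + x) - S (- i + x) = spread k w x" for x
      unfolding sp unfolding spread_def k_def
      using integrable_spread_kernel[OF iAg w(2), of "- g" x] integrable_spread_kernel[OF iAg w(2), of "- i" x]
      by (simp add: left_diff_distrib)
    then have "(\<integral>x. \<bar>S (- g + x) - S (- i + x)\<bar> \<partial>\<mu>) = (\<integral>x. \<bar>spread k w x\<bar> \<partial>\<mu>)" by simp
    also have "\<dots> \<le> (\<integral>l. \<bar>k l\<bar> \<partial>\<mu>) * (\<integral>x. w x \<partial>\<mu>)" by (rule spread_L1_bound[OF k w(1,3)])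
    also have "(\<integral>l. \<bar>k l\<bar> \<partial>\<mu>) = shift_diff A (- i + g)" unfolding k_def by (rule shift_diff_translate[OF A])
    also have "shift_diff A (- i + g) * (\<integral>x. w x \<partial>\<mu>) \<le> c * (\<integral>x. w x \<partial>\<mu>)"
      using U(3)[OF i(2)] w(4) by (intro mult_right_mono) auto
    finally have 1: "(\<integral>x. \<bar>S (- g + x) - S (- i + x)\<bar> \<partial>\<mu>) \<le> c * (\<integral>x. w x \<partial>\<mu>)" .
    have "(\<integral>x. \<bar>S (- i + x) - S x\<bar> \<partial>\<mu>) \<le> (\<Sum>g\<in>I. \<integral>x. \<bar>S (- g + x) - S x\<bar> \<partial>\<mu>)"
      using i(1) I(2) by (intro member_le_sum) (auto intro!: Bochner_Integration.integral_nonneg)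
    then have 2: "(\<integral>x. \<bar>S (- i + x) - S x\<bar> \<partial>\<mu>) \<le> c * (\<integral>x. w x \<partial>\<mu>)"
      using sum_le by (simp add: S_def)
    have "(\<integral>x. \<bar>S (- g + x) - S x\<bar> \<partial>\<mu>)
        \<le> (\<integral>x. \<bar>S (- g + x) - S (- i + x)\<bar> + \<bar>S (- i + x) - S x\<bar> \<partial>\<mu>)"
      using iS(1) iSg
      by (intro integral_mono integrable_abs Bochner_Integration.integrable_add Bochner_Integration.integrable_diff) auto
    also have "\<dots> = (\<integral>x. \<bar>S (- g + x) - S (- i + x)\<bar> \<partial>\<mu>) + (\<integral>x. \<bar>S (- i + x) - S x\<bar> \<partial>\<mu>)"
      using iS(1) iSg
      by (intro Bochner_Integration.integral_add integrable_abs Bochner_Integration.integrable_diff)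
    also have "\<dots> \<le> 2 * (c * (\<integral>x. w x \<partial>\<mu>))" using 1 2 by simp
    also have "\<dots> = \<epsilon> * (\<integral>x. S x \<partial>\<mu>)" by (simp add: c_def iS(2))
    finally show ?thesis .
  qed
  define s where "s = (\<integral>x. S x \<partial>\<mu>)"
  have s: "s > 0" using a w(4) by (simp add: s_def iS(2))
  show ?thesis
  proof (intro exI conjI ballI allI)
    show "integrable \<mu> (\<lambda>x. S x / s)" using iS(1) by simp
    show "0 \<le> S x / s" for x using S0 s by simp
    show "(\<integral>x. S x / s \<partial>\<mu>) = 1" using s by (simp add: s_def)
    fix g assume "g \<in> K"
    have "(\<integral>x. \<bar>S (- g + x) / s - S x / s\<bar> \<partial>\<mu>) = (\<integral>x. \<bar>S (- g + x) - S x\<bar> / s \<partial>\<mu>)"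
      using s by (intro Bochner_Integration.integral_cong refl) (simp add: diff_divide_distrib[symmetric])
    also have "\<dots> = (\<integral>x. \<bar>S (- g + x) - S x\<bar> \<partial>\<mu>) / s" by simp
    also have "\<dots> \<le> \<epsilon>" using near[OF \<open>g \<in> K\<close>] s by (simp add: s_def field_simps)
    finally show "(\<integral>x. \<bar>S (- g + x) / s - S x / s\<bar> \<partial>\<mu>) \<le> \<epsilon>" .
  qed
qed

end

section \<open>The coset space as a measure space\<close>

lemma left_coset_eq_iff:
  assumes "closed_subgroup H"
  shows "left_coset H a = left_coset H b \<longleftrightarrow> - a + b \<in> H"
proof
  assume "left_coset H a = left_coset H b"
  moreover have "b \<in> left_coset H b"
    using assms by (auto simp: left_coset_def closed_subgroup_def intro!: image_eqI[of _ _ 0])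
  ultimately have "b \<in> left_coset H a" by simp
  then show "- a + b \<in> H" by (auto simp: left_coset_def)
next
  assume h: "- a + b \<in> H"
  have "- b + a = - (- a + b)" by (simp add: minus_add)
  then have h': "- b + a \<in> H" using assms h by (simp add: closed_subgroup_def)
  have "left_coset H d \<subseteq> left_coset H c" if "- c + d \<in> H" for c d
  proof
    fix x assume "x \<in> left_coset H d"
    then obtain k where k: "k \<in> H" "x = d + k" by (auto simp: left_coset_def)
    have "x = c + (- c + d + k)" by (simp add: k(2) add.assoc)
    moreover have "- c + d + k \<in> H" using assms that k(1) by (simp add: closed_subgroup_def)
    ultimately show "x \<in> left_coset H c" unfolding left_coset_def by (rule image_eqI)
  qed
  from this[OF h] this[OF h'] show "left_coset H a = left_coset H b" by blast
qed

lemma openin_image_left_coset: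
  assumes H: "closed_subgroup H" and V: "open V"
  shows "openin (coset_topology H) (left_coset H ` V)"
proof -
  have "left_coset H -` (left_coset H ` V) = (\<Union>h\<in>H. (\<lambda>x. x + h) -` V)"
  proof (intro equalityI subsetI)
    fix x assume "x \<in> left_coset H -` (left_coset H ` V)"
    then obtain v where v: "v \<in> V" "left_coset H x = left_coset H v" by auto
    then have "- x + v \<in> H" using left_coset_eq_iff[OF H] by blast
    moreover have "x + (- x + v) \<in> V" using v by simp
    ultimately show "x \<in> (\<Union>h\<in>H. (\<lambda>x. x + h) -` V)" by blast
  next
    fix x assume "x \<in> (\<Union>h\<in>H. (\<lambda>x. x + h) -` V)"
    then obtain h where h: "h \<in> H" "x + h \<in> V" by auto
    then have "left_coset H x = left_coset H (x + h)"
      unfolding left_coset_eq_iff[OF H] by simp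
    then show "x \<in> left_coset H -` (left_coset H ` V)" using h(2) by auto
  qed
  moreover have "open ((\<lambda>x. x + h) -` V)" for h
    using V by (intro open_vimage continuous_intros)
  ultimately show ?thesis by (auto simp: openin_coset_topology coset_space_def)
qed

text \<open>
  The images of the interiors of an exhaustion of \<open>G\<close> by compact sets form an increasing open cover of the
  coset space.
\<close>

lemma cocompact_iff:
  fixes H :: "'g::{topological_group_add, t2_space, second_countable_topology} set"
  assumes H: "closed_subgroup H" and lc: "locally_compact_space (euclidean :: 'g topology)"
  shows "cocompact H \<longleftrightarrow> (\<exists>C. compact C \<and> left_coset H ` C = coset_space H)"
proof
  assume c: "cocompact H"
  obtain K :: "nat \<Rightarrow> 'g set" where K: "\<And>n. compact (K n)" "incseq K"
    "\<And>C. compact C \<Longrightarrow> \<exists>n. C \<subseteq> K n"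
    using compact_exhaustion[OF lc] by blast
  define F where "F = range (\<lambda>n. left_coset H ` interior (K n))"
  have "coset_space H \<subseteq> \<Union>F"
  proof
    fix X assume "X \<in> coset_space H"
    then obtain a where a: "X = left_coset H a" by (auto simp: coset_space_def)
    obtain U C where UC: "open U" "compact C" "a \<in> U" "U \<subseteq> C" by (rule compact_neighbourhood[OF lc])
    obtain n where "C \<subseteq> K n" using K(3)[OF UC(2)] by blast
    then have "a \<in> interior (K n)" using UC by (meson interiorI order_trans)
    then show "X \<in> \<Union>F" by (auto simp: F_def a)
  qed
  moreover have "\<forall>X\<in>F. openin (coset_topology H) X"
    using H by (auto simp: F_def intro: openin_image_left_coset)
  ultimately obtain F' where F': "finite F'" "F' \<subseteq> F" "coset_space H \<subseteq> \<Union>F'"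
    using c unfolding cocompact_def compact_space_def compactin_def topspace_coset_topology by blast
  have "\<exists>J. finite J \<and> F' = (\<lambda>n. left_coset H ` interior (K n)) ` J"
    using finite_subset_image[OF F'(1) F'(2)[unfolded F_def]] by auto
  then obtain J where J: "finite J" "F' = (\<lambda>n. left_coset H ` interior (K n)) ` J" by blast
  obtain n where n: "\<forall>j\<in>J. j \<le> n" using J(1) finite_nat_set_iff_bounded_le by blast
  have "left_coset H ` interior (K j) \<subseteq> left_coset H ` K n" if "j \<in> J" for j
    using interior_subset[of "K j"] K(2) n that by (intro image_mono) (auto simp: incseq_def)
  then have "coset_space H \<subseteq> left_coset H ` K n" using F'(3) J(2) by blast
  moreover have "left_coset H ` K n \<subseteq> coset_space H" by (auto simp: coset_space_def)
  ultimately show "\<exists>C. compact C \<and> left_coset H ` C = coset_space H" using K(1) by blast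
next
  assume "\<exists>C. compact C \<and> left_coset H ` C = coset_space H"
  then obtain C where C: "compact C" "left_coset H ` C = coset_space H" by blast
  have "compactin (coset_topology H) (left_coset H ` C)"
    using C(1) by (intro image_compactin[OF _ quotient_imp_continuous_map[OF quotient_map_left_coset]]) simp
  then show "cocompact H"
    by (simp add: cocompact_def compact_space_def topspace_coset_topology C(2))
qed

lemma coset_action_cancel [simp]:
  "coset_action (- g) (coset_action g X) = X" "coset_action g (coset_action (- g) X) = X"
  by (simp_all add: coset_action_def image_image)

lemma coset_action_add: "coset_action (g + h) X = coset_action g (coset_action h X)"
  by (simp add: coset_action_def image_image add.assoc)

locale coset_probability = haar \<mu> + m: prob_space m
  for \<mu> :: "'g::{topological_group_add, t2_space, second_countable_topology} measure"
    and m :: "'g set measure" +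
  fixes H :: "'g set"
  assumes subgroup: "closed_subgroup H"
    and invariant_prob: "invariant_coset_probability H m"
begin

lemma space_m: "space m = coset_space H"
  using invariant_prob by (simp add: invariant_coset_probability_def)

lemma sets_m: "sets m = sigma_sets (coset_space H) {U. openin (coset_topology H) U}"
  using invariant_prob by (simp add: invariant_coset_probability_def)

lemma distr_action: "distr m m (coset_action g) = m"
  using invariant_prob by (simp add: invariant_coset_probability_def)

lemma opens_subset: "{U. openin (coset_topology H) U} \<subseteq> Pow (coset_space H)"
  by (auto simp: openin_coset_topology)

lemma sets_openin: "openin (coset_topology H) U \<Longrightarrow> U \<in> sets m"
  by (simp add: sets_m sigma_sets.Basic)

lemma measurable_left_coset [measurable]: "left_coset H \<in> borel \<rightarrow>\<^sub>M m"
  by (rule measurable_sigma_sets[OF sets_m opens_subset]) (auto simp: openin_coset_topology coset_space_def)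

text \<open>
  The Borel sets of the coset space are not given as those of a topological type, so joint measurability is
  checked on open sets: by second countability the preimage of an open set is a countable union of rectangles
  \<open>a \<times> p(b)\<close> with basic open sets \<open>a\<close> and \<open>b\<close>.
\<close>

lemma measurable_action [measurable]: "(\<lambda>(g, x). coset_action g x) \<in> borel \<Otimes>\<^sub>M m \<rightarrow>\<^sub>M m"
proof (rule measurable_sigma_sets[OF sets_m opens_subset])
  show "(\<lambda>(g, x). coset_action g x) \<in> space (borel \<Otimes>\<^sub>M m) \<rightarrow> coset_space H"
    by (auto simp: space_pair_measure space_m coset_space_def coset_action_left_coset)
next
  fix U assume "U \<in> {U. openin (coset_topology H) U}"
  then have U: "open (left_coset H -` U)" by (simp add: openin_coset_topology)
  obtain \<B> :: "'g set set" where B: "countable \<B>" "topological_basis \<B>"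
    using ex_countable_basis by blast
  define P where "P = {(a, b). a \<in> \<B> \<and> b \<in> \<B> \<and> (\<forall>g\<in>a. \<forall>h\<in>b. left_coset H (g + h) \<in> U)}"
  have "P \<subseteq> \<B> \<times> \<B>" by (auto simp: P_def)
  moreover have "countable (\<B> \<times> \<B>)" using B(1) by simp
  ultimately have cP: "countable P" by (rule countable_subset)
  have "(\<lambda>(g, x). coset_action g x) -` U \<inter> space (borel \<Otimes>\<^sub>M m) = (\<Union>(a, b)\<in>P. a \<times> left_coset H ` b)"
  proof (intro equalityI subsetI)
    fix z assume z: "z \<in> (\<lambda>(g, x). coset_action g x) -` U \<inter> space (borel \<Otimes>\<^sub>M m)"
    obtain g h where gh: "z = (g, left_coset H h)"
      using z by (auto simp: space_pair_measure space_m coset_space_def)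
    have inU: "left_coset H (g + h) \<in> U" using z by (simp add: gh coset_action_left_coset)
    have "open ((\<lambda>(g, h). g + h) -` (left_coset H -` U))"
      by (rule open_vimage[OF U]) (auto simp: case_prod_unfold intro!: continuous_intros)
    moreover have "(g, h) \<in> (\<lambda>(g, h). g + h) -` (left_coset H -` U)" using inU by simp
    ultimately obtain S T where ST: "open S" "open T" "(g, h) \<in> S \<times> T"
      "S \<times> T \<subseteq> (\<lambda>(g, h). g + h) -` (left_coset H -` U)"
      by (rule open_prod_elim)
    have "g \<in> S" "h \<in> T" using ST(3) by auto
    obtain a where a: "a \<in> \<B>" "g \<in> a" "a \<subseteq> S" by (rule topological_basisE[OF B(2) ST(1) \<open>g \<in> S\<close>])
    obtain b where b: "b \<in> \<B>" "h \<in> b" "b \<subseteq> T" by (rule topological_basisE[OF B(2) ST(2) \<open>h \<in> T\<close>])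
    have "left_coset H (s + t) \<in> U" if "s \<in> a" "t \<in> b" for s t
    proof -
      have "(s, t) \<in> S \<times> T" using that a(3) b(3) by blast
      then have "(s, t) \<in> (\<lambda>(g, h). g + h) -` (left_coset H -` U)" using ST(4) by (rule rev_subsetD)
      then show ?thesis by simp
    qed
    then have "(a, b) \<in> P" using a(1) b(1) by (simp add: P_def)
    then show "z \<in> (\<Union>(a, b)\<in>P. a \<times> left_coset H ` b)"
      using a(2) b(2) by (intro UN_I[of "(a, b)"]) (simp_all add: gh)
  next
    fix z assume "z \<in> (\<Union>(a, b)\<in>P. a \<times> left_coset H ` b)"
    then obtain a b g h where "(a, b) \<in> P" "z = (g, left_coset H h)" "g \<in> a" "h \<in> b" by auto
    then show "z \<in> (\<lambda>(g, x). coset_action g x) -` U \<inter> space (borel \<Otimes>\<^sub>M m)"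
      by (auto simp: P_def coset_action_left_coset space_pair_measure space_m coset_space_def)
  qed
  also have "\<dots> \<in> sets (borel \<Otimes>\<^sub>M m)"
  proof (rule sets.countable_UN''[OF cP])
    fix z assume "z \<in> P"
    then obtain a b where z: "z = (a, b)" "a \<in> \<B>" "b \<in> \<B>" by (auto simp: P_def)
    then have op: "open a" "open b" using topological_basis_open[OF B(2)] by simp_all
    have "a \<times> left_coset H ` b \<in> sets (borel \<Otimes>\<^sub>M m)"
    proof (rule pair_measureI)
      show "a \<in> sets borel" using op(1) by (rule borel_open)
      show "left_coset H ` b \<in> sets m"
        by (rule sets_openin[OF openin_image_left_coset[OF subgroup op(2)]])
    qed
    then show "(case z of (a, b) \<Rightarrow> a \<times> left_coset H ` b) \<in> sets (borel \<Otimes>\<^sub>M m)"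
      by (simp add: z(1))
  qed
  finally show "(\<lambda>(g, x). coset_action g x) -` U \<inter> space (borel \<Otimes>\<^sub>M m) \<in> sets (borel \<Otimes>\<^sub>M m)" .
qed

lemma measurable_coset_action [measurable (raw)]:
  assumes "f \<in> borel_measurable N" "k \<in> N \<rightarrow>\<^sub>M m"
  shows "(\<lambda>z. coset_action (f z) (k z)) \<in> N \<rightarrow>\<^sub>M m"
  using measurable_compose[OF measurable_Pair[OF assms] measurable_action] by simp

lemma nn_integral_action:
  assumes [measurable]: "f \<in> borel_measurable m"
  shows "(\<integral>\<^sup>+x. f (coset_action g x) \<partial>m) = (\<integral>\<^sup>+x. f x \<partial>m)"
  by (subst (2) distr_action[of g, symmetric]) (simp add: nn_integral_distr)

lemma integral_action:
  fixes f :: "'g set \<Rightarrow> 'c::{banach, second_countable_topology}"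
  assumes [measurable]: "f \<in> borel_measurable m"
  shows "(\<integral>x. f (coset_action g x) \<partial>m) = (\<integral>x. f x \<partial>m)"
  by (subst (2) distr_action[of g, symmetric]) (simp add: integral_distr)

lemma integrable_action:
  fixes f :: "'g set \<Rightarrow> 'c::{banach, second_countable_topology}"
  assumes "integrable m f"
  shows "integrable m (\<lambda>x. f (coset_action g x))"
proof -
  have [measurable]: "f \<in> borel_measurable m" using assms by simp
  have "integrable (distr m m (coset_action g)) f" using assms by (simp add: distr_action)
  then show ?thesis by (subst (asm) integrable_distr_eq) simp_all
qed

sublocale GX: pair_sigma_finite \<mu> m ..

text \<open>
  By Fubini and the invariance of \<open>m\<close>, the set of \<open>h\<close> with \<open>h x \<in> E\<close> is Haar null for almost every \<open>x\<close>, in particular for some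
  \<open>x\<close>. Another base point only changes this set by a right translation.
\<close>

lemma null_preimage:
  assumes E: "E \<in> sets m" and 0: "emeasure m E = 0"
  shows "emeasure \<mu> {h. left_coset H (h + y) \<in> E} = 0"
proof -
  note [measurable] = E
  define B where "B = left_coset H -` E"
  have B [measurable]: "B \<in> sets borel" unfolding B_def using measurable_sets[OF measurable_left_coset E] by simp
  have "(\<integral>\<^sup>+x. (\<integral>\<^sup>+h. indicator E (coset_action h x) \<partial>\<mu>) \<partial>m)
      = (\<integral>\<^sup>+h. (\<integral>\<^sup>+x. indicator E (coset_action h x) \<partial>m) \<partial>\<mu>)"
    by (rule GX.Fubini') measurable
  also have "\<dots> = 0" using 0 by (simp add: nn_integral_action[of "indicator E"])
  finally have "AE x in m. (\<integral>\<^sup>+h. indicator E (coset_action h x) \<partial>\<mu>) = 0"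
    by (subst (asm) nn_integral_0_iff_AE) measurable
  then have "\<exists>x\<in>space m. (\<integral>\<^sup>+h. indicator E (coset_action h x) \<partial>\<mu>) = 0"
  proof (rule contrapos_pp)
    assume none: "\<not> (\<exists>x\<in>space m. (\<integral>\<^sup>+h. indicator E (coset_action h x) \<partial>\<mu>) = 0)"
    show "\<not> (AE x in m. (\<integral>\<^sup>+h. indicator E (coset_action h x) \<partial>\<mu>) = 0)"
    proof
      assume "AE x in m. (\<integral>\<^sup>+h. indicator E (coset_action h x) \<partial>\<mu>) = 0"
      then have "AE x in m. False" using AE_space by eventually_elim (use none in auto)
      then show False by simp
    qed
  qed
  then obtain z where z: "(\<integral>\<^sup>+h. indicator E (left_coset H (h + z)) \<partial>\<mu>) = 0"
    by (auto simp: space_m coset_space_def coset_action_left_coset)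
  have Bz [measurable]: "(\<lambda>h. h + z) -` B \<in> sets borel" by (rule measurable_sets_borel) measurable
  have "emeasure \<mu> ((\<lambda>h. h + z) -` B) = (\<integral>\<^sup>+h. indicator ((\<lambda>h. h + z) -` B) h \<partial>\<mu>)" by simp
  also have "\<dots> = 0" using z by (simp add: B_def indicator_def)
  finally have "emeasure \<mu> ((\<lambda>h. h + (y + - z)) -` ((\<lambda>h. h + z) -` B)) = 0"
    by (rule null_translate_right[OF Bz])
  moreover have "(\<lambda>h. h + (y + - z)) -` ((\<lambda>h. h + z) -` B) = {h. left_coset H (h + y) \<in> E}"
    by (auto simp: B_def add.assoc)
  ultimately show ?thesis by simp
qed

end

section \<open>Cocompact subgroups have a spectral gap\<close>

lemma cmod_diff_square_le: "(cmod (a - b))\<^sup>2 \<le> 2 * (cmod a)\<^sup>2 + 2 * (cmod b)\<^sup>2"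
proof -
  have "(cmod (a - b))\<^sup>2 \<le> (cmod a + cmod b)\<^sup>2" by (intro power_mono norm_triangle_ineq4) simp
  also have "\<dots> \<le> 2 * (cmod a)\<^sup>2 + 2 * (cmod b)\<^sup>2"
    using zero_le_power2[of "cmod a - cmod b"] by (simp add: power2_diff power2_sum)
  finally show ?thesis .
qed

lemma sqrt_diff_square_le:
  fixes a b :: real
  assumes "0 \<le> a" "0 \<le> b"
  shows "(sqrt a - sqrt b)\<^sup>2 \<le> \<bar>a - b\<bar>"
proof -
  have "(sqrt a - sqrt b)\<^sup>2 = \<bar>sqrt a - sqrt b\<bar> * \<bar>sqrt a - sqrt b\<bar>"
    by (simp add: power2_eq_square)
  also have "\<dots> \<le> \<bar>sqrt a - sqrt b\<bar> * (sqrt a + sqrt b)"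
    using assms by (intro mult_left_mono) (auto simp: abs_le_iff)
  also have "\<dots> = \<bar>(sqrt a - sqrt b) * (sqrt a + sqrt b)\<bar>"
    using assms by (simp add: abs_mult)
  also have "(sqrt a - sqrt b) * (sqrt a + sqrt b) = a - b"
    using assms by (simp add: algebra_simps)
  finally show ?thesis .
qed

context coset_probability
begin

lemma L2_0D:
  assumes "v \<in> L2_0 m"
  shows "v \<in> borel_measurable m" "integrable m (\<lambda>x. (cmod (v x))\<^sup>2)" "(\<integral>x. v x \<partial>m) = 0"
    "integrable m v"
proof -
  show 1: "v \<in> borel_measurable m" "integrable m (\<lambda>x. (cmod (v x))\<^sup>2)" "(\<integral>x. v x \<partial>m) = 0"
    using assms by (auto simp: L2_0_def)
  show "integrable m v"
  proof (rule Bochner_Integration.integrable_bound)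
    show "integrable m (\<lambda>x. 1 + (cmod (v x))\<^sup>2)" using 1 by simp
    have "a \<le> \<bar>1 + a\<^sup>2\<bar>" for a :: real
    proof -
      have "0 \<le> (a - 1)\<^sup>2" by simp
      then have "2 * a \<le> a\<^sup>2 + 1" by (simp add: power2_diff)
      moreover have "0 \<le> a\<^sup>2" by simp
      ultimately show ?thesis by linarith
    qed
    then show "AE x in m. norm (v x) \<le> norm (1 + (cmod (v x))\<^sup>2)"
      by (intro AE_I2) (simp only: real_norm_def)
  qed (rule 1(1))
qed

lemma nn_integral_koopman_diff:
  assumes v: "v \<in> L2_0 m"
  shows "(\<integral>\<^sup>+x. ennreal ((cmod (v x - v (coset_action (- g) x)))\<^sup>2) \<partial>m)
    = (ennreal (L2_norm m (\<lambda>x. koopman coset_action g v x - v x)))\<^sup>2"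
proof -
  note [measurable] = L2_0D(1)[OF v]
  let ?f = "\<lambda>x. (cmod (v x - v (coset_action (- g) x)))\<^sup>2"
  have int: "integrable m ?f"
  proof (rule Bochner_Integration.integrable_bound)
    show "integrable m (\<lambda>x. 2 * (cmod (v x))\<^sup>2 + 2 * (cmod (v (coset_action (- g) x)))\<^sup>2)"
      using L2_0D(2)[OF v] integrable_action[OF L2_0D(2)[OF v], of "- g"] by simp
    show "AE x in m. norm (?f x) \<le> norm (2 * (cmod (v x))\<^sup>2 + 2 * (cmod (v (coset_action (- g) x)))\<^sup>2)"
      using cmod_diff_square_le by (intro AE_I2) simp
  qed measurable
  have "(\<integral>\<^sup>+x. ennreal (?f x) \<partial>m) = ennreal (\<integral>x. ?f x \<partial>m)"
    using int by (intro nn_integral_eq_integral) auto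
  also have "\<dots> = (ennreal (sqrt (\<integral>x. ?f x \<partial>m)))\<^sup>2"
    by (subst ennreal_power) (auto intro!: Bochner_Integration.integral_nonneg)
  also have "sqrt (\<integral>x. ?f x \<partial>m) = L2_norm m (\<lambda>x. koopman coset_action g v x - v x)"
    by (simp add: L2_norm_def koopman_def norm_minus_commute)
  finally show ?thesis .
qed

lemma double_integral_diff:
  assumes v: "v \<in> L2_0 m" and norm: "L2_norm m v = 1"
  shows "(\<integral>\<^sup>+x. (\<integral>\<^sup>+x'. ennreal ((cmod (v x - v x'))\<^sup>2) \<partial>m) \<partial>m) = 2"
proof -
  note [measurable] = L2_0D(1)[OF v]
  have sq: "(\<integral>x. (cmod (v x))\<^sup>2 \<partial>m) = 1" using norm by (simp add: L2_norm_def)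
  have inner: "(\<integral>\<^sup>+x'. ennreal ((cmod (z - v x'))\<^sup>2) \<partial>m) = ennreal ((cmod z)\<^sup>2 + 1)" for z
  proof -
    have eq: "(cmod (z - v x'))\<^sup>2 = (cmod z)\<^sup>2 + (cmod (v x'))\<^sup>2 - 2 * Re (cnj z * v x')" for x'
      unfolding cmod_power2 by (simp add: power2_eq_square algebra_simps)
    define r where "r x' = Re (cnj z * v x')" for x'
    have i: "integrable m r"
      unfolding r_def[abs_def]
      using L2_0D(4)[OF v] by (intro integrable_Re) simp
    have "(\<integral>x'. r x' \<partial>m) = Re (\<integral>x'. cnj z * v x' \<partial>m)"
      unfolding r_def using L2_0D(4)[OF v] by (intro integral_Re) simp
    then have 0: "(\<integral>x'. r x' \<partial>m) = 0" using L2_0D(3)[OF v] by simp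
    have int: "integrable m (\<lambda>x'. (cmod (z - v x'))\<^sup>2)"
      unfolding eq r_def[symmetric] using L2_0D(2)[OF v] i by simp
    have "(\<integral>\<^sup>+x'. ennreal ((cmod (z - v x'))\<^sup>2) \<partial>m) = ennreal (\<integral>x'. (cmod (z - v x'))\<^sup>2 \<partial>m)"
      using int by (intro nn_integral_eq_integral) simp_all
    also have "(\<integral>x'. (cmod (z - v x'))\<^sup>2 \<partial>m) = (cmod z)\<^sup>2 + 1"
      unfolding eq r_def[symmetric] using L2_0D(2)[OF v] i 0 sq by (simp add: m.prob_space)
    finally show ?thesis .
  qed
  have "(\<integral>\<^sup>+x. ennreal ((cmod (v x))\<^sup>2 + 1) \<partial>m) = ennreal (\<integral>x. (cmod (v x))\<^sup>2 + 1 \<partial>m)"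
    using L2_0D(2)[OF v] by (intro nn_integral_eq_integral) auto
  also have "\<dots> = 2" using L2_0D(2)[OF v] sq by (simp add: m.prob_space)
  finally show ?thesis by (simp add: inner)
qed

text \<open>
  This is the right invariance of the image of Haar measure under inversion: replacing the base point
  \<open>k x\<close> by \<open>x\<close> amounts to the substitution \<open>g \<mapsto> k + g\<close>.
\<close>

lemma orbit_average_le:
  assumes f: "f \<in> borel_measurable m" and S: "S \<in> sets borel" and S': "S' \<in> sets borel"
    and k: "\<And>g. k + g \<in> S \<Longrightarrow> g \<in> S'" and x: "x \<in> space m"
  shows "(\<integral>\<^sup>+g. indicator S g * f (coset_action (- g) (coset_action k x)) \<partial>\<mu>)
    \<le> (\<integral>\<^sup>+g. indicator S' g * f (coset_action (- g) x) \<partial>\<mu>)"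
proof -
  note [measurable] = f S S'
  have kx: "coset_action k x \<in> space m"
    using x by (auto simp: space_m coset_space_def coset_action_left_coset)
  have act [measurable]: "(\<lambda>g. coset_action (- g) y) \<in> borel \<rightarrow>\<^sub>M m" if "y \<in> space m" for y
    using that by measurable
  have "(\<lambda>g. indicator S g * f (coset_action (- g) (coset_action k x))) \<in> borel_measurable borel"
    using act[OF kx] by measurable
  then have "(\<integral>\<^sup>+g. indicator S g * f (coset_action (- g) (coset_action k x)) \<partial>\<mu>)
      = (\<integral>\<^sup>+g. indicator S (k + g) * f (coset_action (- (k + g)) (coset_action k x)) \<partial>\<mu>)"
    by (rule nn_integral_translate[symmetric])
  also have "\<dots> = (\<integral>\<^sup>+g. indicator S (k + g) * f (coset_action (- g) x) \<partial>\<mu>)"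
    by (simp add: minus_add coset_action_add[symmetric])
  also have "\<dots> \<le> (\<integral>\<^sup>+g. indicator S' g * f (coset_action (- g) x) \<partial>\<mu>)"
    using k by (intro nn_integral_mono) (auto simp: indicator_def)
  finally show ?thesis .
qed

text \<open>
  Averaging \<open>\<bar>v(x) - v((- g) x')\<bar>\<^sup>2\<close> over \<open>g \<in> S\<close> and over all \<open>x'\<close> gives \<open>\<mu>(S)\<close> times the average of \<open>\<bar>v(x) - v(x')\<bar>\<^sup>2\<close>. For each \<open>x'\<close>
  the average over \<open>S\<close> is at most the one over \<open>S'\<close> with \<open>x\<close> itself in place of \<open>x'\<close>. Integrating over
  \<open>x\<close> leaves the displacement of \<open>v\<close> by \<open>g\<close>.
\<close>

theorem poincare_inequality:
  assumes v: "v \<in> L2_0 m" "L2_norm m v = 1"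
    and S: "S \<in> sets borel" and S': "S' \<in> sets borel"
    and trans: "\<And>x x'. x \<in> space m \<Longrightarrow> x' \<in> space m \<Longrightarrow>
      \<exists>k. x' = coset_action k x \<and> (\<forall>g. k + g \<in> S \<longrightarrow> g \<in> S')"
  shows "2 * emeasure \<mu> S
    \<le> (\<integral>\<^sup>+g. indicator S' g * (ennreal (L2_norm m (\<lambda>x. koopman coset_action g v x - v x)))\<^sup>2 \<partial>\<mu>)"
proof -
  note [measurable] = L2_0D(1)[OF v(1)] S S'
  let ?f = "\<lambda>x x'. ennreal ((cmod (v x - v x'))\<^sup>2)"
  have pt: "emeasure \<mu> S * (\<integral>\<^sup>+x'. ?f x x' \<partial>m)
      \<le> (\<integral>\<^sup>+g. indicator S' g * ?f x (coset_action (- g) x) \<partial>\<mu>)" (is "_ \<le> ?R") if x: "x \<in> space m" for x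
  proof -
    have "emeasure \<mu> S * (\<integral>\<^sup>+x'. ?f x x' \<partial>m) = (\<integral>\<^sup>+g. indicator S g * (\<integral>\<^sup>+x'. ?f x x' \<partial>m) \<partial>\<mu>)"
      by (simp add: nn_integral_multc sets_haar)
    also have "\<dots> = (\<integral>\<^sup>+g. indicator S g * (\<integral>\<^sup>+x'. ?f x (coset_action (- g) x') \<partial>m) \<partial>\<mu>)"
      by (intro nn_integral_cong arg_cong2[where f = "(*)"] refl nn_integral_action[symmetric]) measurable
    also have "\<dots> = (\<integral>\<^sup>+g. (\<integral>\<^sup>+x'. indicator S g * ?f x (coset_action (- g) x') \<partial>m) \<partial>\<mu>)"
      by (intro nn_integral_cong nn_integral_cmult[symmetric]) measurable
    also have "\<dots> = (\<integral>\<^sup>+x'. (\<integral>\<^sup>+g. indicator S g * ?f x (coset_action (- g) x') \<partial>\<mu>) \<partial>m)"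
      by (rule GX.Fubini'[symmetric]) measurable
    also have "\<dots> \<le> (\<integral>\<^sup>+x'. ?R \<partial>m)"
    proof (rule nn_integral_mono)
      fix x' assume "x' \<in> space m"
      then obtain k where k: "x' = coset_action k x" "\<And>g. k + g \<in> S \<Longrightarrow> g \<in> S'"
        using trans[OF x] by blast
      show "(\<integral>\<^sup>+g. indicator S g * ?f x (coset_action (- g) x') \<partial>\<mu>) \<le> ?R"
        unfolding k(1) using k(2) by (intro orbit_average_le[where f = "?f x"] S S' x) measurable
    qed
    also have "\<dots> = ?R" by (simp add: m.emeasure_space_1)
    finally show ?thesis .
  qed
  have "2 * emeasure \<mu> S = emeasure \<mu> S * (\<integral>\<^sup>+x. (\<integral>\<^sup>+x'. ?f x x' \<partial>m) \<partial>m)"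
    by (simp add: double_integral_diff[OF v] mult.commute)
  also have "\<dots> = (\<integral>\<^sup>+x. emeasure \<mu> S * (\<integral>\<^sup>+x'. ?f x x' \<partial>m) \<partial>m)"
    by (rule nn_integral_cmult[symmetric]) measurable
  also have "\<dots> \<le> (\<integral>\<^sup>+x. (\<integral>\<^sup>+g. indicator S' g * ?f x (coset_action (- g) x) \<partial>\<mu>) \<partial>m)"
    using pt by (rule nn_integral_mono)
  also have "\<dots> = (\<integral>\<^sup>+g. (\<integral>\<^sup>+x. indicator S' g * ?f x (coset_action (- g) x) \<partial>m) \<partial>\<mu>)"
    by (rule GX.Fubini') measurable
  also have "\<dots> = (\<integral>\<^sup>+g. indicator S' g * (\<integral>\<^sup>+x. ?f x (coset_action (- g) x) \<partial>m) \<partial>\<mu>)"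
    by (intro nn_integral_cong nn_integral_cmult) measurable
  finally show ?thesis by (simp add: nn_integral_koopman_diff[OF v(1)])
qed

theorem cocompact_imp_spectral_gap:
  assumes "cocompact H"
  shows "spectral_gap coset_action m"
  unfolding spectral_gap_def
proof
  assume "has_almost_invariant_vectors coset_action m"
  then obtain v :: "nat \<Rightarrow> 'g set \<Rightarrow> complex" where v: "\<And>n. v n \<in> L2_0 m" "\<And>n. L2_norm m (v n) = 1"
    and lim: "\<And>K. compact K \<Longrightarrow>
      (\<lambda>n. SUP g\<in>K. ennreal (L2_norm m (\<lambda>x. koopman coset_action g (v n) x - v n x))) \<longlonglongrightarrow> 0"
    unfolding has_almost_invariant_vectors_def by blast
  obtain C where C: "compact C" "left_coset H ` C = coset_space H"
    using assms cocompact_iff[OF subgroup locally_compact] by blast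
  obtain U S where US: "open U" "compact S" "(0::'g) \<in> U" "U \<subseteq> S"
    by (rule compact_neighbourhood[OF locally_compact])
  define D where "D = {a + b |a b. a \<in> C \<and> b \<in> uminus ` C}"
  define S' where "S' = {a + b |a b. a \<in> D \<and> b \<in> S}"
  have S': "compact S'" unfolding S'_def D_def by (intro compact_plus compact_uminus C US)
  have trans: "\<exists>k. x' = coset_action k x \<and> (\<forall>g. k + g \<in> S \<longrightarrow> g \<in> S')"
    if "x \<in> space m" "x' \<in> space m" for x x'
  proof -
    have "x \<in> left_coset H ` C" using that(1) C(2) by (simp add: space_m)
    then obtain a where a: "a \<in> C" "x = left_coset H a" by (elim imageE)
    have "x' \<in> left_coset H ` C" using that(2) C(2) by (simp add: space_m)
    then obtain b where b: "b \<in> C" "x' = left_coset H b" by (elim imageE)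
    have "g \<in> S'" if "b + - a + g \<in> S" for g
    proof -
      have "g = (a + - b) + (b + - a + g)"
        by (simp only: add.assoc minus_add_cancel add_minus_cancel)
      moreover have "a + - b \<in> D" unfolding D_def using a b by blast
      ultimately show ?thesis unfolding S'_def using that by blast
    qed
    moreover have "x' = coset_action (b + - a) x"
      by (simp add: a b coset_action_left_coset add.assoc)
    ultimately show ?thesis by blast
  qed
  have "0 < emeasure \<mu> U" using US by (intro open_pos)
  also have "\<dots> \<le> emeasure \<mu> S"
    using US by (intro emeasure_mono) (auto simp: sets_haar compact_sets)
  finally have s: "0 < measure \<mu> S"
    using finite_on_compact[OF US(2)] by (simp add: measure_def enn2real_positive_iff)
  have emS: "emeasure \<mu> S = ennreal (measure \<mu> S)" "emeasure \<mu> S' = ennreal (measure \<mu> S')"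
    using finite_on_compact[OF US(2)] finite_on_compact[OF S'] by (simp_all add: emeasure_eq_ennreal_measure)
  \<comment> \<open>Small enough for \<open>\<mu>(S') e\<^sup>2\<close> not to exceed \<open>\<mu>(S)\<close>, against the lower bound \<open>2 \<mu>(S)\<close>.\<close>
  define e where "e = min 1 (measure \<mu> S / (measure \<mu> S' + 1))"
  have b: "0 < measure \<mu> S' + 1" by (intro add_nonneg_pos) auto
  have e: "0 < e" "e \<le> 1" using s b by (auto simp: e_def)
  have "eventually (\<lambda>n. (SUP g\<in>S'. ennreal (L2_norm m (\<lambda>x. koopman coset_action g (v n) x - v n x))) < ennreal e) sequentially"
    using e by (intro order_tendstoD(2)[OF lim[OF S']]) simp
  then obtain n where n: "(SUP g\<in>S'. ennreal (L2_norm m (\<lambda>x. koopman coset_action g (v n) x - v n x))) < ennreal e"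
    using eventually_happens'[OF sequentially_bot] by blast
  have "2 * emeasure \<mu> S \<le> (\<integral>\<^sup>+g. indicator S' g *
      (ennreal (L2_norm m (\<lambda>x. koopman coset_action g (v n) x - v n x)))\<^sup>2 \<partial>\<mu>)"
    using US S' by (intro poincare_inequality v trans) (auto intro: compact_sets)
  also have "\<dots> \<le> (\<integral>\<^sup>+g. indicator S' g * (ennreal e)\<^sup>2 \<partial>\<mu>)"
  proof (intro nn_integral_mono)
    fix g
    show "indicator S' g * (ennreal (L2_norm m (\<lambda>x. koopman coset_action g (v n) x - v n x)))\<^sup>2
        \<le> indicator S' g * (ennreal e)\<^sup>2"
    proof (cases "g \<in> S'")
      case True
      then have "ennreal (L2_norm m (\<lambda>x. koopman coset_action g (v n) x - v n x)) \<le> ennreal e"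
        using n by (meson SUP_upper le_less_trans less_imp_le)
      then show ?thesis by (intro mult_left_mono power_mono) auto
    qed simp
  qed
  also have "\<dots> = emeasure \<mu> S' * (ennreal e)\<^sup>2"
    using compact_sets[OF S'] by (subst nn_integral_multc) (simp_all add: sets_haar)
  finally have "ennreal (2 * measure \<mu> S) \<le> ennreal (measure \<mu> S' * e\<^sup>2)"
    using e s by (simp add: emS ennreal_mult' ennreal_power)
  then have "2 * measure \<mu> S \<le> measure \<mu> S' * e\<^sup>2"
    using e by (subst (asm) ennreal_le_iff) auto
  also have "\<dots> \<le> measure \<mu> S' * e"
    using e by (intro mult_left_mono) (auto simp: power2_eq_square mult_left_le)
  also have "\<dots> \<le> (measure \<mu> S' + 1) * (measure \<mu> S / (measure \<mu> S' + 1))"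
    using s b e by (intro mult_mono) (auto simp: e_def)
  also have "\<dots> = measure \<mu> S" using b by simp
  finally show False using s by simp
qed

end

section \<open>Almost invariant vectors far out in the coset space\<close>

context coset_probability
begin

text \<open>
  The function \<open>\<phi>\<close> is the Radon-Nikodym density of the image of \<open>V d\<mu>\<close> under the orbit map \<open>h \<mapsto> p(h + y)\<close>, which is
  absolutely continuous by \<open>null_preimage\<close>.
\<close>

lemma push_forward_density:
  assumes V: "integrable \<mu> V" and V0: "\<And>x. 0 \<le> V x"
  obtains \<phi> :: "'g set \<Rightarrow> real" where "integrable m \<phi>" "\<And>x. 0 \<le> \<phi> x"
    "\<And>f. f \<in> borel_measurable m \<Longrightarrow> (\<integral>x. \<phi> x * f x \<partial>m) = (\<integral>h. V h * f (left_coset H (h + y)) \<partial>\<mu>)"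
proof -
  have [measurable]: "V \<in> borel_measurable borel" using V by (rule integrable_measurable)
  define N where "N = density \<mu> (\<lambda>h. ennreal (V h))"
  have [measurable_cong]: "sets N = sets borel" by (simp add: N_def sets_haar)
  define \<nu> where "\<nu> = distr N m (\<lambda>h. left_coset H (h + y))"
  have finN: "finite_measure N"
  proof (rule finite_measureI)
    have "emeasure N (space N) = (\<integral>\<^sup>+h. ennreal (V h) \<partial>\<mu>)"
      by (simp add: N_def emeasure_density)
    also have "\<dots> = ennreal (\<integral>h. V h \<partial>\<mu>)" using V V0 by (intro nn_integral_eq_integral) auto
    finally show "emeasure N (space N) \<noteq> \<infinity>" by simp
  qed
  have fin: "finite_measure \<nu>"
    unfolding \<nu>_def by (intro finite_measure.finite_measure_distr finN) measurable
  have sets_nu: "sets \<nu> = sets m" by (simp add: \<nu>_def)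
  have ac: "absolutely_continuous m \<nu>"
    unfolding absolutely_continuous_def
  proof
    fix E assume E: "E \<in> null_sets m"
    have "emeasure \<mu> {h. left_coset H (h + y) \<in> E} = 0" using E by (intro null_preimage) auto
    moreover have "(\<lambda>h. left_coset H (h + y)) -` E \<inter> space borel \<in> sets borel"
      using E by (intro measurable_sets[where A = m]) auto
    then have Eb: "{h. left_coset H (h + y) \<in> E} \<in> sets borel" by (simp add: vimage_def)
    ultimately have "{h. left_coset H (h + y) \<in> E} \<in> null_sets \<mu>" by (auto simp: sets_haar)
    then have "emeasure N {h. left_coset H (h + y) \<in> E} = 0"
      using Eb unfolding N_def
      by (subst emeasure_density) (simp_all add: nn_integral_null_set sets_haar)
    then have "emeasure \<nu> E = 0"
      using E unfolding \<nu>_def by (subst emeasure_distr) (auto simp: vimage_def N_def)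
    then show "E \<in> null_sets \<nu>" using E by (intro null_setsI) (auto simp: sets_nu)
  qed
  obtain \<phi> where \<phi>: "\<phi> \<in> borel_measurable m" "AE x in m. RN_deriv m \<nu> x = ennreal (\<phi> x)" "\<And>x. 0 \<le> \<phi> x"
    by (rule m.real_RN_deriv[OF fin ac sets_nu]) (rule that; assumption)
  note [measurable] = \<phi>(1)
  have "\<nu> = density m (RN_deriv m \<nu>)" using m.density_RN_deriv[OF ac sets_nu] by simp
  also have "\<dots> = density m (\<lambda>x. ennreal (\<phi> x))" using \<phi>(2) by (intro density_cong) auto
  finally have dens: "\<nu> = density m (\<lambda>x. ennreal (\<phi> x))" .
  show ?thesis
  proof (rule that)
    have "(\<integral>\<^sup>+x. ennreal (\<phi> x) \<partial>m) = emeasure \<nu> (space \<nu>)" by (simp add: dens emeasure_density)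
    also have "\<dots> < \<infinity>" using finite_measure.emeasure_finite[OF fin] by (simp add: less_top)
    finally show "integrable m \<phi>" using \<phi>(3) by (intro integrableI_nonneg) auto
    show "0 \<le> \<phi> x" for x by (rule \<phi>(3))
    fix f :: "'g set \<Rightarrow> real" assume [measurable]: "f \<in> borel_measurable m"
    have "(\<integral>x. \<phi> x * f x \<partial>m) = (\<integral>x. f x \<partial>\<nu>)"
      unfolding dens using \<phi>(3) by (subst integral_density) auto
    also have "\<dots> = (\<integral>h. f (left_coset H (h + y)) \<partial>N)"
      unfolding \<nu>_def by (rule integral_distr) measurable
    also have "\<dots> = (\<integral>h. V h * f (left_coset H (h + y)) \<partial>\<mu>)"
      unfolding N_def using V0 by (subst integral_density) auto
    finally show "(\<integral>x. \<phi> x * f x \<partial>m) = (\<integral>h. V h * f (left_coset H (h + y)) \<partial>\<mu>)" .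
  qed
qed

text \<open>
  The orbit map commutes with translations, and an image measure has at most the total variation of the original.
  The variation is tested with the sign of the difference of densities.
\<close>

lemma push_forward_contraction:
  fixes \<phi> :: "'g set \<Rightarrow> real"
  assumes V: "integrable \<mu> V" and \<phi>: "integrable m \<phi>"
    and push: "\<And>f. f \<in> borel_measurable m \<Longrightarrow>
      (\<integral>x. \<phi> x * f x \<partial>m) = (\<integral>h. V h * f (left_coset H (h + y)) \<partial>\<mu>)"
  shows "(\<integral>x. \<bar>\<phi> (coset_action (- g) x) - \<phi> x\<bar> \<partial>m) \<le> (\<integral>h. \<bar>V (- g + h) - V h\<bar> \<partial>\<mu>)"
proof -
  have [measurable]: "V \<in> borel_measurable borel" "\<phi> \<in> borel_measurable m"
    using V \<phi> by (auto intro: integrable_measurable)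
  define f where "f x = sgn (\<phi> (coset_action (- g) x) - \<phi> x)" for x
  have mf [measurable]: "f \<in> borel_measurable m" unfolding f_def[abs_def] by simp
  have fb: "\<bar>f x\<bar> \<le> 1" for x by (simp add: f_def sgn_if)
  have \<phi>g: "integrable m (\<lambda>x. \<phi> (coset_action (- g) x))" using \<phi> by (rule integrable_action)
  have Vg: "integrable \<mu> (\<lambda>h. V (- g + h))" using V by (rule integrable_translate)
  have mfy: "(\<lambda>h. f (left_coset H (h + y))) \<in> borel_measurable borel" by measurable
  have "(\<integral>x. \<bar>\<phi> (coset_action (- g) x) - \<phi> x\<bar> \<partial>m)
      = (\<integral>x. \<phi> (coset_action (- g) x) * f x - \<phi> x * f x \<partial>m)"
    by (intro Bochner_Integration.integral_cong refl) (auto simp: f_def sgn_if)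
  also have "\<dots> = (\<integral>x. \<phi> (coset_action (- g) x) * f x \<partial>m) - (\<integral>x. \<phi> x * f x \<partial>m)"
    using integrable_times_bounded[OF \<phi>g mf fb] integrable_times_bounded[OF \<phi> mf fb]
    by (intro Bochner_Integration.integral_diff)
  also have "(\<integral>x. \<phi> (coset_action (- g) x) * f x \<partial>m) = (\<integral>x. \<phi> x * f (coset_action g x) \<partial>m)"
    using integral_action[of "\<lambda>x. \<phi> (coset_action (- g) x) * f x" g] by simp
  also have "\<dots> = (\<integral>h. V h * f (left_coset H (g + h + y)) \<partial>\<mu>)"
    by (subst push) (simp_all add: coset_action_left_coset add.assoc)
  also have "\<dots> = (\<integral>h. V (- g + h) * f (left_coset H (h + y)) \<partial>\<mu>)"
    using integral_translate[of "\<lambda>h. V (- g + h) * f (left_coset H (h + y))" g] by simp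
  also have "(\<integral>x. \<phi> x * f x \<partial>m) = (\<integral>h. V h * f (left_coset H (h + y)) \<partial>\<mu>)"
    using mf by (rule push)
  also have "(\<integral>h. V (- g + h) * f (left_coset H (h + y)) \<partial>\<mu>) - (\<integral>h. V h * f (left_coset H (h + y)) \<partial>\<mu>)
      = (\<integral>h. V (- g + h) * f (left_coset H (h + y)) - V h * f (left_coset H (h + y)) \<partial>\<mu>)"
    using integrable_mult_bounded[OF Vg mfy fb] integrable_mult_bounded[OF V mfy fb] by simp
  also have "\<dots> = (\<integral>h. (V (- g + h) - V h) * f (left_coset H (h + y)) \<partial>\<mu>)"
    by (simp add: left_diff_distrib)
  also have "\<dots> \<le> 1 * (\<integral>h. \<bar>V (- g + h) - V h\<bar> \<partial>\<mu>)"
    using integral_mult_bounded[OF _ mfy fb, of "\<lambda>h. V (- g + h) - V h"] V Vg by simp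
  finally show ?thesis by simp
qed

text \<open>
  Otherwise every \<open>y\<close> is congruent modulo \<open>H\<close> to an element of the compact set \<open>- C + D\<close>.
\<close>

lemma escaping_base_point:
  assumes not_cocompact: "\<not> cocompact H" and C: "compact C" "compact D"
  shows "\<exists>y. \<forall>c\<in>C. left_coset H (c + y) \<notin> left_coset H ` D"
proof (rule ccontr)
  assume contra: "\<not> ?thesis"
  define E where "E = {a + b |a b. a \<in> uminus ` C \<and> b \<in> D}"
  have "compact E" unfolding E_def by (intro compact_plus compact_uminus C)
  moreover have "left_coset H ` E = coset_space H"
  proof
    show "left_coset H ` E \<subseteq> coset_space H" by (auto simp: coset_space_def)
    show "coset_space H \<subseteq> left_coset H ` E"
    proof
      fix X assume "X \<in> coset_space H"
      then obtain y where y: "X = left_coset H y" by (auto simp: coset_space_def)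
      obtain c d where cd: "c \<in> C" "d \<in> D" "left_coset H (c + y) = left_coset H d"
        using contra by blast
      have "coset_action (- c) (left_coset H (c + y)) = coset_action (- c) (left_coset H d)"
        using cd(3) by simp
      then have "X = left_coset H (- c + d)" by (simp add: coset_action_left_coset y)
      moreover have "- c + d \<in> E" unfolding E_def using cd by blast
      ultimately show "X \<in> left_coset H ` E" by blast
    qed
  qed
  ultimately show False
    using not_cocompact cocompact_iff[OF subgroup locally_compact] by blast
qed

text \<open>
  Choose compact sets such that \<open>C i\<close> carries \<open>V\<close> up to mass \<open>t\<^sup>2\<close> and the image \<open>P j\<close> of the interior of \<open>C j\<close> carries \<open>m\<close> up
  to \<open>t\<^sup>2\<close>, and a base point \<open>y\<close> from which \<open>C i\<close> does not reach \<open>P j\<close>. The density \<open>\<phi>\<close> then has mass at most \<open>t\<^sup>2\<close> on \<open>P j\<close>, so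
  the unit vector \<open>u = sqrt \<phi>\<close> has mean \<open>a \<le> 2 t\<close>. The vector sought is \<open>u - a\<close> divided by its norm.
\<close>

lemma almost_invariant_vector:
  assumes not_cocompact: "\<not> cocompact H" and t: "0 < t" "t \<le> 1/4"
    and V: "integrable \<mu> V" "\<And>x. 0 \<le> V x" "(\<integral>x. V x \<partial>\<mu>) = 1"
    and inv: "\<And>g. g \<in> K \<Longrightarrow> (\<integral>x. \<bar>V (- g + x) - V x\<bar> \<partial>\<mu>) \<le> t\<^sup>2"
  shows "\<exists>v\<in>L2_0 m. L2_norm m v = 1 \<and>
    (\<forall>g\<in>K. L2_norm m (\<lambda>x. koopman coset_action g v x - v x) \<le> 2 * t)"
proof -
  have mV [measurable]: "V \<in> borel_measurable borel" using V(1) by (rule integrable_measurable)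
  have t2: "0 < t\<^sup>2" using t by simp
  obtain C :: "nat \<Rightarrow> 'g set" where C: "\<And>n. compact (C n)" "incseq C"
    "\<And>D. compact D \<Longrightarrow> \<exists>n. D \<subseteq> C n"
    using compact_exhaustion[OF locally_compact] by blast
  have in_C: "\<exists>n. x \<in> interior (C n)" for x
  proof -
    obtain U D where UD: "open U" "compact D" "x \<in> U" "U \<subseteq> D"
      by (rule compact_neighbourhood[OF locally_compact, of x])
    obtain n where "D \<subseteq> C n" using C(3)[OF UD(2)] by blast
    then have "U \<subseteq> C n" using UD(4) by simp
    then have "x \<in> interior (C n)" using UD(1,3) by (auto intro: interiorI)
    then show ?thesis ..
  qed
  have mC [measurable]: "C n \<in> sets borel" for n using C(1) by (rule compact_sets)
  have VC: "(\<lambda>n. \<integral>x. V x * indicator (C n) x \<partial>\<mu>) \<longlonglongrightarrow> (\<integral>x. V x \<partial>\<mu>)"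
  proof (rule integral_dominated_convergence[where w = V])
    show "AE x in \<mu>. (\<lambda>n. V x * indicator (C n) x) \<longlonglongrightarrow> V x"
    proof (rule AE_I2)
      fix x
      obtain n where n: "x \<in> C n" using in_C[of x] interior_subset by blast
      have "x \<in> C k" if "k \<ge> n" for k
        using n incseqD[OF C(2) that] by blast
      then have "V x * indicator (C k) x = V x" if "k \<ge> n" for k
        using that by simp
      then show "(\<lambda>n. V x * indicator (C n) x) \<longlonglongrightarrow> V x"
        by (intro tendsto_eventually) (auto simp: eventually_sequentially)
    qed
    show "AE x in \<mu>. norm (V x * indicator (C n) x) \<le> V x" for n
      using V(2) by (auto simp: indicator_def)
  qed (use V(1) in auto)
  have "eventually (\<lambda>n. 1 - t\<^sup>2 < (\<integral>x. V x * indicator (C n) x \<partial>\<mu>)) sequentially"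
    using t2 V(3) by (intro order_tendstoD(1)[OF VC]) simp
  then obtain i where i: "1 - t\<^sup>2 < (\<integral>x. V x * indicator (C i) x \<partial>\<mu>)"
    using eventually_happens'[OF sequentially_bot] by blast
  define P where "P n = left_coset H ` interior (C n)" for n
  have mP [measurable]: "P n \<in> sets m" for n
    unfolding P_def by (intro sets_openin openin_image_left_coset subgroup) simp
  have "(\<Union>n. P n) = space m"
    using in_C by (fastforce simp: P_def space_m coset_space_def)
  moreover have "incseq P"
    using C(2) by (auto simp: P_def incseq_def intro!: image_mono interior_mono)
  ultimately have "(\<lambda>n. measure m (P n)) \<longlonglongrightarrow> 1"
    using m.finite_Lim_measure_incseq[of P] mP by (auto simp: m.prob_space image_subset_iff)
  then have "eventually (\<lambda>n. 1 - t\<^sup>2 < measure m (P n)) sequentially"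
    using t2 by (intro order_tendstoD(1)[where y = 1]) auto
  then obtain j where j: "1 - t\<^sup>2 < measure m (P j)"
    using eventually_happens'[OF sequentially_bot] by blast
  obtain y where y: "\<And>c. c \<in> C i \<Longrightarrow> left_coset H (c + y) \<notin> left_coset H ` C j"
    using escaping_base_point[OF not_cocompact C(1) C(1)] by blast
  obtain \<phi> :: "'g set \<Rightarrow> real" where \<phi>: "integrable m \<phi>" "\<And>x. 0 \<le> \<phi> x"
    and push: "\<And>f. f \<in> borel_measurable m \<Longrightarrow>
      (\<integral>x. \<phi> x * f x \<partial>m) = (\<integral>h. V h * f (left_coset H (h + y)) \<partial>\<mu>)"
    by (rule push_forward_density[OF V(1,2)]) (rule that; assumption)
  have m\<phi> [measurable]: "\<phi> \<in> borel_measurable m" using \<phi>(1) by simp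
  have \<phi>1: "(\<integral>x. \<phi> x \<partial>m) = 1" using push[of "\<lambda>_. 1"] V(3) by simp
  have \<phi>P: "(\<integral>x. \<phi> x * indicator (P j) x \<partial>m) \<le> t\<^sup>2"
  proof -
    have iVC: "integrable \<mu> (\<lambda>h. V h * indicator (C i) h)"
      using V(1) by (intro integrable_mult_bounded[of _ _ 1]) auto
    have "(\<integral>x. \<phi> x * indicator (P j) x \<partial>m) = (\<integral>h. V h * indicator (P j) (left_coset H (h + y)) \<partial>\<mu>)"
      by (rule push) simp
    also have "\<dots> \<le> (\<integral>h. V h - V h * indicator (C i) h \<partial>\<mu>)"
    proof (intro integral_mono)
      show "integrable \<mu> (\<lambda>h. V h * indicator (P j) (left_coset H (h + y)))"
        using V(1) by (intro integrable_mult_bounded[of _ _ 1]) (auto simp: indicator_def)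
      show "integrable \<mu> (\<lambda>h. V h - V h * indicator (C i) h)" using V(1) iVC by simp
      fix h
      have "left_coset H (h + y) \<notin> P j" if "h \<in> C i"
        using y[OF that] interior_subset[of "C j"] by (auto simp: P_def)
      then show "V h * indicator (P j) (left_coset H (h + y)) \<le> V h - V h * indicator (C i) h"
        using V(2) by (auto simp: indicator_def)
    qed
    also have "\<dots> = 1 - (\<integral>h. V h * indicator (C i) h \<partial>\<mu>)" using V(1,3) iVC by simp
    finally show ?thesis using i by simp
  qed
  define u where "u x = sqrt (\<phi> x)" for x
  have mu [measurable]: "u \<in> borel_measurable m" unfolding u_def[abs_def] by measurable
  have u0: "0 \<le> u x" and u2: "(u x)\<^sup>2 = \<phi> x" for x using \<phi>(2) by (auto simp: u_def)
  \<comment> \<open>A pointwise bound replaces the Cauchy-Schwarz inequality on \<open>P j\<close> and on its complement: \<open>u\<close> is at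
    most \<open>(\<phi> / t + t) / 2\<close> and at most \<open>(t \<phi> + 1 / t) / 2\<close>; the first is used where \<open>\<phi>\<close> has little mass and the
    second on a set of small measure.\<close>
  define B where "B x = (\<phi> x * indicator (P j) x / t + t + t * \<phi> x + (1 - indicator (P j) x) / t) / 2"
    for x :: "'g set"
  have i\<phi>P: "integrable m (\<lambda>x. \<phi> x * indicator (P j) x)"
    using \<phi>(1) by (intro integrable_times_bounded[of _ _ _ 1]) auto
  have iP: "integrable m (indicator (P j) :: 'g set \<Rightarrow> real)"
    by (intro integrable_real_indicator) (auto simp: m.emeasure_finite less_top[symmetric])
  have iB: "integrable m B" unfolding B_def[abs_def] using i\<phi>P iP \<phi>(1) by simp
  have uB: "u x \<le> B x" for x
  proof -
    have amgm: "a \<le> (a\<^sup>2 / s + s) / 2" if "s > 0" for a s :: real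
    proof -
      have "0 \<le> (a - s)\<^sup>2 / s" using that by simp
      also have "(a - s)\<^sup>2 / s = a\<^sup>2 / s + s - 2 * a"
        using that by (simp add: power2_diff field_simps power2_eq_square)
      finally show ?thesis by simp
    qed
    show ?thesis
    proof (cases "x \<in> P j")
      case True
      have "u x \<le> (\<phi> x / t + t) / 2" using amgm[OF t(1), of "u x"] by (simp add: u2)
      also have "\<dots> \<le> B x" using True \<phi>(2)[of x] t by (simp add: B_def)
      finally show ?thesis .
    next
      case False
      have "u x \<le> (\<phi> x / (1 / t) + 1 / t) / 2" using amgm[of "1 / t" "u x"] t by (simp add: u2)
      also have "\<dots> \<le> B x" using False t by (simp add: B_def mult.commute)
      finally show ?thesis .
    qed
  qed
  have iu: "integrable m u"
    using u0 order_trans[OF uB abs_ge_self]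
    by (intro Bochner_Integration.integrable_bound[OF iB mu] AE_I2) simp
  define a where "a = (\<integral>x. u x \<partial>m)"
  have a0: "0 \<le> a" unfolding a_def using u0 by (intro Bochner_Integration.integral_nonneg) auto
  have "a \<le> (\<integral>x. B x \<partial>m)" unfolding a_def using iu iB uB by (intro integral_mono)
  also have "\<dots> = ((\<integral>x. \<phi> x * indicator (P j) x \<partial>m) / t + t + t + (1 - measure m (P j)) / t) / 2"
    unfolding B_def using i\<phi>P iP \<phi>(1) \<phi>1 by (simp add: m.prob_space)
  also have "\<dots> \<le> (t\<^sup>2 / t + t + t + t\<^sup>2 / t) / 2"
    using \<phi>P j t by (intro divide_right_mono add_mono) auto
  also have "\<dots> = 2 * t" using t by (simp add: power2_eq_square)
  finally have a2: "a \<le> 1 / 2" using t by simp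
  then have aa: "a\<^sup>2 \<le> 1 / 4"
    using power_mono[OF a2 a0, of 2] by (simp add: power2_eq_square)
  define s where "s = sqrt (1 - a\<^sup>2)"
  have s2: "s\<^sup>2 = 1 - a\<^sup>2" using aa by (simp add: s_def)
  have s: "s > 0" using aa by (simp add: s_def)
  define v where "v x = complex_of_real ((u x - a) / s)" for x
  have mv [measurable]: "v \<in> borel_measurable m" unfolding v_def[abs_def] by measurable
  have v2: "(cmod (v x))\<^sup>2 = (\<phi> x - 2 * a * u x + a\<^sup>2) / s\<^sup>2" for x
    by (simp add: v_def power_divide power2_diff u2 del: of_real_divide of_real_diff)
  have iv2: "integrable m (\<lambda>x. (cmod (v x))\<^sup>2)" unfolding v2 using \<phi>(1) iu by simp
  have "(\<integral>x. v x \<partial>m) = complex_of_real (\<integral>x. (u x - a) / s \<partial>m)"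
    unfolding v_def by (rule integral_complex_of_real)
  also have "(\<integral>x. (u x - a) / s \<partial>m) = 0" using iu by (simp add: a_def m.prob_space)
  finally have vL: "v \<in> L2_0 m" using iv2 by (simp add: L2_0_def)
  have as2: "1 - 2 * a * a + a\<^sup>2 = s\<^sup>2" unfolding s2 by (simp add: power2_eq_square)
  have "(\<integral>x. (cmod (v x))\<^sup>2 \<partial>m) = (1 - 2 * a * a + a\<^sup>2) / s\<^sup>2"
    unfolding v2 using \<phi>(1) iu by (simp add: \<phi>1 a_def[symmetric] m.prob_space)
  also have "\<dots> = 1" unfolding as2 using s by simp
  finally have v1: "L2_norm m v = 1" by (simp add: L2_norm_def)
  have "L2_norm m (\<lambda>x. koopman coset_action g v x - v x) \<le> 2 * t" if g: "g \<in> K" for g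
  proof -
    have \<phi>g: "integrable m (\<lambda>x. \<phi> (coset_action (- g) x))" using \<phi>(1) by (rule integrable_action)
    have pt: "(cmod (koopman coset_action g v x - v x))\<^sup>2 \<le> \<bar>\<phi> (coset_action (- g) x) - \<phi> x\<bar> / s\<^sup>2" for x
    proof -
      have "koopman coset_action g v x - v x = complex_of_real ((u (coset_action (- g) x) - u x) / s)"
        by (simp add: koopman_def v_def diff_divide_distrib)
      then have "(cmod (koopman coset_action g v x - v x))\<^sup>2 = (u (coset_action (- g) x) - u x)\<^sup>2 / s\<^sup>2"
        by (simp add: power_divide del: of_real_divide of_real_diff)
      also have "\<dots> \<le> \<bar>\<phi> (coset_action (- g) x) - \<phi> x\<bar> / s\<^sup>2"
        unfolding u_def using \<phi>(2) by (intro divide_right_mono sqrt_diff_square_le) auto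
      finally show ?thesis .
    qed
    have ib: "integrable m (\<lambda>x. \<bar>\<phi> (coset_action (- g) x) - \<phi> x\<bar> / s\<^sup>2)" using \<phi>(1) \<phi>g by simp
    have "(\<integral>x. (cmod (koopman coset_action g v x - v x))\<^sup>2 \<partial>m)
        \<le> (\<integral>x. \<bar>\<phi> (coset_action (- g) x) - \<phi> x\<bar> / s\<^sup>2 \<partial>m)"
    proof (intro integral_mono ib pt)
      show "integrable m (\<lambda>x. (cmod (koopman coset_action g v x - v x))\<^sup>2)"
        using pt unfolding koopman_def
        by (intro Bochner_Integration.integrable_bound[OF ib] AE_I2) (auto simp: koopman_def)
    qed
    also have "\<dots> \<le> t\<^sup>2 / s\<^sup>2"
      using order_trans[OF push_forward_contraction[OF V(1) \<phi>(1) push] inv[OF g]] s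
      by (simp add: divide_right_mono)
    also have "\<dots> \<le> t\<^sup>2 / (1 / 4)" using aa s2 by (intro divide_left_mono) auto
    also have "\<dots> = (2 * t)\<^sup>2" by simp
    finally show ?thesis unfolding L2_norm_def using t by (intro real_le_lsqrt) auto
  qed
  then show ?thesis using vL v1 by blast
qed

end

text \<open>
  The vector number \<open>n\<close> is chosen for the compact set number \<open>n\<close> of an exhaustion and a tolerance tending to 0;
  every compact set lies in almost all members of the exhaustion.
\<close>

theorem not_cocompact_imp_almost_invariant_vectors:
  fixes \<mu> :: "'g::{topological_group_add, t2_space, second_countable_topology} measure"
  assumes "coset_probability \<mu> m H" and "haar_mean \<mu> M" and not_cocompact: "\<not> cocompact H"
  shows "has_almost_invariant_vectors coset_action m"
proof -
  interpret coset_probability \<mu> m H by fact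
  interpret haar_mean \<mu> M by fact
  obtain C :: "nat \<Rightarrow> 'g set" where C: "\<And>n. compact (C n)" "incseq C" "\<And>D. compact D \<Longrightarrow> \<exists>n. D \<subseteq> C n"
    using compact_exhaustion[OF locally_compact] by blast
  define t where "t n = 1 / (4 * real (Suc n))" for n
  have t: "0 < t n" "t n \<le> 1/4" for n by (auto simp: t_def field_simps)
  have "\<exists>v. v \<in> L2_0 m \<and> L2_norm m v = 1 \<and>
      (\<forall>g\<in>C n. L2_norm m (\<lambda>x. koopman coset_action g v x - v x) \<le> 2 * t n)" for n
  proof -
    have "(t n)\<^sup>2 > 0" using t[of n] by simp
    from reiter_condition[OF C(1)[of n] this] obtain V :: "'g \<Rightarrow> real" where V: "integrable \<mu> V"
      "\<forall>x. 0 \<le> V x" "(\<integral>x. V x \<partial>\<mu>) = 1"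
      "\<forall>g\<in>C n. (\<integral>x. \<bar>V (- g + x) - V x\<bar> \<partial>\<mu>) \<le> (t n)\<^sup>2"
      by (elim exE conjE) (rule that)
    then have "\<exists>v\<in>L2_0 m. L2_norm m v = 1 \<and>
      (\<forall>g\<in>C n. L2_norm m (\<lambda>x. koopman coset_action g v x - v x) \<le> 2 * t n)"
      by (intro almost_invariant_vector[OF not_cocompact t V(1)]) simp_all
    then show ?thesis by (simp only: Bex_def)
  qed
  then obtain v where v': "\<forall>n. v n \<in> L2_0 m \<and> L2_norm m (v n) = 1 \<and>
      (\<forall>g\<in>C n. L2_norm m (\<lambda>x. koopman coset_action g (v n) x - v n x) \<le> 2 * t n)"
    using choice[of "\<lambda>n v. v \<in> L2_0 m \<and> L2_norm m v = 1 \<and>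
      (\<forall>g\<in>C n. L2_norm m (\<lambda>x. koopman coset_action g v x - v x) \<le> 2 * t n)"] by auto
  have v: "v n \<in> L2_0 m" "L2_norm m (v n) = 1"
    "g \<in> C n \<Longrightarrow> L2_norm m (\<lambda>x. koopman coset_action g (v n) x - v n x) \<le> 2 * t n" for n g
    using v' by auto
  have "(\<lambda>n. SUP g\<in>K. ennreal (L2_norm m (\<lambda>x. koopman coset_action g (v n) x - v n x))) \<longlonglongrightarrow> 0"
    if K: "compact K" for K
  proof (rule tendsto_sandwich[OF _ _ tendsto_const])
    obtain N where N: "K \<subseteq> C N" using C(3)[OF K] by blast
    have "(SUP g\<in>K. ennreal (L2_norm m (\<lambda>x. koopman coset_action g (v n) x - v n x))) \<le> ennreal (2 * t n)"
      if "n \<ge> N" for n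
    proof (rule SUP_least)
      fix g assume "g \<in> K"
      then have "g \<in> C n" using N C(2) that by (auto simp: incseq_def)
      then show "ennreal (L2_norm m (\<lambda>x. koopman coset_action g (v n) x - v n x)) \<le> ennreal (2 * t n)"
        by (intro ennreal_leI v)
    qed
    then show "eventually (\<lambda>n. (SUP g\<in>K. ennreal (L2_norm m (\<lambda>x. koopman coset_action g (v n) x - v n x)))
        \<le> ennreal (2 * t n)) sequentially"
      by (auto simp: eventually_sequentially)
    have "(\<lambda>n. 1 / 2 * (1 / real (Suc n))) \<longlonglongrightarrow> 1 / 2 * 0"
      by (intro tendsto_intros LIMSEQ_Suc[OF lim_1_over_n])
    moreover have "2 * t n = 1 / 2 * (1 / real (Suc n))" for n by (simp add: t_def field_simps)
    ultimately have "(\<lambda>n. 2 * t n) \<longlonglongrightarrow> 0" by simp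
    then show "(\<lambda>n. ennreal (2 * t n)) \<longlonglongrightarrow> 0"
      using tendsto_ennrealI[of "\<lambda>n. 2 * t n" 0] by simp
  qed simp
  then show ?thesis
    unfolding has_almost_invariant_vectors_def using v(1,2) by (intro exI[of _ v]) simp
qed

theorem proposition1p8:
  fixes H :: "'g::{topological_group_add, t2_space, second_countable_topology} set"
  assumes "locally_compact_space (euclidean :: 'g topology)"
    and "amenable TYPE('g)"
    and "closed_subgroup H"
    and "finite_covolume H"
  shows "cocompact H \<longleftrightarrow> weakly_cocompact H"
proof -
  obtain \<mu> :: "'g measure" and M where \<mu>: "left_haar_measure \<mu>" and M: "mean_on_Linfty \<mu> M"
    "\<And>f g. f \<in> Linfty \<mu> \<Longrightarrow> M (\<lambda>x. f (g + x)) = M f"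
    using assms(2) unfolding amenable_def by blast
  have haar: "haar \<mu>" using \<mu> assms(1) by (rule haar.intro)
  have mean: "haar_mean \<mu> M"
    using haar M by (simp add: haar_mean_def haar_mean_axioms_def)
  have coset: "coset_probability \<mu> m H" if "invariant_coset_probability H m" for m
    using haar assms(3) that
    by (simp add: coset_probability_def coset_probability_axioms_def invariant_coset_probability_def)
  show ?thesis
  proof
    assume "cocompact H"
    then have "spectral_gap coset_action m" if "invariant_coset_probability H m" for m
      by (rule coset_probability.cocompact_imp_spectral_gap[OF coset[OF that]])
    then show "weakly_cocompact H" using assms(4) by (simp add: weakly_cocompact_def)
  next
    assume weak: "weakly_cocompact H"
    obtain m where m: "invariant_coset_probability H m"
      using assms(4) by (auto simp: finite_covolume_def)
    then have "spectral_gap coset_action m" using weak by (simp add: weakly_cocompact_def)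
    then show "cocompact H"
      using not_cocompact_imp_almost_invariant_vectors[OF coset[OF m] mean] by (auto simp: spectral_gap_def)
  qed
qed

end
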